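(* Let $f^0(x,y)$ be a curvature surface defined on $D=\{(x,y)\in\mathbb{R}^2:x>0\}$ and $F^0=[\phi,X^0_\alpha,X^0_\beta,\xi]$ the orthonormal frame field determining $f^0$. Let $\boldsymbol{n}(x,y):=(1+y^2)^{-1/2}(X^0_\beta+y\phi)(x,y)$, and let $\boldsymbol{v}_1(y),\boldsymbol{b}^\infty,\boldsymbol{c}^\infty,A(y),\mathbb{S}^2_y,w(x)$ be as in the context. Then we have the following facts as $x\to\infty$: (1) Each $x$-curve $\boldsymbol{n}(x,y)$ for $x\in[1,\infty)$ with fixed $y$ has infinite length, and the curve approaches the point $-\boldsymbol{v}_1(y)$ while winding uniformly around the point. Then, the curve never reaches $-\boldsymbol{v}_1(y)$ at any finite $x$. (2) There is a constant orthonormal base $[\hat{\boldsymbol{b}},\hat{\boldsymbol{c}}]$ of the plane spanned by $\boldsymbol{b}^\infty$ and $\boldsymbol{c}^\infty$ such that all $x$-curves $\xi(x,y)$ and $X^0_\alpha(x,y)$ (with any $y$) converge uniformly, respectively, to the circles expressed as $\bar{\boldsymbol{b}}(x)=\cos w(x)\,\hat{\boldsymbol{b}}-\sin w(x)\,\hat{\boldsymbol{c}}$ and $\bar{\boldsymbol{c}}(x)=\sin w(x)\,\hat{\boldsymbol{b}}+\cos w(x)\,\hat{\boldsymbol{c}}$. (3) Each $x$-curve $f^0(x,y)$ converges uniformly to the following circle of $\mathbb{S}^2_y$: $$-\frac{1}{2\sqrt5}(1+y^2)^{-1/2}\Big(\boldsymbol{v}_1(y)+2(1+y^2)^{1/2}\,\bar{\boldsymbol{b}}(x)\Big)+A(y).$$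 The convergences for the $x$-curves in (2) and (3) are uniform in the wider sense with respect to $y\in\mathbb{R}$.
   Context: $X_0(x)=\frac52+\sum_{k\ge1}a_kx^{2k}$ (analytic on $\mathbb{R}$), where the coefficients are given by $a_1=1$, $2(k+1)(4k^2+\frac54)a_{k+1}+(2k-1)a_k=0$ $(k\ge1)$. $h(x,y)=2X_0-xX_0'+y^2\frac{X_0'}{x}+\sqrt5$ (positive). On $D$ define the functions (not to be confused with the coefficients above) $a_1=\frac{2y}{xh}(X_0+\frac{\sqrt5}{2})$, $b_1=-\frac{1}{xh}(X_0+\frac{\sqrt5}{2}+\sqrt5(x^2-y^2))$, $c_1=-\frac{2}{xh}(X_0+\frac{\sqrt5}{2})$, $a_2=-\frac1h(2X_0+\sqrt5-(x^2+y^2)\frac{X_0'}{x})$, $b_2=-\frac{2y}{h}(\frac{X_0'}{2x}+\sqrt5)$, $c_2=\frac{2y}{h}(X_0''-\frac{X_0'}{x})$. The frame field is an analytic orthonormal frame field $F^0=[\phi,X^0_\alpha,X^0_\beta,\xi]$ of $\mathbb{R}^4$ on $D$ satisfying $\phi_x=-a_1X^0_\alpha$, $\xi_x=b_1X^0_\alpha$, $(X^0_\beta)_x=c_1X^0_\alpha$, $(X^0_\alpha)_x=a_1\phi-b_1\xi-c_1X^0_\beta$, $\phi_y=-a_2X^0_\beta$, $\xi_y=b_2X^0_\beta$, $(X^0_\alpha)_y=c_2X^0_\beta$, $(X^0_\beta)_y=a_2\phi-b_2\xi-c_2X^0_\alpha$ (it exists and is unique up to left multiplication by a constant orthogonal matrix).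 The curvature surface $f^0:D\to\mathbb{R}^4$ determined by $F^0$ is the analytic map, unique up to translation, with $df^0=\frac{x^2-y^2}{xh}X^0_\alpha dx+\frac{2y}{h}X^0_\beta dy$. $\boldsymbol{u}(y)=(1+y^2)^{-1/2}(yX^0_\beta-\phi)(x,y)$ is independent of $x$; $\boldsymbol{v}_1(y)$ is the continuous unit vector function with $\frac{d\boldsymbol{u}}{dy}=\frac{y^2}{1+y^2}\boldsymbol{v}_1$. The vector $\boldsymbol{n}(x,y)$ is a unit vector perpendicular to $\boldsymbol{u}(y)$. $A(y)=f^0(x,y)-\frac{1}{2\sqrt5(1+y^2)}(X^0_\beta-2(1+y^2)\xi+y\phi)(x,y)$ is independent of $x$, and $\mathbb{S}^2_y$ is the $2$-sphere with center $A(y)$ and radius $\frac{1}{2\sqrt5}\sqrt{\frac{5+4y^2}{1+y^2}}$ in the affine hyperplane through $A(y)$ perpendicular to $\boldsymbol{u}(y)$; it contains the $x$-curve $f^0(\cdot,y)$. $(\boldsymbol{b}^\infty,\boldsymbol{c}^\infty)$ is the orthonormal pair of constant vectors such that $X^0_\alpha(e^{-u},y)-(\cos\frac{\sqrt5u}{2}\boldsymbol{b}^\infty-\sin\frac{\sqrt5u}{2}\boldsymbol{c}^\infty)\to0$ as $u\to\infty$ for every $y$; $[\boldsymbol{u}(y),\boldsymbol{v}_1(y),\boldsymbol{b}^\infty,\boldsymbol{c}^\infty]$ is orthonormal for every $y$. $w(x):=\sqrt5\int_0^x\frac{s}{2X_0(s)-sX_0'(s)}\,ds$ (the denominator is positive).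 An $x$-curve is the curve obtained by fixing $y$. "$M(x)$ converges uniformly to $N(x)$ as $x\to\infty$" means that for any $\varepsilon>0$ there is a number $R$ with $\|M(x)-N(x)\|<\varepsilon$ for $x>R$; "uniform in the wider sense with respect to $y$" means that $R$ can be chosen independently of $y$ in each bounded closed interval. *)

theory Defs
  imports "HOL-Analysis.Analysis"
begin

text \<open>
  Maps on \<open>D = {(x, y). x > 0}\<close> are curried functions \<open>real \<Rightarrow> real \<Rightarrow> real^4\<close>;
  their values at \<open>x \<le> 0\<close> are irrelevant.
\<close>

subsection \<open>The function \<open>X\<^sub>0\<close> and the coefficients of the structure equations\<close>

text \<open>The value at index \<open>0\<close> is not used: the constant term of \<open>X\<^sub>0\<close> is \<open>5/2\<close>.\<close>

fun X0_coeff :: "nat \<Rightarrow> real" where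
  "X0_coeff 0 = 0"
| "X0_coeff (Suc 0) = 1"
| "X0_coeff (Suc (Suc j)) =
     (let k = real (Suc j)
      in - ((2 * k - 1) * X0_coeff (Suc j)) / (2 * (k + 1) * (4 * k ^ 2 + 5 / 4)))"

definition X0 :: "real \<Rightarrow> real" where
  "X0 x = 5 / 2 + (\<Sum>j. X0_coeff (Suc j) * x ^ (2 * Suc j))"

definition X0' :: "real \<Rightarrow> real" where "X0' = deriv X0"

definition X0'' :: "real \<Rightarrow> real" where "X0'' = deriv X0'"

definition hfun :: "real \<Rightarrow> real \<Rightarrow> real" where
  "hfun x y = 2 * X0 x - x * X0' x + y ^ 2 * (X0' x / x) + sqrt 5"

definition a1 :: "real \<Rightarrow> real \<Rightarrow> real" where
  "a1 x y = 2 * y / (x * hfun x y) * (X0 x + sqrt 5 / 2)"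

definition b1 :: "real \<Rightarrow> real \<Rightarrow> real" where
  "b1 x y = - (1 / (x * hfun x y)) * (X0 x + sqrt 5 / 2 + sqrt 5 * (x ^ 2 - y ^ 2))"

definition c1 :: "real \<Rightarrow> real \<Rightarrow> real" where
  "c1 x y = - (2 / (x * hfun x y)) * (X0 x + sqrt 5 / 2)"

definition a2 :: "real \<Rightarrow> real \<Rightarrow> real" where
  "a2 x y = - (1 / hfun x y) * (2 * X0 x + sqrt 5 - (x ^ 2 + y ^ 2) * (X0' x / x))"

definition b2 :: "real \<Rightarrow> real \<Rightarrow> real" where
  "b2 x y = - (2 * y / hfun x y) * (X0' x / (2 * x) + sqrt 5)"

definition c2 :: "real \<Rightarrow> real \<Rightarrow> real" where
  "c2 x y = 2 * y / hfun x y * (X0'' x - X0' x / x)"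

definition wfun :: "real \<Rightarrow> real" where
  "wfun x = sqrt 5 * integral {0..x} (\<lambda>s. s / (2 * X0 s - s * X0' s))"


subsection \<open>Frame fields and curvature surfaces\<close>

definition analytic_on_D :: "(real \<Rightarrow> real \<Rightarrow> real^4) \<Rightarrow> bool" where
  "analytic_on_D g \<longleftrightarrow>
     (\<forall>x0>0. \<forall>y0. \<exists>r>0. \<exists>C :: nat \<Rightarrow> nat \<Rightarrow> real^4.
        \<forall>x y. \<bar>x - x0\<bar> < r \<and> \<bar>y - y0\<bar> < r \<longrightarrow>
          ((\<lambda>(i, j). ((x - x0) ^ i * (y - y0) ^ j) *\<^sub>R C i j) has_sum g x y) UNIV)"

definition orthonormal_list :: "(real^4) list \<Rightarrow> bool" where
  "orthonormal_list vs \<longleftrightarrow>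
     (\<forall>i<length vs. \<forall>j<length vs. vs ! i \<bullet> vs ! j = (if i = j then 1 else 0))"

definition frame_field ::
  "(real \<Rightarrow> real \<Rightarrow> real^4) \<Rightarrow> (real \<Rightarrow> real \<Rightarrow> real^4) \<Rightarrow>
   (real \<Rightarrow> real \<Rightarrow> real^4) \<Rightarrow> (real \<Rightarrow> real \<Rightarrow> real^4) \<Rightarrow> bool"
where
  "frame_field \<phi> X\<alpha> X\<beta> \<xi> \<longleftrightarrow>
     analytic_on_D \<phi> \<and> analytic_on_D X\<alpha> \<and> analytic_on_D X\<beta> \<and> analytic_on_D \<xi> \<and>
     (\<forall>x>0. \<forall>y.
        orthonormal_list [\<phi> x y, X\<alpha> x y, X\<beta> x y, \<xi> x y] \<and>
        ((\<lambda>t. \<phi> t y) has_vector_derivative - a1 x y *\<^sub>R X\<alpha> x y) (at x) \<and>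
        ((\<lambda>t. \<xi> t y) has_vector_derivative b1 x y *\<^sub>R X\<alpha> x y) (at x) \<and>
        ((\<lambda>t. X\<beta> t y) has_vector_derivative c1 x y *\<^sub>R X\<alpha> x y) (at x) \<and>
        ((\<lambda>t. X\<alpha> t y) has_vector_derivative
           a1 x y *\<^sub>R \<phi> x y - b1 x y *\<^sub>R \<xi> x y - c1 x y *\<^sub>R X\<beta> x y) (at x) \<and>
        ((\<lambda>t. \<phi> x t) has_vector_derivative - a2 x y *\<^sub>R X\<beta> x y) (at y) \<and>
        ((\<lambda>t. \<xi> x t) has_vector_derivative b2 x y *\<^sub>R X\<beta> x y) (at y) \<and>
        ((\<lambda>t. X\<alpha> x t) has_vector_derivative c2 x y *\<^sub>R X\<beta> x y) (at y) \<and>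
        ((\<lambda>t. X\<beta> x t) has_vector_derivative
           a2 x y *\<^sub>R \<phi> x y - b2 x y *\<^sub>R \<xi> x y - c2 x y *\<^sub>R X\<alpha> x y) (at y))"

definition curvature_surface ::
  "(real \<Rightarrow> real \<Rightarrow> real^4) \<Rightarrow> (real \<Rightarrow> real \<Rightarrow> real^4) \<Rightarrow> (real \<Rightarrow> real \<Rightarrow> real^4) \<Rightarrow> bool"
where
  "curvature_surface X\<alpha> X\<beta> f \<longleftrightarrow>
     analytic_on_D f \<and>
     (\<forall>x>0. \<forall>y.
        ((\<lambda>(s, t). f s t) has_derivative
           (\<lambda>(dx, dy). (((x ^ 2 - y ^ 2) / (x * hfun x y)) * dx) *\<^sub>R X\<alpha> x y
                      + ((2 * y / hfun x y) * dy) *\<^sub>R X\<beta> x y)) (at (x, y)))"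


subsection \<open>Objects derived from the frame field and the surface\<close>

text \<open>The value at \<open>y\<close> of a map on \<open>D\<close> that does not depend on \<open>x > 0\<close>.\<close>

definition x_independent_value :: "(real \<Rightarrow> real \<Rightarrow> real^4) \<Rightarrow> real \<Rightarrow> real^4" where
  "x_independent_value g y = (THE p. \<forall>x>0. g x y = p)"

definition u_vec ::
  "(real \<Rightarrow> real \<Rightarrow> real^4) \<Rightarrow> (real \<Rightarrow> real \<Rightarrow> real^4) \<Rightarrow> real \<Rightarrow> real^4"
where
  "u_vec \<phi> X\<beta> =
     x_independent_value (\<lambda>x y. (1 / sqrt (1 + y ^ 2)) *\<^sub>R (y *\<^sub>R X\<beta> x y - \<phi> x y))"

definition n_vec ::
  "(real \<Rightarrow> real \<Rightarrow> real^4) \<Rightarrow> (real \<Rightarrow> real \<Rightarrow> real^4) \<Rightarrow> real \<Rightarrow> real \<Rightarrow> real^4"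
where
  "n_vec \<phi> X\<beta> x y = (1 / sqrt (1 + y ^ 2)) *\<^sub>R (X\<beta> x y + y *\<^sub>R \<phi> x y)"

definition A_center ::
  "(real \<Rightarrow> real \<Rightarrow> real^4) \<Rightarrow> (real \<Rightarrow> real \<Rightarrow> real^4) \<Rightarrow>
   (real \<Rightarrow> real \<Rightarrow> real^4) \<Rightarrow> (real \<Rightarrow> real \<Rightarrow> real^4) \<Rightarrow> real \<Rightarrow> real^4"
where
  "A_center \<phi> X\<beta> \<xi> f =
     x_independent_value (\<lambda>x y. f x y - (1 / (2 * sqrt 5 * (1 + y ^ 2))) *\<^sub>R
       (X\<beta> x y - (2 * (1 + y ^ 2)) *\<^sub>R \<xi> x y + y *\<^sub>R \<phi> x y))"

definition S2 ::
  "(real \<Rightarrow> real \<Rightarrow> real^4) \<Rightarrow> (real \<Rightarrow> real \<Rightarrow> real^4) \<Rightarrow>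
   (real \<Rightarrow> real \<Rightarrow> real^4) \<Rightarrow> (real \<Rightarrow> real \<Rightarrow> real^4) \<Rightarrow> real \<Rightarrow> (real^4) set"
where
  "S2 \<phi> X\<beta> \<xi> f y =
     {p. (p - A_center \<phi> X\<beta> \<xi> f y) \<bullet> u_vec \<phi> X\<beta> y = 0 \<and>
         dist p (A_center \<phi> X\<beta> \<xi> f y) = 1 / (2 * sqrt 5) * sqrt ((5 + 4 * y ^ 2) / (1 + y ^ 2))}"

text \<open>Since \<open>du/dy\<close> vanishes at \<open>y = 0\<close>, continuity is what determines \<open>v\<^sub>1 0\<close>.\<close>

definition is_v1 ::
  "(real \<Rightarrow> real \<Rightarrow> real^4) \<Rightarrow> (real \<Rightarrow> real \<Rightarrow> real^4) \<Rightarrow> (real \<Rightarrow> real^4) \<Rightarrow> bool"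
where
  "is_v1 \<phi> X\<beta> v1 \<longleftrightarrow>
     continuous_on UNIV v1 \<and> (\<forall>y. norm (v1 y) = 1) \<and>
     (\<forall>y. (u_vec \<phi> X\<beta> has_vector_derivative (y ^ 2 / (1 + y ^ 2)) *\<^sub>R v1 y) (at y))"

definition is_limit_pair :: "(real \<Rightarrow> real \<Rightarrow> real^4) \<Rightarrow> real^4 \<Rightarrow> real^4 \<Rightarrow> bool" where
  "is_limit_pair X\<alpha> b c \<longleftrightarrow>
     orthonormal_list [b, c] \<and>
     (\<forall>y. ((\<lambda>t. X\<alpha> (exp (- t)) y - (cos (sqrt 5 * t / 2) *\<^sub>R b - sin (sqrt 5 * t / 2) *\<^sub>R c))
            \<longlongrightarrow> 0) at_top)"

definition b_bar :: "real^4 \<Rightarrow> real^4 \<Rightarrow> real \<Rightarrow> real^4" where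
  "b_bar b c x = cos (wfun x) *\<^sub>R b - sin (wfun x) *\<^sub>R c"

definition c_bar :: "real^4 \<Rightarrow> real^4 \<Rightarrow> real \<Rightarrow> real^4" where
  "c_bar b c x = sin (wfun x) *\<^sub>R b + cos (wfun x) *\<^sub>R c"


subsection \<open>Curves on \<open>[1, \<infinity>)\<close> and convergence\<close>

definition infinite_length :: "(real \<Rightarrow> real^4) \<Rightarrow> bool" where
  "infinite_length \<gamma> \<longleftrightarrow>
     (\<forall>x\<ge>1. \<gamma> differentiable (at x)) \<and>
     filterlim (\<lambda>R. integral {1..R} (\<lambda>x. norm (vector_derivative \<gamma> (at x)))) at_top at_top"

text \<open>
  Uniform winding of \<open>\<gamma>\<close> around \<open>p\<close>, where the orthonormal vectors \<open>e1\<close>, \<open>e2\<close> span the tangent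
  plane at \<open>p\<close> of a 2-sphere containing \<open>\<gamma>\<close>. Here \<open>\<rho>\<close>, \<open>\<theta>\<close> are polar coordinates about \<open>p\<close> of
  the orthogonal projection of \<open>\<gamma>\<close> to that plane. The curve always turns in the same sense, with
  angular speed between positive constants, and its mean angular velocity tends to a nonzero
  constant; in particular it makes infinitely many turns. One cannot ask for \<open>\<theta>'\<close> itself to
  converge: for the curves of \<open>n_vec\<close> it stays asymptotically periodic and nonconstant.
\<close>

definition winds_uniformly_around ::
  "(real \<Rightarrow> real^4) \<Rightarrow> real^4 \<Rightarrow> real^4 \<Rightarrow> real^4 \<Rightarrow> bool"
where
  "winds_uniformly_around \<gamma> p e1 e2 \<longleftrightarrow>
     (\<exists>\<rho> \<theta> \<theta>' :: real \<Rightarrow> real. \<exists>\<sigma> \<in> {1, -1}. \<exists>m>0. \<exists>M. \<exists>\<omega>. \<omega> \<noteq> 0 \<and>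
        (\<forall>x\<ge>1. \<rho> x > 0 \<and>
               (\<gamma> x - p) \<bullet> e1 = \<rho> x * cos (\<theta> x) \<and>
               (\<gamma> x - p) \<bullet> e2 = \<rho> x * sin (\<theta> x) \<and>
               (\<theta> has_real_derivative \<theta>' x) (at x within {1..}) \<and>
               m \<le> \<sigma> * \<theta>' x \<and> \<sigma> * \<theta>' x \<le> M) \<and>
        ((\<lambda>x. \<theta> x / x) \<longlongrightarrow> \<omega>) at_top)"

text \<open>Convergence as \<open>x \<rightarrow> \<infinity>\<close>, uniform in the wider sense with respect to \<open>y\<close>.\<close>

definition converges_locally_uniformly ::
  "(real \<Rightarrow> real \<Rightarrow> real^4) \<Rightarrow> (real \<Rightarrow> real \<Rightarrow> real^4) \<Rightarrow> bool"
where
  "converges_locally_uniformly M N \<longleftrightarrow>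
     (\<forall>p q. uniform_limit {p..q} (\<lambda>x y. M x y - N x y) (\<lambda>y. 0) at_top)"

end

theory Submission
  imports Defs
begin

text \<open>
  With \<open>P = X\<^sub>0'/x\<close> and \<open>R = x P'\<close>, the third-order equation for \<open>X\<^sub>0\<close> becomes
  \<open>x R' = X\<^sub>0 - (x\<^sup>2 + 5/4) P\<close> with first integral \<open>2 X\<^sub>0 P - (x\<^sup>2 + 5/4) P\<^sup>2 - R\<^sup>2 = 5\<close>. Hence
  \<open>X\<^sub>0 \<approx> C x\<close>, and \<open>(q, R)\<close> with \<open>q = X\<^sub>0' - X\<^sub>0/x\<close> rotates asymptotically on the circle of radius
  \<open>\<surd>(C\<^sup>2 - 5)\<close>. Expressing \<open>u'(y)\<close> in the moving frame gives \<open>v\<^sub>1 = -n + O(1/x)\<close> with explicit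
  coefficients along \<open>\<xi>\<close> and \<open>X\<^sub>\<alpha>\<close>. The angular speed of \<open>n\<close> about \<open>-v\<^sub>1\<close> is therefore explicit and
  independent of \<open>y\<close>, and its mean is \<open>1\<close>. For \<open>y = 0\<close>, rotating \<open>(\<xi>, X\<^sub>\<alpha>)\<close> back by the angle
  \<open>w + R/H\<close>, where \<open>H = 2 X\<^sub>0 - x X\<^sub>0'\<close>, leaves a pair whose derivative orthogonal to \<open>v\<^sub>1\<close> is
  \<open>O(1/x\<^sup>2)\<close>, so that it converges. The \<open>y\<close>-derivatives of \<open>\<xi>\<close> and \<open>X\<^sub>\<alpha>\<close> are \<open>O(1/x)\<close>, which extends
  the limit to all \<open>y\<close>, and \<open>f - A\<close> is a combination of \<open>n\<close> and \<open>\<xi>\<close>.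
\<close>

section \<open>The function \<open>X\<^sub>0\<close>\<close>

text \<open>Error terms are controlled by uniform bounds on \<open>[1, \<infinity>)\<close>: an
  upper bound for \<open>cX\<close> and positive lower bounds for \<open>cX - qX\<close> and
  \<open>cX + qX\<close>, all resting on the first integral. The obstacle is oscillation. The
  angular speed of \<open>n\<close> oscillates with \<open>(qX, R)\<close>, so its mean is read off
  from a bounded function, \<open>phase\<close>, whose derivative is the speed minus 1 up to O(1/x).
  Likewise \<xi> and \<open>X\<alpha>\<close> rotate forever, and a remainder of order 1/x in the
  derivative of the pair rotated back would not be integrable. The choice of \<open>R/H\<close>
  comes from the first integral: it makes the derivative of \<open>R/H\<close> cancel the 1/x term
  of \<open>w' + b1(x, 0)\<close> up to O(1/x^2). A second difficulty is that \<open>b\<close> and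
  \<open>c\<close> are defined by the behaviour as x tends to 0, while the claims concern x tending
  to infinity. The two ends are linked by the plane orthogonal to \<open>u y\<close> and
  \<open>v1 y\<close>. It contains \<open>b\<close> and \<open>c\<close> for every y, because
  \<open>R 0 = 0\<close> makes the inner product of \<open>v1 y\<close> and \<open>X\<alpha>\<close>
  vanish as x tends to 0.\<close>

definition entire_coeffs :: "(nat \<Rightarrow> real) \<Rightarrow> bool" where
  "entire_coeffs a \<longleftrightarrow> (\<forall>t. summable (\<lambda>n. a n * t ^ n))"

definition pser :: "(nat \<Rightarrow> real) \<Rightarrow> real \<Rightarrow> real" where
  "pser a t = (\<Sum>n. a n * t ^ n)"

lemma entire_coeffs_diffs: "entire_coeffs a \<Longrightarrow> entire_coeffs (diffs a)"
  unfolding entire_coeffs_def using termdiff_converges_all by blast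

lemma pser_deriv:
  assumes "entire_coeffs a"
  shows "(pser a has_real_derivative pser (diffs a) t) (at t)"
proof -
  have "((\<lambda>x. \<Sum>n. a n * x ^ n) has_real_derivative (\<Sum>n. diffs a n * t ^ n)) (at t)"
    by (rule termdiffs_strong_converges_everywhere) (use assms in \<open>auto simp: entire_coeffs_def\<close>)
  then show ?thesis by (simp add: pser_def[abs_def])
qed

text \<open>The Euler operator t d/dt multiplies the n-th coefficient by n. This is what turns a
  recurrence with polynomial coefficients into a differential equation.\<close>

lemma pser_euler:
  assumes "entire_coeffs a"
  shows "(\<lambda>n. (real n * a n) * t ^ n) sums (t * pser (diffs a) t)"
proof -
  have "summable (\<lambda>n. diffs a n * t ^ n)"
    using entire_coeffs_diffs[OF assms] by (simp add: entire_coeffs_def)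
  from diffs_equiv[OF this]
  have "(\<lambda>n. t * (of_nat n * a n * t ^ (n - Suc 0))) sums (t * pser (diffs a) t)"
    unfolding pser_def by (rule sums_mult)
  moreover have "t * (of_nat n * a n * t ^ (n - Suc 0)) = (real n * a n) * t ^ n" for n
    by (cases n) auto
  ultimately show ?thesis by simp
qed

lemma entire_coeffs_euler: "entire_coeffs a \<Longrightarrow> entire_coeffs (\<lambda>n. real n * a n)"
  unfolding entire_coeffs_def[of "\<lambda>n. real n * a n"] using pser_euler sums_summable by blast

lemma pser_euler_eq: "entire_coeffs a \<Longrightarrow> pser (\<lambda>n. real n * a n) t = t * pser (diffs a) t"
  using pser_euler[of a t] by (simp add: pser_def sums_iff)

lemma pser_sums: "entire_coeffs a \<Longrightarrow> (\<lambda>n. a n * t ^ n) sums pser a t"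
  by (simp add: entire_coeffs_def pser_def summable_sums)

section \<open>The coefficients of \<open>X0\<close> and the differential equations\<close>

definition X0c :: "nat \<Rightarrow> real" where
  "X0c n = (if n = 0 then 5 / 2 else X0_coeff n)"

text \<open>The constant term 5/2 makes the recurrence valid at k = 0 too, where it reads 5/2 * a_1
  = a_0 with a_1 = 1.\<close>

lemma X0c_rec: "X0c (Suc k) * (real k + 1) * (8 * real k ^ 2 + 5 / 2) = - (2 * real k - 1) * X0c k"
proof (cases k)
  case (Suc j)
  define r where "r = real (Suc j)"
  have "4 * r\<^sup>2 + 5 / 4 > 0" "r + 1 > 0" unfolding r_def by (auto intro: add_nonneg_pos)
  then have "X0c (Suc (Suc j)) = - ((2 * r - 1) * X0_coeff (Suc j)) / (2 * (r + 1) * (4 * r\<^sup>2 + 5 / 4))"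
    and "2 * (r + 1) * (4 * r\<^sup>2 + 5 / 4) \<noteq> 0"
    by (auto simp: X0c_def r_def Let_def)
  then have "X0c (Suc (Suc j)) * (2 * (r + 1) * (4 * r\<^sup>2 + 5 / 4)) = - ((2 * r - 1) * X0_coeff (Suc j))"
    by (metis nonzero_divide_eq_eq)
  then show ?thesis unfolding Suc r_def[symmetric] by (simp add: X0c_def field_simps del: X0_coeff.simps)
qed (simp add: X0c_def)

lemma X0c_ratio: "\<bar>X0c (Suc k)\<bar> * (real k + 1) \<le> \<bar>X0c k\<bar>"
proof -
  have pos: "8 * real k ^ 2 + 5 / 2 > 0" by (simp add: add_nonneg_pos)
  \<comment> \<open>Expanding the first square gives
    \<open>2 * k \<le> 8 * k^2 + 1/8\<close>.\<close>
  have "0 \<le> (8 * real k - 1)\<^sup>2" "0 \<le> (real k)\<^sup>2" by simp_all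
  then have le: "\<bar>2 * real k - 1\<bar> \<le> 8 * real k ^ 2 + 5 / 2"
    unfolding abs_le_iff power2_diff by (simp add: power_mult_distrib)
  have "(\<bar>X0c (Suc k)\<bar> * (real k + 1)) * (8 * real k ^ 2 + 5 / 2) = \<bar>2 * real k - 1\<bar> * \<bar>X0c k\<bar>"
    using arg_cong[OF X0c_rec[of k], of abs] pos by (simp add: abs_mult abs_minus_commute)
  also have "\<dots> \<le> \<bar>X0c k\<bar> * (8 * real k ^ 2 + 5 / 2)"
    using mult_right_mono[OF le, of "\<bar>X0c k\<bar>"] by (simp add: mult.commute)
  finally show ?thesis using pos by (rule mult_right_le_imp_le)
qed

lemma entire_X0c: "entire_coeffs X0c"
  unfolding entire_coeffs_def
proof
  fix t :: real
  obtain N :: nat where N: "2 * \<bar>t\<bar> \<le> real N" using real_arch_simple by blast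
  show "summable (\<lambda>n. X0c n * t ^ n)"
  proof (rule summable_ratio_test[where c = "1/2" and N = N])
    fix n assume "N \<le> n"
    then have n: "2 * \<bar>t\<bar> \<le> real n + 1" using N by linarith
    have "\<bar>X0c (Suc n)\<bar> * (2 * \<bar>t\<bar>) \<le> \<bar>X0c n\<bar>"
      using mult_left_mono[OF n, of "\<bar>X0c (Suc n)\<bar>"] X0c_ratio[of n] by linarith
    then have "\<bar>X0c (Suc n)\<bar> * (2 * \<bar>t\<bar>) * \<bar>t\<bar> ^ n \<le> \<bar>X0c n\<bar> * \<bar>t\<bar> ^ n"
      by (intro mult_right_mono) auto
    then show "norm (X0c (Suc n) * t ^ Suc n) \<le> 1 / 2 * norm (X0c n * t ^ n)"
      by (simp add: abs_mult power_abs mult_ac)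
  qed simp
qed

text \<open>\<open>P\<close> and \<open>R\<close> denote \<open>X\<^sub>0'/x\<close> and \<open>x P'\<close>, \<open>H\<close> is the denominator in \<open>w\<close>.\<close>

definition P :: "real \<Rightarrow> real" where "P x = 2 * pser (diffs X0c) (x\<^sup>2)"

definition R :: "real \<Rightarrow> real" where "R x = 4 * pser (\<lambda>n. real n * diffs X0c n) (x\<^sup>2)"

definition H :: "real \<Rightarrow> real" where "H x = 2 * X0 x - x\<^sup>2 * P x"

lemma X0_eq: "X0 x = pser X0c (x\<^sup>2)"
proof -
  have s: "summable (\<lambda>n. X0c n * (x\<^sup>2) ^ n)" using entire_X0c by (simp add: entire_coeffs_def)
  have "pser X0c (x\<^sup>2) = (\<Sum>n. X0c (Suc n) * (x\<^sup>2) ^ Suc n) + X0c 0"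
    unfolding pser_def using suminf_split_head[OF s] by simp
  also have "(\<Sum>n. X0c (Suc n) * (x\<^sup>2) ^ Suc n) = (\<Sum>j. X0_coeff (Suc j) * x ^ (2 * Suc j))"
    by (intro arg_cong[where f = suminf] ext) (simp add: X0c_def power_mult[symmetric] del: power_Suc)
  finally show ?thesis by (simp only: X0_def) (simp add: X0c_def)
qed

lemma pser_square_deriv:
  assumes "entire_coeffs a"
  shows "((\<lambda>x. pser a (x\<^sup>2)) has_real_derivative pser (diffs a) (x\<^sup>2) * (2 * x)) (at x)"
  by (rule DERIV_chain2[OF pser_deriv[OF assms]]) (auto intro!: derivative_eq_intros)

lemma X0_deriv: "(X0 has_real_derivative x * P x) (at x)"
proof -
  have "X0 = (\<lambda>x. pser X0c (x\<^sup>2))" by (auto simp: X0_eq)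
  then show ?thesis using pser_square_deriv[OF entire_X0c, of x] by (simp add: P_def mult_ac)
qed

text \<open>Unlike \<open>P_deriv\<close>, this form covers x = 0. Continuity of \<open>P\<close>
  there lets the first integral be evaluated from its initial values.\<close>

lemma P_deriv0: "(P has_real_derivative 4 * x * pser (diffs (diffs X0c)) (x\<^sup>2)) (at x)"
proof -
  have "P = (\<lambda>x. 2 * pser (diffs X0c) (x\<^sup>2))" by (auto simp: P_def)
  then show ?thesis
    using DERIV_cmult[OF pser_square_deriv[OF entire_coeffs_diffs[OF entire_X0c], of x], of 2]
    by (simp add: mult_ac)
qed

lemma P_deriv: "x \<noteq> 0 \<Longrightarrow> (P has_real_derivative R x / x) (at x)"
  using P_deriv0[of x]
  by (simp add: R_def pser_euler_eq[OF entire_coeffs_diffs[OF entire_X0c]] power2_eq_square mult_ac)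

text \<open>Put t = x^2, let g be the derivative of \<open>X0\<close> with respect to t and E = t
  d/dt. The recurrence says 8 E^2 g + 2 E X0 + 5/2 g - X0 = 0. Since P = 2 g, R = 4 E g, x R' = 8
  E^2 g and 2 E X0 = x^2 P, this is the claimed equation.\<close>

lemma R_deriv: "x \<noteq> 0 \<Longrightarrow> (R has_real_derivative (X0 x - (x\<^sup>2 + 5 / 4) * P x) / x) (at x)"
proof -
  assume x: "x \<noteq> 0"
  let ?g = "diffs X0c"
  have g: "entire_coeffs ?g" and ng: "entire_coeffs (\<lambda>n. real n * ?g n)"
    by (simp_all add: entire_coeffs_diffs entire_coeffs_euler entire_X0c)
  let ?t = "x\<^sup>2"
  have "(\<lambda>n. 8 * ((real n * (real n * ?g n)) * ?t ^ n) + 2 * ((real n * X0c n) * ?t ^ n)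
      + 5 / 2 * (?g n * ?t ^ n) - X0c n * ?t ^ n)
    sums (8 * (?t * pser (diffs (\<lambda>n. real n * ?g n)) ?t) + 2 * (?t * pser ?g ?t)
      + 5 / 2 * pser ?g ?t - pser X0c ?t)"
    by (intro sums_add sums_diff sums_mult pser_euler pser_sums g ng entire_X0c)
  moreover have "8 * ((real n * (real n * ?g n)) * ?t ^ n) + 2 * ((real n * X0c n) * ?t ^ n)
      + 5 / 2 * (?g n * ?t ^ n) - X0c n * ?t ^ n = 0" for n
  proof -
    have "8 * (real n * (real n * ?g n)) + 2 * (real n * X0c n) + 5 / 2 * ?g n - X0c n = 0"
      using X0c_rec[of n] by (simp add: diffs_def algebra_simps power2_eq_square)
    then have "(8 * (real n * (real n * ?g n)) + 2 * (real n * X0c n) + 5 / 2 * ?g n - X0c n) * ?t ^ n = 0"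
      by simp
    then show ?thesis by (simp add: algebra_simps)
  qed
  ultimately have "(\<lambda>n. 0) sums (8 * (?t * pser (diffs (\<lambda>n. real n * ?g n)) ?t) + 2 * (?t * pser ?g ?t)
      + 5 / 2 * pser ?g ?t - pser X0c ?t)"
    by (simp only:)
  then have "8 * (?t * pser (diffs (\<lambda>n. real n * ?g n)) ?t) + 2 * (?t * pser ?g ?t)
      + 5 / 2 * pser ?g ?t - pser X0c ?t = 0"
    using sums_unique2 sums_zero by blast
  then have eq: "8 * ?t * pser (diffs (\<lambda>n. real n * ?g n)) ?t = X0 x - (?t + 5 / 4) * P x"
    by (simp add: X0_eq P_def algebra_simps)
  have "R = (\<lambda>x. 4 * pser (\<lambda>n. real n * ?g n) (x\<^sup>2))" by (auto simp: R_def)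
  then have "(R has_real_derivative 8 * x * pser (diffs (\<lambda>n. real n * ?g n)) ?t) (at x)"
    using DERIV_cmult[OF pser_square_deriv[OF ng, of x], of 4] by (simp add: mult_ac)
  moreover have "8 * x * pser (diffs (\<lambda>n. real n * ?g n)) ?t = (X0 x - (?t + 5 / 4) * P x) / x"
    using x unfolding eq[symmetric] by (simp add: power2_eq_square)
  ultimately show ?thesis by simp
qed

lemma R_continuous: "isCont R x"
proof -
  have "R = (\<lambda>x. 4 * pser (\<lambda>n. real n * diffs X0c n) (x\<^sup>2))" by (auto simp: R_def)
  then show ?thesis
    using DERIV_isCont[OF DERIV_cmult[OF pser_square_deriv[OF entire_coeffs_euler[OF
      entire_coeffs_diffs[OF entire_X0c]], of x], of 4]] by simp
qed

lemma P_continuous: "isCont P x" using P_deriv0 DERIV_isCont by blast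

lemma X0_continuous: "isCont X0 x" using X0_deriv DERIV_isCont by blast

lemma pser_0: "pser a 0 = a 0"
  unfolding pser_def by (subst powser_zero[symmetric]) simp

lemma X0_0: "X0 0 = 5 / 2" by (simp add: X0_eq pser_0 X0c_def)
lemma P_0: "P 0 = 2" by (simp add: P_def pser_0 diffs_def X0c_def)
lemma R_0: "R 0 = 0" by (simp add: R_def pser_0)

lemma X0'_eq: "X0' x = x * P x"
  unfolding X0'_def by (rule DERIV_imp_deriv[OF X0_deriv])

lemma X0''_eq: "x \<noteq> 0 \<Longrightarrow> X0'' x = P x + R x"
proof -
  assume x: "x \<noteq> 0"
  have "((\<lambda>x. x * P x) has_real_derivative P x + R x) (at x)"
    using x by (auto intro!: derivative_eq_intros P_deriv)
  moreover have "X0' = (\<lambda>x. x * P x)" by (auto simp: X0'_eq)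
  ultimately show ?thesis unfolding X0''_def by (simp add: DERIV_imp_deriv)
qed

text \<open>This quadratic first integral is also the Gauss equation of the surface.\<close>

lemma first_integral:
  assumes "x \<ge> 0"
  shows "2 * X0 x * P x - (x\<^sup>2 + 5 / 4) * (P x)\<^sup>2 - (R x)\<^sup>2 = 5"
proof (cases "x = 0")
  case True then show ?thesis by (simp add: X0_0 P_0 R_0 power2_eq_square)
next
  case False
  then have x: "0 < x" using assms by simp
  let ?Q = "\<lambda>x. 2 * X0 x * P x - (x\<^sup>2 + 5 / 4) * (P x)\<^sup>2 - (R x)\<^sup>2"
  have "?Q x = ?Q 0"
  proof (rule DERIV_isconst2[of 0 x])
    show "continuous_on {0..x} ?Q"
      by (intro continuous_at_imp_continuous_on ballI continuous_intros X0_continuous P_continuous R_continuous)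
    fix z assume "0 < z" "z < x"
    then show "(?Q has_real_derivative 0) (at z)"
      by (auto intro!: derivative_eq_intros X0_deriv P_deriv R_deriv)
        (simp add: field_simps power2_eq_square)
  qed (use x in auto)
  then show ?thesis by (simp add: X0_0 P_0 R_0 power2_eq_square)
qed

section \<open>Positivity of \<open>P\<close>, \<open>H\<close> and \<open>X0\<close>\<close>

lemma H_times_P: "x \<ge> 0 \<Longrightarrow> H x * P x = 5 + 5 / 4 * (P x)\<^sup>2 + (R x)\<^sup>2"
  using first_integral[of x] by (simp add: H_def algebra_simps power2_eq_square)

text \<open>By \<open>H_times_P\<close>, a zero of \<open>P\<close> would force
  \<open>5 + R^2 = 0\<close>. Since \<open>P 0 = 2\<close>, the intermediate value theorem excludes
  nonpositive values.\<close>

lemma P_pos: assumes "x \<ge> 0" shows "P x > 0"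
proof (rule ccontr)
  have nz: "P z \<noteq> 0" if "z \<ge> 0" for z
  proof
    assume "P z = 0"
    then have "5 + (R z)\<^sup>2 = 0" using H_times_P[OF that] by simp
    then show False using zero_le_power2[of "R z"] by linarith
  qed
  assume "\<not> P x > 0"
  then have "\<exists>z. 0 \<le> z \<and> z \<le> x \<and> P z = 0"
    by (intro IVT2) (use assms P_continuous in \<open>auto simp: P_0\<close>)
  then show False using nz by blast
qed

lemma H_pos: assumes "x \<ge> 0" shows "H x > 0"
proof -
  have "H x * P x > 0" unfolding H_times_P[OF assms]
    using zero_le_power2[of "R x"] zero_le_power2[of "P x"] by linarith
  then show ?thesis using P_pos[OF assms] by (simp add: zero_less_mult_iff)
qed

lemma X0_pos: "x \<ge> 0 \<Longrightarrow> X0 x > 0"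
  using H_pos[of x] P_pos[of x] mult_nonneg_nonneg[of "x\<^sup>2" "P x"] unfolding H_def
  by (smt (verit) zero_le_power2)

section \<open>Asymptotics\<close>

lemma tendsto_0_of_O_inverse:
  fixes g :: "real \<Rightarrow> 'a::real_normed_vector"
  assumes "\<And>x. x \<ge> 1 \<Longrightarrow> norm (g x) \<le> K / x"
  shows "(g \<longlongrightarrow> 0) at_top"
proof (rule Lim_null_comparison)
  show "\<forall>\<^sub>F x in at_top. norm (g x) \<le> K / x"
    using eventually_ge_at_top[of 1] by eventually_elim (rule assms)
  show "((\<lambda>x. K / x) \<longlongrightarrow> 0) at_top"
    by (intro tendsto_divide_0[OF tendsto_const] filterlim_at_top_imp_at_infinity filterlim_ident)
qed

text \<open>The bound K/x^2 has the antiderivative -K/x, so the mean value inequality makes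
  increments beyond u at most K/u.\<close>

lemma convergent_of_quadratic_decay:
  fixes g :: "real \<Rightarrow> 'a::banach"
  assumes d: "\<And>x. x \<ge> 1 \<Longrightarrow> (g has_vector_derivative g' x) (at x)"
    and b: "\<And>x. x \<ge> 1 \<Longrightarrow> norm (g' x) \<le> K / x\<^sup>2"
  obtains L where "(g \<longlongrightarrow> L) at_top"
proof -
  have K: "K \<ge> 0" using order_trans[OF norm_ge_zero b[of 1]] by simp
  have est: "norm (g v - g u) \<le> K / u" if "1 \<le> u" "u \<le> v" for u v
  proof (cases "u = v")
    case True then show ?thesis using K that by simp
  next
    case False
    have "norm (g v - g u) \<le> (- K / v) - (- K / u)"
    proof (rule differentiable_bound_general[where \<phi>' = "\<lambda>x. K / x\<^sup>2" and f' = g'])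
      show "u < v" using False that by simp
      show "continuous_on {u..v} g"
        using that by (intro continuous_at_imp_continuous_on ballI)
          (auto intro: has_vector_derivative_continuous[OF d])
      show "continuous_on {u..v} (\<lambda>x. - K / x)" using that by (intro continuous_intros) auto
      fix x assume x: "u < x" "x < v"
      show "(g has_vector_derivative g' x) (at x)" using x that d by auto
      show "((\<lambda>x. - K / x) has_vector_derivative K / x\<^sup>2) (at x)"
        unfolding has_real_derivative_iff_has_vector_derivative[symmetric]
        using x that by (auto intro!: derivative_eq_intros simp: power2_eq_square)
      show "norm (g' x) \<le> K / x\<^sup>2" using x that b by auto
    qed
    also have "\<dots> \<le> K / u" using K that by simp
    finally show ?thesis .
  qed
  have lim0: "((\<lambda>x. K / x) \<longlongrightarrow> 0) at_top"
    by (intro tendsto_divide_0[OF tendsto_const] filterlim_at_top_imp_at_infinity filterlim_ident)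
  have small: "\<exists>N\<ge>1. K / N < e" if "e > 0" for e
    using eventually_conj[OF order_tendstoD(2)[OF lim0 that] eventually_ge_at_top[of 1]]
      eventually_happens[of _ "at_top::real filter"] by fastforce
  \<comment> \<open>The limit is first found along the integers; \<open>est\<close> then gives the
    rate K/u for real u.\<close>
  have "Cauchy (\<lambda>n. g (real n))"
  proof (rule CauchyI')
    fix e :: real assume "e > 0"
    then obtain N where N: "N \<ge> 1" "K / N < e" using small by blast
    obtain M :: nat where M: "N \<le> real M" using real_arch_simple by blast
    show "\<exists>M. \<forall>m\<ge>M. \<forall>n>m. dist (g (real m)) (g (real n)) < e"
    proof (intro exI allI impI)
      fix m n :: nat assume mn: "M \<le> m" "m < n"
      have "norm (g (real n) - g (real m)) \<le> K / real m" using mn M N by (intro est) auto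
      also have "\<dots> \<le> K / N" using mn M N K by (intro divide_left_mono) auto
      finally show "dist (g (real m)) (g (real n)) < e" using N by (simp add: dist_norm norm_minus_commute)
    qed
  qed
  then obtain L where L: "(\<lambda>n. g (real n)) \<longlonglongrightarrow> L" using Cauchy_convergent convergent_def by blast
  have "norm (g u - L) \<le> K / u" if "u \<ge> 1" for u
  proof (rule tendsto_upperbound)
    show "(\<lambda>n. norm (g u - g (real n))) \<longlonglongrightarrow> norm (g u - L)" by (intro tendsto_intros L)
    obtain M :: nat where "u \<le> real M" using real_arch_simple by blast
    then show "\<forall>\<^sub>F n in sequentially. norm (g u - g (real n)) \<le> K / u"
      unfolding eventually_sequentially using est[OF that] norm_minus_commute
      by (metis (no_types, lifting) of_nat_le_iff order_trans)
  qed simp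
  then have "((\<lambda>u. g u - L) \<longlongrightarrow> 0) at_top" by (rule tendsto_0_of_O_inverse)
  then show thesis using that LIM_zero_cancel by blast
qed

text \<open>As \<open>x \<rightarrow> \<infinity>\<close>, \<open>cX\<close> tends to a constant \<open>C\<close>, and \<open>(qX, R)\<close> rotates on a circle of radius
  \<open>\<surd>(C\<^sup>2 - 5)\<close>.\<close>

definition cX :: "real \<Rightarrow> real" where "cX x = X0 x / x"
definition qX :: "real \<Rightarrow> real" where "qX x = x * P x - X0 x / x"

section \<open>Algebraic relations between \<open>cX\<close>, \<open>qX\<close> and
  \<open>R\<close>\<close>

context fixes x :: real assumes x: "x > 0" begin

lemma X0_cX: "X0 x = x * cX x" using x by (simp add: cX_def)
lemma P_cX: "P x = (cX x + qX x) / x" using x by (simp add: cX_def qX_def)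
lemma H_cX: "H x = x * (cX x - qX x)"
  using x by (simp add: cX_def qX_def H_def algebra_simps power2_eq_square)

lemma cX_deriv: "(cX has_real_derivative qX x / x) (at x)"
  unfolding cX_def[abs_def] qX_def using x
  by (auto intro!: derivative_eq_intros X0_deriv simp: field_simps power2_eq_square)

lemma qX_deriv: "(qX has_real_derivative R x + cX x / x) (at x)"
  unfolding cX_def qX_def[abs_def] using x
  by (auto intro!: derivative_eq_intros X0_deriv P_deriv simp: field_simps power2_eq_square)

lemma R_deriv_cX: "(R has_real_derivative - qX x - 5 / 4 * (cX x + qX x) / x\<^sup>2) (at x)"
proof -
  have "(X0 x - (x\<^sup>2 + 5 / 4) * P x) / x = - qX x - 5 / 4 * (cX x + qX x) / x\<^sup>2"
    using x unfolding X0_cX P_cX by (simp add: field_simps power2_eq_square)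
  then show ?thesis using R_deriv[of x] x by simp
qed

text \<open>In these variables \<open>H * P\<close> equals \<open>cX^2 - qX^2\<close>, so the first
  integral becomes, up to a term of order 1/x^2 for bounded \<open>cX\<close>, the circle
  \<open>qX^2 + R^2 = cX^2 - 5\<close>.\<close>

lemma cq_integral: "(cX x)\<^sup>2 - (qX x)\<^sup>2 = 5 + 5 / 4 * ((cX x + qX x) / x)\<^sup>2 + (R x)\<^sup>2"
proof -
  have "H x * P x = (cX x - qX x) * (cX x + qX x)" using x by (simp add: H_cX P_cX)
  then show ?thesis using H_times_P[of x] x unfolding P_cX by (simp add: algebra_simps power2_eq_square)
qed

lemma cq_sum_pos: "cX x + qX x > 0" using P_pos[of x] x by (simp add: P_cX zero_less_divide_iff)
lemma cq_diff_pos: "cX x - qX x > 0" using H_pos[of x] x by (simp add: H_cX zero_less_mult_iff)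
lemma qX_less: "\<bar>qX x\<bar> < cX x" using cq_sum_pos cq_diff_pos by linarith
lemma cX_pos: "cX x > 0" using qX_less by linarith

lemma cq_squares_ge: "(cX x)\<^sup>2 - (qX x)\<^sup>2 \<ge> 5 + (R x)\<^sup>2"
  unfolding cq_integral using zero_le_power2[of "(cX x + qX x) / x"] by linarith

lemma cq_prod_ge: "(cX x - qX x) * (cX x + qX x) \<ge> 5 + (R x)\<^sup>2"
  using cq_squares_ge by (simp add: square_diff_square_factored power2_eq_square mult.commute)

lemma R_le: "\<bar>R x\<bar> \<le> cX x"
proof -
  have "(R x)\<^sup>2 \<le> (cX x)\<^sup>2"
    using cq_squares_ge zero_le_power2[of "qX x"] by linarith
  then show ?thesis using cX_pos by (simp add: abs_le_square_iff[symmetric])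
qed

lemma cX_ge: "cX x \<ge> sqrt 5"
proof -
  have "5 + ((R x)\<^sup>2 + (qX x)\<^sup>2) \<le> (cX x)\<^sup>2" using cq_squares_ge by linarith
  then have "5 \<le> (cX x)\<^sup>2"
    using add_nonneg_nonneg[OF zero_le_power2[of "R x"] zero_le_power2[of "qX x"]] by linarith
  then show ?thesis using cX_pos by (intro real_le_lsqrt) auto
qed

end

text \<open>The derivative \<open>qX/x\<close> of \<open>cX\<close> is only O(cX/x), which alone
  would permit polynomial growth. Adding \<open>R/x\<close> cancels it because R' is nearly -qX,
  leaving D' at most cX/x^2. As |R| is at most cX, D is at least cX/2 for x at least 2. Hence D'/D
  is at most 2/x^2, and ln D + 5/x does not increase; any constant from 2 on would do for 5.\<close>

lemma cX_bounded: obtains K where "K > 0" "\<And>x. x \<ge> 1 \<Longrightarrow> cX x \<le> K"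
proof -
  define D where "D x = cX x + R x / x" for x
  define E where "E x = ln (D x) + 5 / x" for x
  have Dlow: "cX x \<le> 2 * D x" "D x > 0" if "x \<ge> 2" for x
  proof -
    have "\<bar>R x\<bar> / x \<le> cX x / 2" using R_le[of x] cX_pos[of x] that by (intro frac_le) auto
    moreover have "- (\<bar>R x\<bar> / x) \<le> R x / x" using that by (simp add: field_simps)
    ultimately show "cX x \<le> 2 * D x" "D x > 0" using cX_pos[of x] that unfolding D_def by auto
  qed
  have Dd: "(D has_real_derivative - R x / x\<^sup>2 - 5 / 4 * (cX x + qX x) / x ^ 3) (at x)" if "x > 0" for x
    unfolding D_def[abs_def] using that
    by (auto intro!: derivative_eq_intros cX_deriv R_deriv_cX simp: field_simps power2_eq_square power3_eq_cube)
  have "E x \<le> E 2" if "x \<ge> 2" for x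
  proof (rule DERIV_nonpos_imp_nonincreasing[OF that])
    fix z :: real assume z: "2 \<le> z" "z \<le> x"
    let ?D' = "- R z / z\<^sup>2 - 5 / 4 * (cX z + qX z) / z ^ 3"
    have "(E has_real_derivative ?D' / D z - 5 / z\<^sup>2) (at z)"
    proof -
      have "((\<lambda>x. ln (D x)) has_real_derivative 1 / D z * ?D') (at z)"
        by (rule DERIV_chain2[OF DERIV_ln_divide Dd]) (use z Dlow(2)[of z] in auto)
      moreover have "((\<lambda>x. 5 / x) has_real_derivative - 5 / z\<^sup>2) (at z)"
        using z by (auto intro!: derivative_eq_intros simp: power2_eq_square)
      ultimately show ?thesis unfolding E_def[abs_def] using DERIV_add by force
    qed
    moreover have "?D' \<le> 5 / z\<^sup>2 * D z"
    proof -
      have "- R z / z\<^sup>2 \<le> cX z / z\<^sup>2" using R_le[of z] z by (intro divide_right_mono) auto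
      moreover have "- (5 / 4 * (cX z + qX z) / z ^ 3) \<le> 0" using cq_sum_pos[of z] z by simp
      moreover have "cX z / z\<^sup>2 \<le> 5 / z\<^sup>2 * D z" using Dlow[of z] z by (simp add: divide_right_mono)
      ultimately show ?thesis by linarith
    qed
    then have "?D' / D z - 5 / z\<^sup>2 \<le> 0" using Dlow(2)[of z] z by (simp add: divide_le_eq)
    ultimately show "\<exists>y. (E has_real_derivative y) (at z) \<and> y \<le> 0" by blast
  qed
  then have "ln (D x) \<le> E 2" if "x \<ge> 2" for x
  proof -
    have "E x \<le> E 2" "0 \<le> 5 / x" using \<open>\<And>x. 2 \<le> x \<Longrightarrow> E x \<le> E 2\<close> that by auto
    then show ?thesis unfolding E_def[of x] by linarith
  qed
  then have "D x \<le> exp (E 2)" if "x \<ge> 2" for x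
    using that Dlow(2)[OF that] exp_le_cancel_iff[of "ln (D x)" "E 2"] by simp
  then have ge2: "cX x \<le> 2 * exp (E 2)" if "x \<ge> 2" for x
    using that order_trans[OF Dlow(1)[OF that], of "2 * exp (E 2)"] by simp
  have "continuous_on {1..2} cX"
    by (intro continuous_at_imp_continuous_on ballI DERIV_isCont[OF cX_deriv]) auto
  then have "bounded (cX ` {1..2})" by (intro compact_imp_bounded compact_continuous_image) auto
  then obtain B where "\<And>x. 1 \<le> x \<Longrightarrow> x \<le> 2 \<Longrightarrow> \<bar>cX x\<bar> \<le> B" unfolding bounded_iff by fastforce
  then have "cX x \<le> max B (2 * exp (E 2))" if "x \<ge> 1" for x
  proof (cases "x \<le> 2")
    case True
    then have "\<bar>cX x\<bar> \<le> B" using \<open>\<And>x. 1 \<le> x \<Longrightarrow> x \<le> 2 \<Longrightarrow> \<bar>cX x\<bar> \<le> B\<close> that by blast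
    then show ?thesis by simp
  qed (use ge2[of x] in simp)
  then show thesis using that[of "max B (2 * exp (E 2))"] by (simp add: less_max_iff_disj)
qed

text \<open>The product of \<open>cX - qX\<close> and \<open>cX + qX\<close> is at least 5 and each
  factor is at most 2 K, so each is at least 5/(2 K).\<close>

lemma cq_bounds:
  obtains K \<delta> where "K \<ge> 1" "\<delta> > 0" "\<And>x. x \<ge> 1 \<Longrightarrow> cX x \<le> K"
    "\<And>x. x \<ge> 1 \<Longrightarrow> \<delta> \<le> cX x - qX x" "\<And>x. x \<ge> 1 \<Longrightarrow> \<delta> \<le> cX x + qX x"
proof -
  obtain K0 where K0: "K0 > 0" "\<And>x. x \<ge> 1 \<Longrightarrow> cX x \<le> K0" using cX_bounded by blast
  define K where "K = max 1 K0"
  have K: "K \<ge> 1" "\<And>x. x \<ge> 1 \<Longrightarrow> cX x \<le> K" using K0 by (auto simp: K_def le_max_iff_disj)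
  have *: "5 / (2 * K) \<le> d" if "d * s \<ge> 5" "s \<le> 2 * K" "d > 0" for d s
    using order_trans[OF that(1) mult_left_mono[OF that(2), of d]] that K by (simp add: divide_le_eq)
  have "5 / (2 * K) \<le> cX x - qX x" "5 / (2 * K) \<le> cX x + qX x" if "x \<ge> 1" for x
  proof -
    have a: "(cX x - qX x) * (cX x + qX x) \<ge> 5" using cq_prod_ge[of x] zero_le_power2[of "R x"] that by linarith
    have b: "cX x \<le> K" "\<bar>qX x\<bar> < cX x" using K that qX_less[of x] by auto
    show "5 / (2 * K) \<le> cX x - qX x" by (rule *[OF a]) (use b in auto)
    show "5 / (2 * K) \<le> cX x + qX x"
      by (rule *[of _ "cX x - qX x"]) (use a b in \<open>auto simp: mult.commute\<close>)
  qed
  then show thesis using that[of K "5 / (2 * K)"] K by auto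
qed

subsection \<open>The angle \<open>w\<close>\<close>

lemma wfun_deriv: assumes "x > 0" shows "(wfun has_real_derivative sqrt 5 * (x / H x)) (at x)"
proof -
  have eq: "wfun z = sqrt 5 * integral {0..z} (\<lambda>s. s / H s)" for z
    by (simp add: wfun_def H_def X0'_eq power2_eq_square mult_ac)
  have Hc: "isCont H z" for z
    unfolding H_def[abs_def] by (intro continuous_intros X0_continuous P_continuous)
  have "((\<lambda>z. integral {0..z} (\<lambda>s. s / H s)) has_real_derivative x / H x) (at x within {0..x+1})"
    by (rule integral_has_real_derivative)
      (use assms H_pos in \<open>fastforce intro!: continuous_at_imp_continuous_on continuous_intros Hc\<close>)+
  then have "((\<lambda>z. integral {0..z} (\<lambda>s. s / H s)) has_real_derivative x / H x) (at x)"
    using assms by (simp add: at_within_Icc_at)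
  then show ?thesis unfolding eq[abs_def] by (rule DERIV_cmult)
qed

text \<open>The term \<open>R/H\<close> absorbs the part of \<open>w' + b\<^sub>1(\<cdot>, 0)\<close> that is only \<open>O(1/x)\<close>.\<close>

definition psi :: "real \<Rightarrow> real" where "psi x = wfun x + R x / H x"

definition psi' :: "real \<Rightarrow> real" where
  "psi' x = sqrt 5 * (x / H x) + ((X0 x - (x\<^sup>2 + 5 / 4) * P x) / x * H x + x * R x * R x) / (H x)\<^sup>2"

lemma H_deriv: "x > 0 \<Longrightarrow> (H has_real_derivative - x * R x) (at x)"
  unfolding H_def[abs_def]
  by (auto intro!: derivative_eq_intros X0_deriv P_deriv simp: field_simps power2_eq_square)

lemma psi_deriv: "x > 0 \<Longrightarrow> (psi has_real_derivative psi' x) (at x)"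
  unfolding psi_def[abs_def] psi'_def using H_pos[of x]
  by (auto intro!: derivative_eq_intros wfun_deriv R_deriv H_deriv simp: power2_eq_square)

lemma hfun_eq: "x > 0 \<Longrightarrow> hfun x y = H x + y\<^sup>2 * P x + sqrt 5"
  by (simp add: hfun_def H_def X0'_eq power2_eq_square)

lemma hfun_ge: "x > 0 \<Longrightarrow> hfun x y \<ge> H x"
  using P_pos[of x] by (simp add: hfun_eq)

lemma hfun_pos: "x > 0 \<Longrightarrow> hfun x y > 0"
  using hfun_ge[of x y] H_pos[of x] by linarith

text \<open>With d = cX - qX, the 1/x term of \<open>w' + b1(x, 0)\<close> is (5 - cX d)/(x d^2),
  and that of (R/H)' is (R^2 - qX d)/(x d^2). The first integral turns R^2 - qX d into cX d - 5 up
  to O(1/x^2), so the two cancel. The right-hand side is the exact remainder.\<close>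

lemma psi'_b1:
  assumes x: "x > 0"
  defines "d \<equiv> cX x - qX x"
  shows "psi' x + b1 x 0 = (sqrt 5 * (cX x * d - 5) / (d\<^sup>2 * (x * d + sqrt 5)) - sqrt 5 / 2 / (x * d + sqrt 5)
      - 5 / 2 * cX x * (cX x + qX x) / (x\<^sup>2 * d\<^sup>2)) / x"
proof -
  define s where "s = sqrt (5::real)"
  have s: "s * s = 5" "s > 0" by (simp_all add: s_def)
  have d: "d > 0" using cq_diff_pos[OF x] by (simp add: d_def)
  have h: "x * d + s \<noteq> 0" using mult_pos_pos[OF x d] s by linarith
  have q: "qX x = cX x - d" by (simp add: d_def)
  have HP: "d * (2 * cX x - d) = 5 + 5 / 4 * ((2 * cX x - d) / x)\<^sup>2 + (R x)\<^sup>2"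
  proof -
    have "d * (2 * cX x - d) = (cX x)\<^sup>2 - (qX x)\<^sup>2" and "2 * cX x - d = cX x + qX x"
      unfolding q by (simp_all add: algebra_simps power2_eq_square)
    then show ?thesis using cq_integral[OF x] by (simp only:)
  qed
  \<comment> \<open>Once R^2 is eliminated, the claim is a rational identity in x, cX, d and s
    modulo s^2 = 5.\<close>
  have R2: "x * R x * R x = x * (d * (2 * cX x - d) - 5 - 5 / 4 * ((2 * cX x - d) / x)\<^sup>2)"
  proof -
    have "(R x)\<^sup>2 = d * (2 * cX x - d) - 5 - 5 / 4 * ((2 * cX x - d) / x)\<^sup>2" using HP by linarith
    then show ?thesis by (simp only: mult.assoc power2_eq_square)
  qed
  have h2: "d * x + s \<noteq> 0" using h by (simp add: mult.commute)
  show ?thesis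
    unfolding psi'_def b1_def hfun_eq[OF x] H_cX[OF x] P_cX[OF x] X0_cX[OF x] d_def[symmetric] q R2
      s_def[symmetric]
    using x d h h2 s(2) 
    apply (simp add: divide_simps)
    using s(1) by algebra
qed

lemma abs_quotient_le:
  fixes a b M m :: real
  assumes "\<bar>a\<bar> \<le> M" "m \<le> b" "0 < m"
  shows "\<bar>a / b\<bar> \<le> M / m"
  using assms by (auto simp: abs_divide intro!: frac_le)

lemma psi'_b1_bound: obtains M where "\<And>x. x \<ge> 1 \<Longrightarrow> \<bar>psi' x + b1 x 0\<bar> \<le> M / x\<^sup>2"
proof -
  obtain K \<delta> where K: "K \<ge> 1" "\<delta> > 0" "\<And>x. x \<ge> 1 \<Longrightarrow> cX x \<le> K"
    "\<And>x. x \<ge> 1 \<Longrightarrow> \<delta> \<le> cX x - qX x" using cq_bounds by metis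
  define M where "M = sqrt 5 * (2 * K\<^sup>2 + 5) / \<delta> ^ 3 + (sqrt 5 / 2) / \<delta> + 5 * K\<^sup>2 / \<delta>\<^sup>2"
  have "\<bar>psi' x + b1 x 0\<bar> \<le> M / x\<^sup>2" if x1: "x \<ge> 1" for x
  proof -
    have x: "x > 0" using x1 by simp
    define d where "d = cX x - qX x"
    have d: "\<delta> \<le> d" "d > 0" "d \<le> 2 * K" and c: "0 < cX x" "cX x \<le> K" "\<bar>cX x + qX x\<bar> \<le> 2 * K"
      using K(2) qX_less[OF x] K(3)[OF x1] K(4)[OF x1] unfolding d_def by linarith+
    have xd: "x * \<delta> \<le> x * d + sqrt 5" "0 < x * \<delta>"
      using mult_left_mono[OF d(1), of x] x K(2) by (auto intro: add_increasing2)
    have "\<bar>sqrt 5 * (cX x * d - 5) / (d\<^sup>2 * (x * d + sqrt 5))\<bar> \<le> sqrt 5 * (2 * K\<^sup>2 + 5) / (\<delta>\<^sup>2 * (x * \<delta>))"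
    proof (rule abs_quotient_le)
      have "0 \<le> cX x * d" "cX x * d \<le> K * (2 * K)" using c d K by (auto intro: mult_mono)
      then show "\<bar>sqrt 5 * (cX x * d - 5)\<bar> \<le> sqrt 5 * (2 * K\<^sup>2 + 5)"
        unfolding abs_mult by (intro mult_mono) (auto simp: power2_eq_square)
      show "\<delta>\<^sup>2 * (x * \<delta>) \<le> d\<^sup>2 * (x * d + sqrt 5)" using d K xd by (intro mult_mono power_mono) auto
    qed (use K x in auto)
    moreover have "\<bar>sqrt 5 / 2 / (x * d + sqrt 5)\<bar> \<le> sqrt 5 / 2 / (x * \<delta>)"
      using xd by (intro abs_quotient_le) auto
    moreover have "\<bar>5 / 2 * cX x * (cX x + qX x) / (x\<^sup>2 * d\<^sup>2)\<bar> \<le> 5 * K\<^sup>2 / (x * \<delta>\<^sup>2)"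
    proof (rule abs_quotient_le)
      have "cX x * \<bar>cX x + qX x\<bar> \<le> K * (2 * K)" using c K by (intro mult_mono) auto
      then show "\<bar>5 / 2 * cX x * (cX x + qX x)\<bar> \<le> 5 * K\<^sup>2" using c by (simp add: abs_mult power2_eq_square)
      have "x \<le> x\<^sup>2" using x1 by (simp add: power2_eq_square)
      then show "x * \<delta>\<^sup>2 \<le> x\<^sup>2 * d\<^sup>2" using d K x by (intro mult_mono power_mono) auto
    qed (use K x in auto)
    moreover have "M / x = sqrt 5 * (2 * K\<^sup>2 + 5) / (\<delta>\<^sup>2 * (x * \<delta>)) + sqrt 5 / 2 / (x * \<delta>) + 5 * K\<^sup>2 / (x * \<delta>\<^sup>2)"
      using x K(2) unfolding M_def by (simp add: field_simps power2_eq_square power3_eq_cube)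
    ultimately have "\<bar>sqrt 5 * (cX x * d - 5) / (d\<^sup>2 * (x * d + sqrt 5)) - sqrt 5 / 2 / (x * d + sqrt 5)
      - 5 / 2 * cX x * (cX x + qX x) / (x\<^sup>2 * d\<^sup>2)\<bar> \<le> M / x" by linarith
    then have "\<bar>psi' x + b1 x 0\<bar> \<le> (M / x) / x"
      unfolding psi'_b1[OF x] d_def[symmetric] using x by (intro abs_quotient_le) auto
    then show ?thesis by (simp add: power2_eq_square)
  qed
  then show thesis using that by blast
qed

subsection \<open>The angular speed of the normalized normal\<close>

text \<open>Writing a dot for the inner product, this is \<open>\<kappa> * (v1 . \<xi>) / ((v1 .
  \<xi>)^2 + (v1 . X\<alpha>)^2)\<close> along the curve, after \<open>hfun x y\<close> and
  \<open>sqrt (1 + y^2)\<close> have cancelled.\<close>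

definition angular_speed :: "real \<Rightarrow> real" where
  "angular_speed x = (2 * X0 x + sqrt 5) / x * (P x + 2 * sqrt 5) / ((P x + 2 * sqrt 5)\<^sup>2 + (2 * R x)\<^sup>2)"

text \<open>The summand 2 sqrt 5 next to the positive \<open>P\<close>, together with
  \<open>cX \<ge> sqrt 5\<close>, keeps every factor away from 0. The bound on \<open>cX\<close>
  controls them from above.\<close>

lemma angular_speed_bounds:
  obtains m M where "m > 0" "\<And>x. x \<ge> 1 \<Longrightarrow> m \<le> angular_speed x" "\<And>x. x \<ge> 1 \<Longrightarrow> angular_speed x \<le> M"
proof -
  obtain K where K: "K > 0" "\<And>x. x \<ge> 1 \<Longrightarrow> cX x \<le> K" using cX_bounded by blast
  define L where "L = 2 * K + 2 * sqrt 5"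
  define m where "m = (2 * sqrt 5) * (2 * sqrt 5) / (L\<^sup>2 + L\<^sup>2)"
  define M where "M = L * L / (2 * sqrt 5)\<^sup>2"
  have L: "L > 0" using K by (simp add: L_def add_pos_pos)
  have "m \<le> angular_speed x \<and> angular_speed x \<le> M" if x1: "x \<ge> 1" for x
  proof -
    have x: "x > 0" using x1 by simp
    have s5: "sqrt 5 / x \<le> sqrt 5" "0 < sqrt 5 / x" using x1 by (auto simp: divide_le_eq)
    have "(2 * X0 x + sqrt 5) / x = 2 * cX x + sqrt 5 / x"
      using x unfolding X0_cX[OF x] by (simp add: field_simps)
    then have S: "2 * sqrt 5 \<le> (2 * X0 x + sqrt 5) / x" "(2 * X0 x + sqrt 5) / x \<le> L"
      using cX_ge[OF x] K(2)[OF x1] s5 unfolding L_def by linarith+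
    have "P x \<le> cX x + qX x" unfolding P_cX[OF x] using x1 cq_sum_pos[OF x] by (simp add: divide_le_eq)
    then have p: "2 * sqrt 5 \<le> P x + 2 * sqrt 5" "P x + 2 * sqrt 5 \<le> L"
      using P_pos[of x] x qX_less[OF x] K(2)[OF x1] unfolding L_def by linarith+
    have r: "\<bar>2 * R x\<bar> \<le> L" using R_le[OF x] K(2)[OF x1] unfolding L_def by (simp add: abs_mult add_increasing2)
    have r2: "(2 * R x)\<^sup>2 \<le> L\<^sup>2" using r L abs_le_square_iff[of "2 * R x" L] by simp
    have p2: "(P x + 2 * sqrt 5)\<^sup>2 \<le> L\<^sup>2" "(2 * sqrt 5)\<^sup>2 \<le> (P x + 2 * sqrt 5)\<^sup>2"
      by (rule power_mono[OF p(2)]; use p in force) (rule power_mono[OF p(1)]; simp)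
    have pos: "0 < (2 * sqrt 5)\<^sup>2" "0 < (P x + 2 * sqrt 5)\<^sup>2 + (2 * R x)\<^sup>2"
      using p2(2) less_le_trans[of 0 "(2 * sqrt 5)\<^sup>2"] by (auto intro!: add_pos_nonneg simp del: power_mult_distrib)
    have S0: "0 \<le> (2 * X0 x + sqrt 5) / x" "0 \<le> (2 * X0 x + sqrt 5) / x * (P x + 2 * sqrt 5)"
      using order_trans[OF _ S(1), of 0] order_trans[OF _ p(1), of 0]
      by (simp_all del: times_divide_eq_left)
    have "(2 * sqrt 5)\<^sup>2 \<le> (P x + 2 * sqrt 5)\<^sup>2 + (2 * R x)\<^sup>2"
      using p2(2) zero_le_power2[of "2 * R x"] by linarith
    note pos = pos this
    show ?thesis
      unfolding m_def M_def angular_speed_def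
      by (intro conjI frac_le mult_mono add_mono S p r2 p2) (use S0 p L p2 pos in \<open>auto simp del: times_divide_eq_left\<close>)
  qed
  moreover have "m > 0" unfolding m_def using L by (simp add: add_pos_pos)
  ultimately show thesis using that by blast
qed


text \<open>The first quotient is the derivative of 2 arctan (r/m) when r' = -q + e1 and m' = -r +
  e2. If e1, e2 and E vanish, then m^2 + r^2 = 2 (c + sqrt 5)(c - q) and r^2 - q m = (c + sqrt 5)(c
  - q - sqrt 5), so the quotient is exactly 1 - sqrt 5/(c - q). The rest is linear in the three
  errors.\<close>

lemma arctan_speed_estimate:
  fixes c q r e1 e2 E \<epsilon> K \<delta> :: real
  assumes int: "c\<^sup>2 - q\<^sup>2 = 5 + r\<^sup>2 + E"
    and e: "\<bar>e1\<bar> \<le> \<epsilon>" "\<bar>e2\<bar> \<le> \<epsilon>" "\<bar>E\<bar> \<le> \<epsilon>"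
    and K: "\<bar>c\<bar> \<le> K" "\<bar>q\<bar> \<le> K" "\<bar>r\<bar> \<le> K" and \<delta>: "0 < \<delta>" "\<delta> \<le> c - q"
  defines "m \<equiv> c + sqrt 5 - q"
  shows "\<bar>2 * ((- q + e1) * m - r * (- r + e2)) / (m\<^sup>2 + r\<^sup>2) - (1 - sqrt 5 / (c - q))\<bar>
    \<le> ((4 * K * (1 + (2 * K + sqrt 5) + K) + (2 * K + sqrt 5)) / (5 * \<delta>)) * \<epsilon>"
proof -
  define s where "s = sqrt (5::real)"
  have s: "s * s = 5" "s > 0" by (simp_all add: s_def)
  have m: "m = c - q + s" by (simp add: m_def s_def)
  have ms: "m \<ge> s" using \<delta> unfolding m by linarith
  have "s * s \<le> m * m" using ms s(2) by (intro mult_mono) auto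
  then have Dn: "m\<^sup>2 + r\<^sup>2 \<ge> 5" using s(1) zero_le_power2[of r] unfolding power2_eq_square[of m] by linarith
  have cq: "\<bar>c - q\<bar> \<le> 2 * K" and mK: "\<bar>m\<bar> \<le> 2 * K + s" and ck: "\<bar>c - q - s\<bar> \<le> 2 * K + s"
    using K s(2) unfolding m by linarith+
  have K0: "K \<ge> 0" and \<epsilon>0: "\<epsilon> \<ge> 0" using K e by linarith+
  \<comment> \<open>\<open>?N\<close> is what cross-multiplication leaves after the exact identity
    has cancelled; it collects e1, e2 and E.\<close>
  let ?N = "2 * (c - q) * (- E + e1 * m - r * e2) + E * (c - q - s)"
  have cq0: "c - q \<noteq> 0" and Dn0: "m\<^sup>2 + r\<^sup>2 \<noteq> 0" using \<delta> Dn by linarith+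
  have "(2 * ((- q + e1) * m - r * (- r + e2))) * (c - q) - (c - q - s) * (m\<^sup>2 + r\<^sup>2) = ?N"
    using int s(1) unfolding m by algebra
  then have "2 * ((- q + e1) * m - r * (- r + e2)) / (m\<^sup>2 + r\<^sup>2) - (1 - s / (c - q)) = ?N / ((c - q) * (m\<^sup>2 + r\<^sup>2))"
  proof -
    have "1 - s / (c - q) = (c - q - s) / (c - q)" using cq0 by (simp add: diff_divide_distrib)
    then show ?thesis
      unfolding \<open>_ = ?N\<close>[symmetric] using cq0 Dn0
      by (simp only: diff_frac_eq not_False_eq_True mult.commute[of "c - q"])
  qed
  moreover have "\<bar>?N / ((c - q) * (m\<^sup>2 + r\<^sup>2))\<bar> \<le> (4 * K * (\<epsilon> + \<epsilon> * (2 * K + s) + K * \<epsilon>) + \<epsilon> * (2 * K + s)) / (\<delta> * 5)"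
  proof (rule abs_quotient_le)
    have "\<bar>e1 * m\<bar> \<le> \<epsilon> * (2 * K + s)" "\<bar>r * e2\<bar> \<le> K * \<epsilon>"
      unfolding abs_mult by (intro mult_mono; use e K mK \<epsilon>0 K0 in force)+
    then have "\<bar>- E + e1 * m - r * e2\<bar> \<le> \<epsilon> + \<epsilon> * (2 * K + s) + K * \<epsilon>" using e by linarith
    then have "\<bar>2 * (c - q) * (- E + e1 * m - r * e2)\<bar> \<le> 4 * K * (\<epsilon> + \<epsilon> * (2 * K + s) + K * \<epsilon>)"
      unfolding abs_mult[of "2 * (c - q)"] using cq K0 by (intro mult_mono) auto
    moreover have "\<bar>E * (c - q - s)\<bar> \<le> \<epsilon> * (2 * K + s)"
      unfolding abs_mult using e ck \<epsilon>0 by (intro mult_mono) auto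
    ultimately show "\<bar>?N\<bar> \<le> 4 * K * (\<epsilon> + \<epsilon> * (2 * K + s) + K * \<epsilon>) + \<epsilon> * (2 * K + s)" by linarith
    show "\<delta> * 5 \<le> (c - q) * (m\<^sup>2 + r\<^sup>2)" using \<delta> Dn by (intro mult_mono) auto
  qed (use \<delta> in auto)
  moreover have "(4 * K * (\<epsilon> + \<epsilon> * (2 * K + s) + K * \<epsilon>) + \<epsilon> * (2 * K + s)) / (\<delta> * 5)
    = ((4 * K * (1 + (2 * K + s) + K) + (2 * K + s)) / (5 * \<delta>)) * \<epsilon>" by (simp add: field_simps)
  ultimately show ?thesis by (simp only: s_def)
qed

text \<open>For \<open>q = A cos x\<close>, \<open>r = -A sin x\<close>, \<open>c\<^sup>2 = A\<^sup>2 + 5\<close>, the function \<open>x - 2 arctan (r / (c + \<surd>5 - q))\<close>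
  is an antiderivative of \<open>\<surd>5 / (c - q)\<close>. The two terms correspond to the partial fractions
  \<open>2 c / (c\<^sup>2 - q\<^sup>2) = 1 / (c - q) + 1 / (c + q)\<close>.\<close>

definition phase :: "real \<Rightarrow> real" where
  "phase x = arctan (R x / (cX x + sqrt 5 + qX x)) - arctan (R x / (cX x + sqrt 5 - qX x))"

lemma phase_bounded: "\<bar>phase x\<bar> \<le> pi"
  unfolding phase_def using arctan_bounded[of "R x / (cX x + sqrt 5 + qX x)"]
    arctan_bounded[of "R x / (cX x + sqrt 5 - qX x)"] by linarith

lemma arctan_quotient_deriv:
  assumes "(r has_real_derivative r') (at x)" "(m has_real_derivative m') (at x)" "m x > 0"
  shows "((\<lambda>x. arctan (r x / m x)) has_real_derivative (r' * m x - r x * m') / ((m x)\<^sup>2 + (r x)\<^sup>2)) (at x)"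
proof -
  have nz: "(m x)\<^sup>2 + (r x)\<^sup>2 \<noteq> 0" using assms(3) by (simp add: sum_power2_eq_zero_iff)
  have "((\<lambda>x. arctan (r x / m x)) has_real_derivative
      inverse (1 + (r x / m x)\<^sup>2) * ((r' * m x - r x * m') / (m x * m x))) (at x)"
    by (rule DERIV_chain2[OF DERIV_arctan DERIV_divide[OF assms(1,2)]]) (use assms(3) in simp)
  moreover have "inverse (1 + (r x / m x)\<^sup>2) * ((r' * m x - r x * m') / (m x * m x))
      = (r' * m x - r x * m') / ((m x)\<^sup>2 + (r x)\<^sup>2)"
  proof -
    have "1 + (r x / m x)\<^sup>2 = ((m x)\<^sup>2 + (r x)\<^sup>2) / (m x)\<^sup>2"
      using assms(3) by (simp add: power_divide add_divide_distrib)
    then show ?thesis using assms(3) by (simp add: power2_eq_square)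
  qed
  ultimately show ?thesis by simp
qed

text \<open>The speed is replaced by sqrt 5 cX/(5 + R^2), then by sqrt 5 cX/(cX^2 - qX^2), each time
  with error O(1/x). Partial fractions split the latter into halves of sqrt 5/(cX - qX) and sqrt
  5/(cX + qX), and each half is matched by one arctangent of \<open>phase\<close>.\<close>

lemma phase_deriv:
  obtains \<zeta> B where "\<And>x. x \<ge> 1 \<Longrightarrow> (phase has_real_derivative \<zeta> x) (at x)"
    "\<And>x. x \<ge> 1 \<Longrightarrow> \<bar>angular_speed x - 1 - \<zeta> x\<bar> \<le> B / x"
proof -
  obtain K \<delta> where K: "K \<ge> 1" "\<delta> > 0" "\<And>x. x \<ge> 1 \<Longrightarrow> cX x \<le> K"
    "\<And>x. x \<ge> 1 \<Longrightarrow> \<delta> \<le> cX x - qX x" "\<And>x. x \<ge> 1 \<Longrightarrow> \<delta> \<le> cX x + qX x" using cq_bounds by metis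
  define s where "s = sqrt (5::real)"
  have s: "s * s = 5" "s > 0" by (simp_all add: s_def)
  define e where "e x = 5 / 4 * (cX x + qX x) / x\<^sup>2" for x
  define E where "E x = 5 / 4 * ((cX x + qX x) / x)\<^sup>2" for x
  define m1 where "m1 x = cX x + s - qX x" for x
  define m2 where "m2 x = cX x + s + qX x" for x
  define z1 where "z1 x = ((- qX x - e x) * m1 x - R x * (qX x / x - (R x + cX x / x))) / ((m1 x)\<^sup>2 + (R x)\<^sup>2)" for x
  define z2 where "z2 x = ((- qX x - e x) * m2 x - R x * (qX x / x + (R x + cX x / x))) / ((m2 x)\<^sup>2 + (R x)\<^sup>2)" for x
  define B1 where "B1 = (4 * K * (1 + (2 * K + s) + K) + (2 * K + s)) / (5 * \<delta>) * (5 * K\<^sup>2)"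
  define B2 where "B2 = (4 * K * K * (20 + 4 * K\<^sup>2) + s * (2 * K + 2 * s) * (20 + 4 * K\<^sup>2) + 8 * s * K * K * (2 * K + 4 * s)) / (20 * 20)"
  define B3 where "B3 = s * K * (5 * K\<^sup>2) / (5 * 5)"
  have d: "(phase has_real_derivative z2 x - z1 x) (at x)" if x1: "x \<ge> 1" for x
  proof -
    have x: "x > 0" using x1 by simp
    have m: "m1 x > 0" "m2 x > 0" using qX_less[OF x] s unfolding m1_def m2_def by linarith+
    have Rd: "(R has_real_derivative - qX x - e x) (at x)" using R_deriv_cX[OF x] by (simp add: e_def)
    have "(m1 has_real_derivative qX x / x - (R x + cX x / x)) (at x)"
      "(m2 has_real_derivative qX x / x + (R x + cX x / x)) (at x)"
      unfolding m1_def[abs_def] m2_def[abs_def]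
      by (auto intro!: derivative_eq_intros cX_deriv[OF x] qX_deriv[OF x])
    from DERIV_diff[OF arctan_quotient_deriv[OF Rd this(2) m(2)] arctan_quotient_deriv[OF Rd this(1) m(1)]]
    show ?thesis by (simp add: z1_def z2_def phase_def[abs_def] m1_def m2_def s_def)
  qed
  have b: "\<bar>angular_speed x - 1 - (z2 x - z1 x)\<bar> \<le> (B1 + B2 + B3) / x" if x1: "x \<ge> 1" for x
  proof -
    have x: "x > 0" using x1 by simp
    have c: "0 < cX x" "cX x \<le> K" and q: "\<bar>qX x\<bar> \<le> K" and r: "\<bar>R x\<bar> \<le> K"
      and cq: "0 < cX x + qX x" "cX x + qX x \<le> 2 * K"
      using cX_pos[OF x] K(3)[OF x1] qX_less[OF x] R_le[OF x] cq_sum_pos[OF x] by linarith+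
    have xx: "x \<le> x\<^sup>2" using x1 by (simp add: power2_eq_square)
    have KK: "K \<le> K\<^sup>2" using K(1) by (simp add: power2_eq_square)
    let ?\<epsilon> = "5 * K\<^sup>2 / x"
    have e: "\<bar>e x\<bar> \<le> ?\<epsilon>"
      unfolding e_def by (rule abs_quotient_le) (use cq KK xx x in auto)
    have E: "\<bar>E x\<bar> \<le> ?\<epsilon>"
    proof -
      have "(cX x + qX x)\<^sup>2 \<le> (2 * K)\<^sup>2" using cq by (intro power_mono) auto
      then have "\<bar>5 / 4 * (cX x + qX x)\<^sup>2 / x\<^sup>2\<bar> \<le> ?\<epsilon>"
        by (intro abs_quotient_le) (use xx x in \<open>auto simp: power_mult_distrib abs_mult\<close>)
      then show ?thesis by (simp add: E_def power_divide)
    qed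
    have "\<bar>qX x / x\<bar> + \<bar>cX x / x\<bar> \<le> K / x + K / x"
      by (intro add_mono abs_quotient_le) (use c q x in auto)
    also have "\<dots> \<le> ?\<epsilon>" using KK K(1) x by (simp add: field_simps)
    finally have f: "\<bar>qX x / x\<bar> + \<bar>cX x / x\<bar> \<le> ?\<epsilon>" .
    have int: "(cX x)\<^sup>2 - (qX x)\<^sup>2 = 5 + (R x)\<^sup>2 + E x" using cq_integral[OF x] by (simp add: E_def)
    have "\<bar>2 * ((- qX x + - e x) * (cX x + sqrt 5 - qX x) - R x * (- R x + (qX x / x - cX x / x)))
        / ((cX x + sqrt 5 - qX x)\<^sup>2 + (R x)\<^sup>2) - (1 - sqrt 5 / (cX x - qX x))\<bar>
      \<le> ((4 * K * (1 + (2 * K + sqrt 5) + K) + (2 * K + sqrt 5)) / (5 * \<delta>)) * ?\<epsilon>"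
      by (rule arctan_speed_estimate[OF int]) (use e E f c q r K(2) K(4)[OF x1] in linarith)+
    moreover have "2 * ((- qX x + - e x) * (cX x + sqrt 5 - qX x) - R x * (- R x + (qX x / x - cX x / x)))
        / ((cX x + sqrt 5 - qX x)\<^sup>2 + (R x)\<^sup>2) = 2 * z1 x"
      unfolding z1_def m1_def s_def by (simp add: algebra_simps)
    ultimately have h1: "\<bar>2 * z1 x - (1 - s / (cX x - qX x))\<bar> \<le> B1 / x"
      by (simp add: B1_def s_def)
    \<comment> \<open>The estimate applied to (cX, -qX, -R) treats the other arctangent; the sign of
      R explains the factor -2 in front of z2.\<close>
    have int': "(cX x)\<^sup>2 - (- qX x)\<^sup>2 = 5 + (- R x)\<^sup>2 + E x" using int by simp
    have "\<bar>2 * ((- (- qX x) + e x) * (cX x + sqrt 5 - (- qX x)) - (- R x) * (- (- R x) + (qX x / x + cX x / x)))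
        / ((cX x + sqrt 5 - (- qX x))\<^sup>2 + (- R x)\<^sup>2) - (1 - sqrt 5 / (cX x - (- qX x)))\<bar>
      \<le> ((4 * K * (1 + (2 * K + sqrt 5) + K) + (2 * K + sqrt 5)) / (5 * \<delta>)) * ?\<epsilon>"
      by (rule arctan_speed_estimate[OF int']) (use e E f c q r K(2) K(5)[OF x1] in linarith)+
    moreover have "2 * ((- (- qX x) + e x) * (cX x + sqrt 5 - (- qX x)) - (- R x) * (- (- R x) + (qX x / x + cX x / x)))
        / ((cX x + sqrt 5 - (- qX x))\<^sup>2 + (- R x)\<^sup>2) = - 2 * z2 x"
    proof -
      have "2 * ((- (- qX x) + e x) * (cX x + sqrt 5 - (- qX x)) - (- R x) * (- (- R x) + (qX x / x + cX x / x)))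
        = - 2 * ((- qX x - e x) * m2 x - R x * (qX x / x + (R x + cX x / x)))"
        by (simp add: m2_def s_def algebra_simps)
      moreover have "cX x + sqrt 5 - (- qX x) = m2 x" by (simp add: m2_def s_def)
      ultimately show ?thesis by (simp only: z2_def power2_minus times_divide_eq_right)
    qed
    ultimately have h2: "\<bar>- 2 * z2 x - (1 - s / (cX x + qX x))\<bar> \<le> B1 / x"
      by (simp add: B1_def s_def)
    define p where "p = P x"
    have p: "0 < p" "p \<le> 2 * K / x" "p \<le> 2 * K"
    proof -
      show "0 < p" using P_pos x unfolding p_def by simp
      show "p \<le> 2 * K / x" unfolding p_def P_cX[OF x] using cq x by (intro divide_right_mono) auto
      also have "2 * K / x \<le> 2 * K" using x1 K(1) by (simp add: divide_le_eq)
      finally show "p \<le> 2 * K" .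
    qed
    have r2: "(R x)\<^sup>2 \<le> K\<^sup>2" using r K(1) abs_le_square_iff[of "R x" K] by simp
    let ?N = "2 * cX x * p * (20 + 4 * (R x)\<^sup>2) + s / x * (p + 2 * s) * (20 + 4 * (R x)\<^sup>2) - 4 * s * cX x * p * (p + 4 * s)"
    let ?D = "(p + 2 * s)\<^sup>2 + (2 * R x)\<^sup>2"
    have D: "?D \<ge> 20"
    proof -
      have "(2 * s)\<^sup>2 \<le> (p + 2 * s)\<^sup>2" using p s by (intro power_mono) auto
      moreover have "(2 * s)\<^sup>2 = 20" using s(1) by (simp add: power2_eq_square)
      ultimately show ?thesis using zero_le_power2[of "2 * R x"] by linarith
    qed
    have D2: "20 + 4 * (R x)\<^sup>2 \<ge> 20" by simp
    \<comment> \<open>Here \<open>P\<close> and sqrt 5/x, both O(1/x), are dropped from the speed;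
      \<open>?N\<close> collects the difference.\<close>
    have h3: "\<bar>angular_speed x - s * cX x / (5 + (R x)\<^sup>2)\<bar> \<le> B2 / x"
    proof -
      have "angular_speed x = (2 * cX x + s / x) * (p + 2 * s) / ?D"
        unfolding angular_speed_def p_def s_def X0_cX[OF x] using x by (simp add: field_simps)
      moreover have "s * cX x / (5 + (R x)\<^sup>2) = 4 * s * cX x / (20 + 4 * (R x)\<^sup>2)"
        using mult_divide_mult_cancel_left[of 4 "s * cX x" "5 + (R x)\<^sup>2"] by (simp add: algebra_simps)
      moreover have "(2 * cX x + s / x) * (p + 2 * s) * (20 + 4 * (R x)\<^sup>2) - 4 * s * cX x * ?D = ?N"
      proof -
        have "(p + 2 * s)\<^sup>2 = p * p + 4 * s * p + 20"
          using s(1) by (simp add: power2_eq_square algebra_simps)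
        then show ?thesis by (simp add: algebra_simps power2_eq_square)
      qed
      ultimately have "angular_speed x - s * cX x / (5 + (R x)\<^sup>2) = ?N / (?D * (20 + 4 * (R x)\<^sup>2))"
        using D D2 by (simp only: diff_frac_eq)
      moreover have "\<bar>?N / (?D * (20 + 4 * (R x)\<^sup>2))\<bar> \<le>
        (2 * K * (2 * K / x) * (20 + 4 * K\<^sup>2) + s / x * (2 * K + 2 * s) * (20 + 4 * K\<^sup>2) + 4 * s * K * (2 * K / x) * (2 * K + 4 * s)) / (20 * 20)"
      proof (rule abs_quotient_le)
        show "20 * 20 \<le> ?D * (20 + 4 * (R x)\<^sup>2)" using D D2 by (intro mult_mono) auto
        have "0 \<le> 2 * cX x * p * (20 + 4 * (R x)\<^sup>2)" "0 \<le> s / x * (p + 2 * s) * (20 + 4 * (R x)\<^sup>2)"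
          "0 \<le> 4 * s * cX x * p * (p + 4 * s)" using c p s x by simp_all
        moreover have "2 * cX x * p * (20 + 4 * (R x)\<^sup>2) \<le> 2 * K * (2 * K / x) * (20 + 4 * K\<^sup>2)"
          by (intro mult_mono) (use c p K(1) r2 x in simp_all)
        moreover have "s / x * (p + 2 * s) * (20 + 4 * (R x)\<^sup>2) \<le> s / x * (2 * K + 2 * s) * (20 + 4 * K\<^sup>2)"
          by (intro mult_mono) (use s p K(1) r2 x in simp_all)
        moreover have "4 * s * cX x * p * (p + 4 * s) \<le> 4 * s * K * (2 * K / x) * (2 * K + 4 * s)"
          by (intro mult_mono) (use s p K(1) c x in simp_all)
        ultimately show "\<bar>?N\<bar> \<le> 2 * K * (2 * K / x) * (20 + 4 * K\<^sup>2) + s / x * (2 * K + 2 * s) * (20 + 4 * K\<^sup>2) + 4 * s * K * (2 * K / x) * (2 * K + 4 * s)"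
          by linarith
      qed simp
      moreover have "(2 * K * (2 * K / x) * (20 + 4 * K\<^sup>2) + s / x * (2 * K + 2 * s) * (20 + 4 * K\<^sup>2) + 4 * s * K * (2 * K / x) * (2 * K + 4 * s)) / (20 * 20) = B2 / x"
        unfolding B2_def using x by (simp add: field_simps)
      ultimately show ?thesis by (simp only:)
    qed
    \<comment> \<open>By the first integral the two denominators differ by
      \<open>E x\<close>.\<close>
    have h4: "\<bar>s * cX x / (5 + (R x)\<^sup>2) - s * cX x / ((cX x)\<^sup>2 - (qX x)\<^sup>2)\<bar> \<le> B3 / x"
    proof -
      have g: "5 + (R x)\<^sup>2 + E x \<ge> 5" "5 + (R x)\<^sup>2 \<ge> 5" by (auto simp: E_def)
      have "s * cX x / (5 + (R x)\<^sup>2) - s * cX x / (5 + (R x)\<^sup>2 + E x) = s * cX x * E x / ((5 + (R x)\<^sup>2) * (5 + (R x)\<^sup>2 + E x))"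
      proof -
        have "5 + (R x)\<^sup>2 \<noteq> 0" "5 + (R x)\<^sup>2 + E x \<noteq> 0" using g by linarith+
        then show ?thesis by (simp add: diff_frac_eq algebra_simps)
      qed
      moreover have "\<bar>s * cX x * E x / ((5 + (R x)\<^sup>2) * (5 + (R x)\<^sup>2 + E x))\<bar> \<le> s * K * ?\<epsilon> / (5 * 5)"
      proof (rule abs_quotient_le)
        show "\<bar>s * cX x * E x\<bar> \<le> s * K * ?\<epsilon>" unfolding abs_mult using s c E K(1) by (intro mult_mono) auto
        show "5 * 5 \<le> (5 + (R x)\<^sup>2) * (5 + (R x)\<^sup>2 + E x)" using g by (intro mult_mono) auto
      qed simp
      ultimately show ?thesis unfolding int B3_def by simp
    qed
    have "s * cX x / ((cX x)\<^sup>2 - (qX x)\<^sup>2) = s / (cX x - qX x) / 2 + s / (cX x + qX x) / 2"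
    proof -
      have "s * ((a + b) / 2) / (a * b) = s / a / 2 + s / b / 2" if "a \<noteq> 0" "b \<noteq> 0" for a b
        using that by (simp add: field_simps)
      from this[of "cX x - qX x" "cX x + qX x"] show ?thesis
        using cq_sum_pos[OF x] cq_diff_pos[OF x] by (simp add: algebra_simps power2_eq_square)
    qed
    then have h5: "\<bar>s * cX x / (5 + (R x)\<^sup>2) - (s / (cX x - qX x) / 2 + s / (cX x + qX x) / 2)\<bar> \<le> B3 / x"
      using h4 by (simp only:)
    have "\<bar>w - 1 - (v2 - v1)\<bar> \<le> e1 + e2 + e3"
      if "\<bar>2 * v1 - (1 - a)\<bar> \<le> e1" "\<bar>- 2 * v2 - (1 - b)\<bar> \<le> e1" "\<bar>w - t\<bar> \<le> e2" "\<bar>t - (a / 2 + b / 2)\<bar> \<le> e3"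
      for w v1 v2 a b t e1 e2 e3 :: real using that by linarith
    from this[OF h1 h2 h3 h5] show ?thesis by (simp only: add_divide_distrib)
  qed
  show thesis by (rule that[OF d b])
qed

text \<open>The function \<theta> + \<sigma> x + \<sigma> \<open>phase\<close> has a derivative
  tending to 0, so by l'Hospital it is o(x). Since \<open>phase\<close> is bounded, only -\<sigma> x
  remains at order x.\<close>

lemma mean_of_angle:
  assumes \<theta>: "\<And>x. x > 1 \<Longrightarrow> (\<theta> has_real_derivative - \<sigma> * angular_speed x) (at x)"
  shows "((\<lambda>x. \<theta> x / x) \<longlongrightarrow> - \<sigma>) at_top"
proof -
  obtain \<zeta> B where z: "\<And>x. x \<ge> 1 \<Longrightarrow> (phase has_real_derivative \<zeta> x) (at x)"
    "\<And>x. x \<ge> 1 \<Longrightarrow> \<bar>angular_speed x - 1 - \<zeta> x\<bar> \<le> B / x" using phase_deriv by blast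
  let ?g = "\<lambda>x. \<theta> x + \<sigma> * x + \<sigma> * phase x"
  have "((\<lambda>x. ?g x / x) \<longlongrightarrow> 0) at_top"
  proof (rule lhospital_at_top_at_top)
    show "LIM x at_top. x :> at_top" by (rule filterlim_ident)
    show "\<forall>\<^sub>F x in at_top. (?g has_real_derivative - \<sigma> * (angular_speed x - 1 - \<zeta> x)) (at x)"
      using eventually_gt_at_top[of 1]
      by eventually_elim (auto intro!: derivative_eq_intros \<theta> z(1) simp: algebra_simps)
    show "\<forall>\<^sub>F x in at_top. ((\<lambda>x. x) has_real_derivative 1) (at x)" by simp
    have "((\<lambda>x. angular_speed x - 1 - \<zeta> x) \<longlongrightarrow> 0) at_top"
      by (rule tendsto_0_of_O_inverse[of _ B]) (use z(2) in simp)
    then show "((\<lambda>x. - \<sigma> * (angular_speed x - 1 - \<zeta> x) / 1) \<longlongrightarrow> 0) at_top"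
      using tendsto_mult_right_zero[of _ _ "- \<sigma>"] by simp
  qed simp
  moreover have "((\<lambda>x. \<sigma> * phase x / x) \<longlongrightarrow> 0) at_top"
    by (rule tendsto_0_of_O_inverse[of _ "\<bar>\<sigma>\<bar> * pi"])
      (use phase_bounded in \<open>auto simp: abs_mult intro!: divide_right_mono mult_left_mono\<close>)
  ultimately have "((\<lambda>x. ?g x / x - \<sigma> - \<sigma> * phase x / x) \<longlongrightarrow> 0 - \<sigma> - 0) at_top"
    by (intro tendsto_intros)
  moreover have "\<forall>\<^sub>F x in at_top. ?g x / x - \<sigma> - \<sigma> * phase x / x = \<theta> x / x"
    using eventually_gt_at_top[of 0] by eventually_elim (simp add: field_simps)
  ultimately show ?thesis using tendsto_cong by fastforce
qed

section \<open>The frame along an \<open>x\<close>-curve\<close>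

lemma orthonormal_list4:
  "orthonormal_list [a, b, c, d] \<longleftrightarrow>
     a \<bullet> a = 1 \<and> b \<bullet> b = 1 \<and> c \<bullet> c = 1 \<and> d \<bullet> d = 1 \<and> a \<bullet> b = 0 \<and> a \<bullet> c = 0 \<and> a \<bullet> d = 0 \<and>
     b \<bullet> c = 0 \<and> b \<bullet> d = 0 \<and> c \<bullet> d = 0"
  unfolding orthonormal_list_def
  by (simp add: All_less_Suc numeral_nat inner_commute) (auto simp: inner_commute)

lemma orthonormal_list2: "orthonormal_list [a, b] \<longleftrightarrow> a \<bullet> a = 1 \<and> b \<bullet> b = 1 \<and> a \<bullet> b = 0"
  unfolding orthonormal_list_def
  by (simp add: All_less_Suc numeral_nat inner_commute) (auto simp: inner_commute)

text \<open>Four orthonormal vectors are independent, hence span. The residual of the expansion is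
  orthogonal to all of them and so to itself.\<close>

lemma orthonormal4_expand:
  fixes a b c d x :: "real^4"
  assumes "orthonormal_list [a, b, c, d]"
  shows "x = (x \<bullet> a) *\<^sub>R a + (x \<bullet> b) *\<^sub>R b + (x \<bullet> c) *\<^sub>R c + (x \<bullet> d) *\<^sub>R d"
proof -
  have o: "a \<bullet> a = 1" "b \<bullet> b = 1" "c \<bullet> c = 1" "d \<bullet> d = 1" "a \<bullet> b = 0" "a \<bullet> c = 0" "a \<bullet> d = 0"
     "b \<bullet> c = 0" "b \<bullet> d = 0" "c \<bullet> d = 0" using assms by (simp_all add: orthonormal_list4)
  then have o2: "b \<bullet> a = 0" "c \<bullet> a = 0" "d \<bullet> a = 0" "c \<bullet> b = 0" "d \<bullet> b = 0" "d \<bullet> c = 0"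
    by (metis inner_commute)+
  note o' = o o2
  have ne: "a \<noteq> b" "a \<noteq> c" "a \<noteq> d" "b \<noteq> c" "b \<noteq> d" "c \<noteq> d" using o by auto
  let ?B = "{a, b, c, d}"
  have card: "card ?B = 4" using ne by simp
  have "pairwise orthogonal ?B" using o' by (simp add: pairwise_def orthogonal_def)
  moreover have "0 \<notin> ?B" using o by auto
  ultimately have ind: "independent ?B" by (rule pairwise_orthogonal_independent)
  have sp: "UNIV \<subseteq> span ?B"
    by (rule card_ge_dim_independent) (use ind card in simp_all)
  define r where "r = x - ((x \<bullet> a) *\<^sub>R a + (x \<bullet> b) *\<^sub>R b + (x \<bullet> c) *\<^sub>R c + (x \<bullet> d) *\<^sub>R d)"
  have "r \<bullet> z = 0" if "z \<in> ?B" for z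
    using that o' by (auto simp: r_def inner_diff_left inner_add_left )
  then have "orthogonal r r"
    using sp by (intro orthogonal_to_span[of r ?B r]) (auto simp: orthogonal_def)
  then have "r = 0" by (simp add: orthogonal_self)
  then show ?thesis by (simp add: r_def)
qed

lemma orthonormal4_inner:
  fixes a b c d x y :: "real^4"
  assumes "orthonormal_list [a, b, c, d]"
  shows "x \<bullet> y = (x \<bullet> a) * (y \<bullet> a) + (x \<bullet> b) * (y \<bullet> b) + (x \<bullet> c) * (y \<bullet> c) + (x \<bullet> d) * (y \<bullet> d)"
  using arg_cong[OF orthonormal4_expand[OF assms, of x], of "\<lambda>z. z \<bullet> y"]
  by (simp add: inner_add_left inner_commute[of y])

text \<open>A vanishing derivative on the half-line makes the described value exist uniquely, so it
  can be computed at whichever x is convenient.\<close>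

lemma x_independent_value_eq:
  assumes "\<And>x. x > 0 \<Longrightarrow> ((\<lambda>t. g t y) has_vector_derivative 0) (at x)" "x > 0"
  shows "x_independent_value g y = g x y"
proof -
  have "\<exists>p. \<forall>x\<in>{0<..}. g x y = p"
    using has_vector_derivative_zero_constant[of "{0<..}" "\<lambda>t. g t y"] assms(1)
    by (metis convex_real_interval(3) greaterThan_iff has_vector_derivative_at_within)
  then obtain p where p: "\<And>x. x > 0 \<Longrightarrow> g x y = p" by auto
  have "x_independent_value g y = p"
    unfolding x_independent_value_def using p zero_less_one by (intro the_equality) blast+
  then show ?thesis using p assms(2) by simp
qed

text \<open>Along a sequence of times spaced by the period 2 pi/k the expression is constant, so
  that constant is 0. Phases 0 and pi/2 isolate p and q.\<close>

lemma trig_combination_limit_0: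
  fixes p q k :: real
  assumes lim: "((\<lambda>t. cos (k * t) * p - sin (k * t) * q) \<longlongrightarrow> 0) at_top" and k: "k > 0"
  shows "p = 0" "q = 0"
proof -
  have "filterlim (\<lambda>n. c / k + (2 * pi / k) * real n) at_top sequentially" for c
    using k by (intro filterlim_tendsto_add_at_top[OF tendsto_const]
        filterlim_tendsto_pos_mult_at_top[OF tendsto_const _ filterlim_real_sequentially]) simp
  from filterlim_compose[OF lim this]
  have "(\<lambda>n::nat. cos (c + 2 * pi * real n) * p - sin (c + 2 * pi * real n) * q) \<longlonglongrightarrow> 0" for c
    using k by (simp add: distrib_left)
  moreover have "cos (c + 2 * pi * real n) = cos c" "sin (c + 2 * pi * real n) = sin c" for c n
    using cos_2npi[of n] sin_2npi[of n] by (simp_all add: cos_add sin_add mult_ac)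
  ultimately have *: "(\<lambda>n::nat. cos c * p - sin c * q) \<longlonglongrightarrow> 0" for c
    by (simp only:)
  show "p = 0" using LIMSEQ_unique[OF *[of 0] tendsto_const] by simp
  show "q = 0" using LIMSEQ_unique[OF *[of "pi / 2"] tendsto_const] by simp
qed

section \<open>The moving frame \<open>u\<close>, \<open>n\<close>, \<open>X\<alpha>\<close>,
  \<open>\<xi>\<close>\<close>

locale frame =
  fixes \<phi> X\<alpha> X\<beta> \<xi> :: "real \<Rightarrow> real \<Rightarrow> real^4"
  assumes frame: "frame_field \<phi> X\<alpha> X\<beta> \<xi>"
begin

abbreviation n :: "real \<Rightarrow> real \<Rightarrow> real^4" where "n \<equiv> n_vec \<phi> X\<beta>"
abbreviation u :: "real \<Rightarrow> real^4" where "u \<equiv> u_vec \<phi> X\<beta>"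

text \<open>This is the speed of the curve \<open>n(., y)\<close>: \<phi> and
  \<open>X\<beta>\<close> both move along \<open>X\<alpha>\<close>, and so does
  \<open>n\<close>.\<close>

definition \<kappa> :: "real \<Rightarrow> real \<Rightarrow> real" where
  "\<kappa> x y = sqrt (1 + y\<^sup>2) * (2 * X0 x + sqrt 5) / (x * hfun x y)"

context fixes x y :: real assumes x: "x > 0" begin

lemma frame_orthonormal: "orthonormal_list [\<phi> x y, X\<alpha> x y, X\<beta> x y, \<xi> x y]"
  using frame x unfolding frame_field_def by blast

lemma frame_inner:
  "\<phi> x y \<bullet> \<phi> x y = 1" "X\<alpha> x y \<bullet> X\<alpha> x y = 1" "X\<beta> x y \<bullet> X\<beta> x y = 1" "\<xi> x y \<bullet> \<xi> x y = 1"
  "\<phi> x y \<bullet> X\<alpha> x y = 0" "\<phi> x y \<bullet> X\<beta> x y = 0" "\<phi> x y \<bullet> \<xi> x y = 0"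
  "X\<alpha> x y \<bullet> \<phi> x y = 0" "X\<beta> x y \<bullet> \<phi> x y = 0" "\<xi> x y \<bullet> \<phi> x y = 0"
  "X\<alpha> x y \<bullet> X\<beta> x y = 0" "X\<alpha> x y \<bullet> \<xi> x y = 0" "X\<beta> x y \<bullet> \<xi> x y = 0"
  "X\<beta> x y \<bullet> X\<alpha> x y = 0" "\<xi> x y \<bullet> X\<alpha> x y = 0" "\<xi> x y \<bullet> X\<beta> x y = 0"
  using frame_orthonormal unfolding orthonormal_list4 by (auto simp: inner_commute)

lemma frame_deriv_x:
  "((\<lambda>t. \<phi> t y) has_vector_derivative - a1 x y *\<^sub>R X\<alpha> x y) (at x)"
  "((\<lambda>t. \<xi> t y) has_vector_derivative b1 x y *\<^sub>R X\<alpha> x y) (at x)"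
  "((\<lambda>t. X\<beta> t y) has_vector_derivative c1 x y *\<^sub>R X\<alpha> x y) (at x)"
  "((\<lambda>t. X\<alpha> t y) has_vector_derivative
     a1 x y *\<^sub>R \<phi> x y - b1 x y *\<^sub>R \<xi> x y - c1 x y *\<^sub>R X\<beta> x y) (at x)"
  using frame x unfolding frame_field_def by blast+

lemma frame_deriv_y:
  "((\<lambda>t. \<phi> x t) has_vector_derivative - a2 x y *\<^sub>R X\<beta> x y) (at y)"
  "((\<lambda>t. \<xi> x t) has_vector_derivative b2 x y *\<^sub>R X\<beta> x y) (at y)"
  "((\<lambda>t. X\<alpha> x t) has_vector_derivative c2 x y *\<^sub>R X\<beta> x y) (at y)"
  "((\<lambda>t. X\<beta> x t) has_vector_derivative
     a2 x y *\<^sub>R \<phi> x y - b2 x y *\<^sub>R \<xi> x y - c2 x y *\<^sub>R X\<alpha> x y) (at y)"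
  using frame x unfolding frame_field_def by blast+

lemma n_deriv: "((\<lambda>t. n t y) has_vector_derivative - \<kappa> x y *\<^sub>R X\<alpha> x y) (at x)"
proof -
  have "((\<lambda>t. n t y) has_vector_derivative
      (1 / sqrt (1 + y\<^sup>2)) *\<^sub>R (c1 x y *\<^sub>R X\<alpha> x y + y *\<^sub>R (- a1 x y *\<^sub>R X\<alpha> x y))) (at x)"
    unfolding n_vec_def by (auto intro!: derivative_eq_intros frame_deriv_x)
  moreover have "(1 / sqrt (1 + y\<^sup>2)) *\<^sub>R (c1 x y *\<^sub>R X\<alpha> x y + y *\<^sub>R (- a1 x y *\<^sub>R X\<alpha> x y)) = - \<kappa> x y *\<^sub>R X\<alpha> x y"
  proof -
    define q where "q = sqrt (1 + y\<^sup>2)"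
    have q: "q > 0" "1 + y\<^sup>2 = q * q" by (simp_all add: q_def add_pos_nonneg)
    have "c1 x y - y * a1 x y = - (2 * X0 x + sqrt 5) / (x * hfun x y) * (1 + y\<^sup>2)"
      using x hfun_pos[OF x, of y] by (simp add: c1_def a1_def field_simps power2_eq_square)
    then have "(1 / sqrt (1 + y\<^sup>2)) * (c1 x y - y * a1 x y) = - \<kappa> x y"
      using q(1) unfolding \<kappa>_def q_def[symmetric] unfolding q(2) by (simp add: minus_divide_left algebra_simps)
    then show ?thesis by (metis (no_types, opaque_lifting) scaleR_diff_left scaleR_minus_left scaleR_scaleR 
      scaleR_right.add mult_minus_right diff_conv_add_uminus)
  qed
  ultimately show ?thesis by simp
qed

lemma X\<alpha>_deriv: "((\<lambda>t. X\<alpha> t y) has_vector_derivative \<kappa> x y *\<^sub>R n x y - b1 x y *\<^sub>R \<xi> x y) (at x)"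
proof -
  let ?k = "(2 * X0 x + sqrt 5) / (x * hfun x y)"
  have "c1 x y = - ?k" "a1 x y = y * ?k" 
    using x hfun_pos[OF x, of y] by (simp_all add: c1_def a1_def field_simps)
  moreover have "\<kappa> x y *\<^sub>R n x y = ?k *\<^sub>R (X\<beta> x y + y *\<^sub>R \<phi> x y)"
  proof -
    have "sqrt (1 + y\<^sup>2) > 0" by (simp add: add_pos_nonneg)
    then show ?thesis by (simp add: \<kappa>_def n_vec_def)
  qed
  ultimately have "a1 x y *\<^sub>R \<phi> x y - b1 x y *\<^sub>R \<xi> x y - c1 x y *\<^sub>R X\<beta> x y = \<kappa> x y *\<^sub>R n x y - b1 x y *\<^sub>R \<xi> x y"
    by (simp add: algebra_simps)
  then show ?thesis using frame_deriv_x(4) by (simp only:)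
qed

lemma n_inner: "n x y \<bullet> n x y = 1" "n x y \<bullet> X\<alpha> x y = 0" "n x y \<bullet> \<xi> x y = 0"
  "X\<alpha> x y \<bullet> n x y = 0" "\<xi> x y \<bullet> n x y = 0"
proof -
  define k where "k = 1 / sqrt (1 + y\<^sup>2)"
  have "1 + y\<^sup>2 > 0" by (simp add: add_pos_nonneg)
  then have k: "k * k * (1 + y * y) = 1" by (simp add: k_def power_divide flip: power2_eq_square)
  then show "n x y \<bullet> n x y = 1"
    unfolding n_vec_def k_def[symmetric]
    by (simp add: inner_add_left inner_add_right frame_inner algebra_simps)
qed (simp_all add: n_vec_def inner_add_left inner_add_right frame_inner)

text \<open>The relation \<open>a1 = - y * c1\<close> makes the motions of \<phi> and
  \<open>X\<beta>\<close> cancel in this combination.\<close>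

lemma u_eq: "u y = (1 / sqrt (1 + y\<^sup>2)) *\<^sub>R (y *\<^sub>R X\<beta> x y - \<phi> x y)"
  unfolding u_vec_def
proof (rule x_independent_value_eq[OF _ x])
  fix z :: real assume z: "z > 0"
  have d: "((\<lambda>t. \<phi> t y) has_vector_derivative - a1 z y *\<^sub>R X\<alpha> z y) (at z)"
    "((\<lambda>t. X\<beta> t y) has_vector_derivative c1 z y *\<^sub>R X\<alpha> z y) (at z)"
    using frame z unfolding frame_field_def by blast+
  have "((\<lambda>t. (1 / sqrt (1 + y\<^sup>2)) *\<^sub>R (y *\<^sub>R X\<beta> t y - \<phi> t y)) has_vector_derivative
      (1 / sqrt (1 + y\<^sup>2)) *\<^sub>R (y *\<^sub>R (c1 z y *\<^sub>R X\<alpha> z y) - - a1 z y *\<^sub>R X\<alpha> z y)) (at z)"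
    by (auto intro!: derivative_eq_intros d)
  moreover have "a1 z y = - y * c1 z y" by (simp add: a1_def c1_def)
  ultimately show "((\<lambda>t. (1 / sqrt (1 + y\<^sup>2)) *\<^sub>R (y *\<^sub>R X\<beta> t y - \<phi> t y)) has_vector_derivative 0) (at z)"
    by simp
qed

lemma u_inner: "u y \<bullet> u y = 1" "u y \<bullet> X\<alpha> x y = 0" "u y \<bullet> \<xi> x y = 0" "u y \<bullet> n x y = 0"
proof -
  define k where "k = 1 / sqrt (1 + y\<^sup>2)"
  have "1 + y\<^sup>2 > 0" by (simp add: add_pos_nonneg)
  then have k: "k * k * (1 + y * y) = 1" by (simp add: k_def power_divide flip: power2_eq_square)
  then show "u y \<bullet> u y = 1"
    unfolding u_eq k_def[symmetric]
    by (simp add: inner_diff_left inner_diff_right frame_inner algebra_simps)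
qed (simp_all add: u_eq n_vec_def inner_add_left inner_add_right inner_diff_left inner_diff_right frame_inner)

lemma moving_orthonormal: "orthonormal_list [u y, n x y, X\<alpha> x y, \<xi> x y]"
  unfolding orthonormal_list4 by (simp add: n_inner u_inner frame_inner)

end

text \<open>This is du/dy in the moving frame with the factor y^2/(1 + y^2) divided out, which
  leaves an expression continuous at y = 0.\<close>

definition v :: "real \<Rightarrow> real \<Rightarrow> real^4" where
  "v x y = (2 * (1 + y\<^sup>2) * P x / hfun x y - 1) *\<^sub>R n x y
     + (sqrt (1 + y\<^sup>2) / hfun x y) *\<^sub>R ((P x + 2 * sqrt 5) *\<^sub>R \<xi> x y - (2 * R x) *\<^sub>R X\<alpha> x y)"

text \<open>Since \<open>a2 = 2 y^2 P/h - 1\<close> and \<open>b2\<close>, \<open>c2\<close> are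
  multiples of y, the factor y in front of \<open>X\<beta>\<close> and the derivative of the
  normalization leave y^2 in every component. The \<phi> and \<open>X\<beta>\<close> components are
  in the ratio y : 1, so they combine to a multiple of \<open>n\<close>.\<close>

lemma u_deriv:
  assumes x: "x > 0"
  shows "(u has_vector_derivative (y\<^sup>2 / (1 + y\<^sup>2)) *\<^sub>R v x y) (at y)"
proof -
  define T where "T = 1 + y\<^sup>2"
  define k where "k = 1 / sqrt T"
  define h where "h = hfun x y"
  have T: "T > 0" by (simp add: T_def add_pos_nonneg)
  have k: "k * k = 1 / T" "k > 0" using T by (simp_all add: k_def)
  have h: "h > 0" using hfun_pos[OF x] by (simp add: h_def)
  have ueq: "u = (\<lambda>y. (1 / sqrt (1 + y\<^sup>2)) *\<^sub>R (y *\<^sub>R X\<beta> x y - \<phi> x y))"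
    using u_eq[OF x] by blast
  have "((\<lambda>y. 1 / sqrt (1 + y\<^sup>2)) has_real_derivative - y * k / T) (at y)"
    using T unfolding T_def k_def
    by (auto intro!: derivative_eq_intros simp: power2_eq_square divide_simps)
  then have "(u has_vector_derivative
      k *\<^sub>R ((y *\<^sub>R (a2 x y *\<^sub>R \<phi> x y - b2 x y *\<^sub>R \<xi> x y - c2 x y *\<^sub>R X\<alpha> x y) + 1 *\<^sub>R X\<beta> x y) - - a2 x y *\<^sub>R X\<beta> x y)
      + (- y * k / T) *\<^sub>R (y *\<^sub>R X\<beta> x y - \<phi> x y)) (at y)" (is "(_ has_vector_derivative ?D) _")
    unfolding ueq k_def T_def
    by (intro has_vector_derivative_scaleR has_vector_derivative_diff frame_deriv_y[OF x])
      (auto intro: DERIV_ident)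
  moreover have "?D = (y\<^sup>2 / T) *\<^sub>R v x y"
  proof -
    have hd: "h = 2 * X0 x - x\<^sup>2 * P x + y\<^sup>2 * P x + sqrt 5"
      using hfun_eq[OF x, of y] by (simp add: h_def H_def)
    have a2: "a2 x y = 2 * y\<^sup>2 * P x / h - 1"
    proof -
      have "2 * X0 x + sqrt 5 - (x\<^sup>2 + y\<^sup>2) * P x = h - 2 * y\<^sup>2 * P x"
        unfolding hd by (simp add: algebra_simps)
      then show ?thesis
        unfolding a2_def X0'_eq h_def[symmetric] using x h
        by (simp add: right_diff_distrib)
    qed
    have b2: "b2 x y = - (y * (P x + 2 * sqrt 5)) / h"
      unfolding b2_def X0'_eq h_def[symmetric] using x h by (simp add: field_simps)
    have c2: "c2 x y = 2 * y * R x / h"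
      using x unfolding c2_def X0'_eq h_def[symmetric] by (simp add: X0''_eq)
    have k1: "k * (sqrt T / h) = 1 / h" using T by (simp add: k_def)
    have sT: "sqrt T = k * T" using T by (simp add: k_def real_div_sqrt)
    have 1: "?D = (k * (1 + a2 x y) - y * k / T * y) *\<^sub>R X\<beta> x y + (k * y * a2 x y + y * k / T) *\<^sub>R \<phi> x y
        + (- (k * y * b2 x y)) *\<^sub>R \<xi> x y + (- (k * y * c2 x y)) *\<^sub>R X\<alpha> x y"
      by (simp add: algebra_simps)
    have 2: "(y\<^sup>2 / T) *\<^sub>R v x y = ((y\<^sup>2 / T) * (2 * T * P x / h - 1) * k) *\<^sub>R X\<beta> x y
        + ((y\<^sup>2 / T) * (2 * T * P x / h - 1) * k * y) *\<^sub>R \<phi> x y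
        + ((y\<^sup>2 / T) * (k * T / h) * (P x + 2 * sqrt 5)) *\<^sub>R \<xi> x y
        + (- ((y\<^sup>2 / T) * (k * T / h) * (2 * R x))) *\<^sub>R X\<alpha> x y"
      unfolding v_def n_vec_def T_def[symmetric] k_def[symmetric] h_def[symmetric] unfolding sT
      by (simp add: scaleR_add_right scaleR_diff_right mult_ac)
    have Ty: "y * y = T - 1" by (simp add: T_def power2_eq_square)
    have e1: "k * (1 + a2 x y) - y * k / T * y = (y\<^sup>2 / T) * (2 * T * P x / h - 1) * k"
      unfolding a2 using T h by (simp add: field_simps power2_eq_square)
    have e2: "k * y * a2 x y + y * k / T = (y\<^sup>2 / T) * (2 * T * P x / h - 1) * k * y"
    proof -
      have "y\<^sup>2 / T = 1 - 1 / T" using T unfolding power2_eq_square Ty by (simp add: field_simps)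
      moreover have "(y\<^sup>2 / T) * (2 * T * P x / h - 1) = 2 * y\<^sup>2 * P x / h - y\<^sup>2 / T"
        using T by (simp add: right_diff_distrib)
      ultimately have z: "(y\<^sup>2 / T) * (2 * T * P x / h - 1) = 2 * y\<^sup>2 * P x / h - 1 + 1 / T"
        by linarith
      show ?thesis unfolding a2 z by (simp add: algebra_simps)
    qed
    have e3: "- (k * y * b2 x y) = (y\<^sup>2 / T) * (k * T / h) * (P x + 2 * sqrt 5)"
      unfolding b2 using T by (simp add: power2_eq_square)
    have e4: "- (k * y * c2 x y) = - ((y\<^sup>2 / T) * (k * T / h) * (2 * R x))"
      unfolding c2 using T by (simp add: power2_eq_square)
    show ?thesis unfolding 1 2 e1 e2 e3 e4 ..
  qed
  ultimately show ?thesis by (simp add: T_def)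
qed

lemma v_inner:
  assumes x: "x > 0"
  shows "v x y \<bullet> n x y = 2 * (1 + y\<^sup>2) * P x / hfun x y - 1"
    "v x y \<bullet> \<xi> x y = sqrt (1 + y\<^sup>2) / hfun x y * (P x + 2 * sqrt 5)"
    "v x y \<bullet> X\<alpha> x y = - (sqrt (1 + y\<^sup>2) / hfun x y * (2 * R x))"
    "u y \<bullet> v x y = 0"
  unfolding v_def
  by (simp_all add: inner_add_left inner_diff_left inner_add_right inner_diff_right
      n_inner[OF x] frame_inner[OF x] u_inner[OF x])

text \<open>Adding \<open>n\<close> removes the -1 in \<open>v\<close>. Every remaining coefficient
  has a numerator bounded by a multiple of 1 + y^2 and the denominator \<open>hfun x y\<close>,
  which is at least \<delta> x.\<close>

lemma n_plus_v_bound: obtains M where "M \<ge> 0" "\<And>x y. x \<ge> 1 \<Longrightarrow> norm (n x y + v x y) \<le> M * (1 + y\<^sup>2) / x"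
proof -
  obtain K \<delta> where K: "K \<ge> 1" "\<delta> > 0" "\<And>x. x \<ge> 1 \<Longrightarrow> cX x \<le> K"
    "\<And>x. x \<ge> 1 \<Longrightarrow> \<delta> \<le> cX x - qX x" using cq_bounds by metis
  define L where "L = 4 * K + (2 * K + 2 * sqrt 5 + 2 * K)"
  have "norm (n x y + v x y) \<le> L / \<delta> * (1 + y\<^sup>2) / x" if x1: "x \<ge> 1" for x y
  proof -
    have x: "x > 0" using x1 by simp
    have T1: "1 \<le> 1 + y\<^sup>2" by simp
    have sT: "sqrt (1 + y\<^sup>2) \<le> 1 + y\<^sup>2"
      using T1 by (intro real_le_lsqrt self_le_power) auto
    have h: "\<delta> * x \<le> hfun x y" "hfun x y > 0"
      using order_trans[OF mult_right_mono[OF K(4)[OF x1], of x] hfun_ge[OF x, of y, unfolded H_cX[OF x], simplified mult.commute[of x]]]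
        x hfun_pos[OF x, of y]
      by simp_all
    have "P x \<le> cX x + qX x" unfolding P_cX[OF x] using x1 cq_sum_pos[OF x] by (simp add: divide_le_eq)
    then have p: "0 < P x" "P x \<le> 2 * K" using P_pos[of x] x qX_less[OF x] K(3)[OF x1] by linarith+
    have r: "\<bar>R x\<bar> \<le> K" using R_le[OF x] K(3)[OF x1] by linarith
    have nn: "norm (n x y) = 1" "norm (\<xi> x y) = 1" "norm (X\<alpha> x y) = 1"
      by (simp_all add: norm_eq_sqrt_inner n_inner[OF x] frame_inner[OF x])
    have "n x y + v x y = (2 * (1 + y\<^sup>2) * P x / hfun x y) *\<^sub>R n x y
     + (sqrt (1 + y\<^sup>2) / hfun x y) *\<^sub>R ((P x + 2 * sqrt 5) *\<^sub>R \<xi> x y - (2 * R x) *\<^sub>R X\<alpha> x y)"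
      by (simp add: v_def algebra_simps)
    also have "norm \<dots> \<le> 2 * (1 + y\<^sup>2) * P x / hfun x y + sqrt (1 + y\<^sup>2) / hfun x y * ((P x + 2 * sqrt 5) + 2 * \<bar>R x\<bar>)"
    proof (intro order_trans[OF norm_triangle_ineq] add_mono)
      show "norm ((2 * (1 + y\<^sup>2) * P x / hfun x y) *\<^sub>R n x y) \<le> 2 * (1 + y\<^sup>2) * P x / hfun x y"
        using p h by (simp add: nn)
      have "norm ((P x + 2 * sqrt 5) *\<^sub>R \<xi> x y - (2 * R x) *\<^sub>R X\<alpha> x y) \<le> (P x + 2 * sqrt 5) + 2 * \<bar>R x\<bar>"
        using p by (intro order_trans[OF norm_triangle_ineq4]) (simp add: nn abs_mult)
      then show "norm ((sqrt (1 + y\<^sup>2) / hfun x y) *\<^sub>R ((P x + 2 * sqrt 5) *\<^sub>R \<xi> x y - (2 * R x) *\<^sub>R X\<alpha> x y))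
        \<le> sqrt (1 + y\<^sup>2) / hfun x y * ((P x + 2 * sqrt 5) + 2 * \<bar>R x\<bar>)"
        using h unfolding norm_scaleR by (intro mult_mono) auto
    qed
    also have "\<dots> = (2 * (1 + y\<^sup>2) * P x + sqrt (1 + y\<^sup>2) * ((P x + 2 * sqrt 5) + 2 * \<bar>R x\<bar>)) / hfun x y"
      by (simp add: add_divide_distrib)
    also have "\<dots> \<le> (2 * (1 + y\<^sup>2) * (2 * K) + (1 + y\<^sup>2) * ((2 * K + 2 * sqrt 5) + 2 * K)) / (\<delta> * x)"
    proof (intro frac_le add_mono mult_mono)
    qed (use p r K h sT T1 x in \<open>auto intro!: add_nonneg_nonneg mult_nonneg_nonneg\<close>)
    also have "\<dots> = L / \<delta> * (1 + y\<^sup>2) / x" by (simp add: L_def algebra_simps add_divide_distrib)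
    finally show ?thesis .
  qed
  moreover have "L / \<delta> \<ge> 0" using K by (simp add: L_def)
  ultimately show thesis using that by blast
qed

end

section \<open>The limit point of \<open>n\<close>\<close>

text \<open>The logarithm of \<open>\<zeta>\<close> along the curve is \<open>\<integral> \<zeta>'/\<zeta>\<close>, whose imaginary part is the polar angle.\<close>

lemma polar_coordinates:
  fixes z1 z2 z1' z2' \<theta>' :: "real \<Rightarrow> real"
  assumes d1: "\<And>x. x \<ge> 1 \<Longrightarrow> (z1 has_real_derivative z1' x) (at x)"
    and d2: "\<And>x. x \<ge> 1 \<Longrightarrow> (z2 has_real_derivative z2' x) (at x)"
    and c1: "continuous_on {1..} z1'" and c2: "continuous_on {1..} z2'"
    and nz: "\<And>x. x \<ge> 1 \<Longrightarrow> (z1 x)\<^sup>2 + (z2 x)\<^sup>2 \<noteq> 0"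
    and speed: "\<And>x. x \<ge> 1 \<Longrightarrow> z1 x * z2' x - z2 x * z1' x = \<theta>' x * ((z1 x)\<^sup>2 + (z2 x)\<^sup>2)"
  obtains \<rho> \<theta> where "\<And>x. x \<ge> 1 \<Longrightarrow> \<rho> x > 0" "\<And>x. x \<ge> 1 \<Longrightarrow> z1 x = \<rho> x * cos (\<theta> x)"
    "\<And>x. x \<ge> 1 \<Longrightarrow> z2 x = \<rho> x * sin (\<theta> x)"
    "\<And>x. x \<ge> 1 \<Longrightarrow> (\<theta> has_real_derivative \<theta>' x) (at x within {1..})"
proof -
  define \<zeta> where "\<zeta> x = Complex (z1 x) (z2 x)" for x
  define \<zeta>' where "\<zeta>' x = Complex (z1' x) (z2' x)" for x
  define l where "l x = \<zeta>' x / \<zeta> x" for x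
  define L where "L x = integral {1..x} l" for x
  have nz\<zeta>: "\<zeta> x \<noteq> 0" if "x \<ge> 1" for x using nz[OF that] by (auto simp: \<zeta>_def complex_eq_iff)
  have d\<zeta>: "(\<zeta> has_vector_derivative \<zeta>' x) (at x)" if "x \<ge> 1" for x
    using d1[OF that] d2[OF that]
    unfolding \<zeta>_def[abs_def] \<zeta>'_def has_vector_derivative_complex_iff
      has_real_derivative_iff_has_vector_derivative by simp
  have cont\<zeta>: "continuous_on {1..} \<zeta>"
    by (intro continuous_at_imp_continuous_on ballI has_vector_derivative_continuous[OF d\<zeta>]) auto
  have cont\<zeta>': "continuous_on {1..} \<zeta>'"
    unfolding \<zeta>'_def[abs_def] using c1 c2 by (intro continuous_intros)
  have contl: "continuous_on {1..} l"
    unfolding l_def[abs_def] using nz\<zeta> by (intro continuous_intros cont\<zeta> cont\<zeta>') auto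
  \<comment> \<open>The integral starts at 1, so at that endpoint only the one-sided derivative is
    available.\<close>
  have dL: "(L has_vector_derivative l x) (at x within {1..})" if "x \<ge> 1" for x
  proof -
    have "(L has_vector_derivative l x) (at x within {1..x+1})"
      unfolding L_def[abs_def]
      by (rule integral_has_vector_derivative) (use that in \<open>auto intro: continuous_on_subset[OF contl]\<close>)
    moreover have "at x within {1..x+1} = at x within {1..}"
      by (rule at_within_nhd[of x "{..<x+1}"]) auto
    ultimately show ?thesis by simp
  qed
  have const: "((\<lambda>x. \<zeta> x * exp (- L x)) has_vector_derivative 0) (at x within {1..})" if "x \<in> {1..}" for x
  proof -
    from that
    have x: "x \<ge> 1" by simp
    have "((\<lambda>x. exp (- L x)) has_vector_derivative (- l x * exp (- L x))) (at x within {1..})"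
      using field_vector_diff_chain_within[OF has_vector_derivative_minus[OF dL[OF x]],
          of exp "exp (- L x)"] by (auto simp: o_def intro!: DERIV_exp DERIV_subset[OF DERIV_exp])
    from has_vector_derivative_mult[OF has_vector_derivative_at_within[OF d\<zeta>[OF x]] this]
    show ?thesis using nz\<zeta>[OF x] by (simp add: l_def)
  qed
  obtain w where "\<And>x. x \<in> {1..} \<Longrightarrow> \<zeta> x * exp (- L x) = w"
    by (rule has_vector_derivative_zero_constant[OF convex_real_interval(1) const]) blast+
  then have w: "\<zeta> x * exp (- L x) = w" if "x \<ge> 1" for x using that by simp
  have w0: "w \<noteq> 0" using w[of 1] nz\<zeta>[of 1] by auto
  have \<zeta>eq: "\<zeta> x = w * exp (L x)" if "x \<ge> 1" for x
    using w[OF that] by (simp add: exp_minus field_simps)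
  have wp: "w = rcis (cmod w) (Arg w)" by (simp add: rcis_cmod_Arg)
  define \<rho> where "\<rho> x = cmod w * exp (Re (L x))" for x
  define \<theta> where "\<theta> x = Arg w + Im (L x)" for x
  have \<zeta>polar: "\<zeta> x = rcis (\<rho> x) (\<theta> x)" if "x \<ge> 1" for x
  proof -
    have "exp (L x) = rcis (exp (Re (L x))) (Im (L x))"
      by (simp add: exp_eq_polar rcis_def)
    then show ?thesis unfolding \<zeta>eq[OF that] \<rho>_def \<theta>_def by (subst wp) (simp only: rcis_mult)
  qed
  \<comment> \<open>The imaginary part of \<zeta>'/\<zeta> is (z1 z2' - z2 z1')/(z1^2 + z2^2), the
    angular velocity.\<close>
  have im: "Im (l x) = \<theta>' x" if "x \<ge> 1" for x
    using speed[OF that] nz[OF that] by (simp add: l_def \<zeta>_def \<zeta>'_def Im_divide field_simps)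
  show thesis
  proof (rule that[of \<rho> \<theta>])
    fix x :: real assume x: "x \<ge> 1"
    show "\<rho> x > 0" using w0 by (simp add: \<rho>_def)
    show "z1 x = \<rho> x * cos (\<theta> x)" "z2 x = \<rho> x * sin (\<theta> x)"
      using \<zeta>polar[OF x] by (simp_all add: \<zeta>_def rcis_def complex_eq_iff)
    show "(\<theta> has_real_derivative \<theta>' x) (at x within {1..})"
      using dL[OF x] im[OF x] unfolding \<theta>_def[abs_def] has_vector_derivative_complex_iff
      by (auto intro!: derivative_eq_intros simp: has_real_derivative_iff_has_vector_derivative)
  qed
qed

text \<open>Both signs together would put 0 into the connected image of \<open>f\<close>, although
  \<open>f\<close> has no zero.\<close>

lemma constant_sign:
  fixes f g :: "real \<Rightarrow> real"
  assumes "continuous_on {1..} f" and sq: "\<And>x. x \<ge> 1 \<Longrightarrow> (f x)\<^sup>2 = (g x)\<^sup>2" and pos: "\<And>x. x \<ge> 1 \<Longrightarrow> g x > 0"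
  obtains \<sigma> where "\<sigma> \<in> {1, -1::real}" "\<And>x. x \<ge> 1 \<Longrightarrow> f x = \<sigma> * g x"
proof -
  have eq: "f x = g x \<or> f x = - g x" if "x \<ge> 1" for x using sq[OF that] power2_eq_iff by blast
  have nz: "f x \<noteq> 0" if "x \<ge> 1" for x using eq[OF that] pos[OF that] by auto
  have "connected (f ` {1..})" using assms(1) by (rule connected_continuous_image) simp
  then have no_flip: "\<not> (f x < 0 \<and> f z > 0)" if "x \<ge> 1" "z \<ge> 1" for x z
  proof -
    have "f x \<in> f ` {1..}" "f z \<in> f ` {1..}" using that by auto
    then have "f x < 0 \<Longrightarrow> f z > 0 \<Longrightarrow> 0 \<in> f ` {1..}"
      using connectedD_interval[OF \<open>connected _\<close>, of "f x" "f z" 0] by simp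
    then show ?thesis using nz by fastforce
  qed
  show thesis
  proof (cases "f 1 > 0")
    case True
    have "f x = 1 * g x" if "x \<ge> 1" for x
      using no_flip[OF that order_refl] True eq[OF that] pos[OF that] by auto
    then show ?thesis using that[of 1] by simp
  next
    case False
    have "f x = - 1 * g x" if "x \<ge> 1" for x
      using no_flip[OF order_refl that] False nz[of 1] eq[OF that] pos[OF that] by auto
    then show ?thesis using that[of "-1"] by simp
  qed
qed

section \<open>The fixed frame \<open>u y\<close>, \<open>v1 y\<close>, \<open>b\<close>,
  \<open>c\<close>\<close>

locale limit_frame = frame +
  fixes v1 :: "real \<Rightarrow> real^4" and b c :: "real^4"
  assumes v1: "is_v1 \<phi> X\<beta> v1" and limit_pair: "is_limit_pair X\<alpha> b c"
begin

lemma v_continuous: assumes x: "x > 0" shows "isCont (v x) y"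
proof -
  have k: "isCont (\<phi> x) y" "isCont (\<xi> x) y" "isCont (X\<alpha> x) y" "isCont (X\<beta> x) y"
    using frame_deriv_y[OF x, of y] by (auto dest: has_vector_derivative_continuous)
  have "isCont (hfun x) y" unfolding hfun_def[abs_def] by (intro continuous_intros)
  moreover have "hfun x y \<noteq> 0" using hfun_pos[OF x, of y] by simp
  moreover have "sqrt (1 + y\<^sup>2) \<noteq> 0" by (simp add: add_nonneg_eq_0_iff)
  ultimately show ?thesis unfolding v_def[abs_def] n_vec_def by (intro continuous_intros k)
qed

text \<open>For nonzero y the factor y^2/(1 + y^2) can be divided out of the two formulas for du/dy.
  At y = 0 it vanishes, and the equality follows from continuity of both sides. In particular
  \<open>v x y\<close> does not depend on x.\<close>

lemma v1_eq: assumes x: "x > 0" shows "v1 y = v x y"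
proof -
  have ne: "v1 z = v x z" if "z \<noteq> 0" for z
  proof -
    have "(u has_vector_derivative (z\<^sup>2 / (1 + z\<^sup>2)) *\<^sub>R v1 z) (at z)" using v1 by (simp add: is_v1_def)
    then have "(z\<^sup>2 / (1 + z\<^sup>2)) *\<^sub>R v1 z = (z\<^sup>2 / (1 + z\<^sup>2)) *\<^sub>R v x z"
      using u_deriv[OF x] vector_derivative_unique_at by blast
    moreover have "z\<^sup>2 / (1 + z\<^sup>2) \<noteq> 0" using that by (simp add: add_nonneg_eq_0_iff)
    ultimately show ?thesis by simp
  qed
  show ?thesis
  proof (cases "y = 0")
    case True
    have "isCont v1 y" using v1 by (simp add: is_v1_def continuous_on_eq_continuous_at)
    then have "(v1 \<longlongrightarrow> v1 y) (at y)" by (simp add: isCont_def)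
    moreover have "\<forall>\<^sub>F z in at y. v1 z = v x z"
      using ne True by (auto simp: eventually_at_filter)
    ultimately have "(v x \<longlongrightarrow> v1 y) (at y)" by (rule Lim_transform_eventually)
    moreover have "(v x \<longlongrightarrow> v x y) (at y)" using v_continuous[OF x, of y] by (simp add: isCont_def)
    ultimately show ?thesis using tendsto_unique[OF at_neq_bot] by blast
  qed (rule ne)
qed

lemma v1_norm: "v1 y \<bullet> v1 y = 1"
  using v1 unfolding is_v1_def by (metis norm_eq_1)

lemma v1_inner:
  assumes x: "x > 0"
  shows "v1 y \<bullet> n x y = 2 * (1 + y\<^sup>2) * P x / hfun x y - 1"
    "v1 y \<bullet> \<xi> x y = sqrt (1 + y\<^sup>2) / hfun x y * (P x + 2 * sqrt 5)"
    "v1 y \<bullet> X\<alpha> x y = - (sqrt (1 + y\<^sup>2) / hfun x y * (2 * R x))"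
    "u y \<bullet> v1 y = 0"
  using v_inner[OF x, of y] by (simp_all only: v1_eq[OF x])

lemma v1_u: "u y \<bullet> v1 y = 0"
  using v1_inner(4)[of 1 y] by simp

text \<open>This concerns the end x tending to 0, where \<open>b\<close> and \<open>c\<close> are
  defined. The inner product is a multiple of R/h, with \<open>R 0 = 0\<close> and h bounded away
  from 0 there.\<close>

lemma v1_X\<alpha>_limit: "((\<lambda>t. X\<alpha> (exp (- t)) y \<bullet> v1 y) \<longlongrightarrow> 0) at_top"
proof -
  have e: "((\<lambda>t::real. exp (- t)) \<longlongrightarrow> 0) at_top"
    by (rule filterlim_compose[OF exp_at_bot filterlim_uminus_at_bot_at_top])
  have "isCont H 0"
    unfolding H_def[abs_def] by (intro continuous_intros X0_continuous P_continuous)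
  then have h: "isCont (\<lambda>x. hfun' x) 0" if "hfun' = (\<lambda>x. H x + y\<^sup>2 * P x + sqrt 5)" for hfun'
    unfolding that by (intro continuous_intros P_continuous)
  \<comment> \<open>\<open>hfun\<close> contains \<open>X0'/x\<close>; rewriting it with
    \<open>P\<close> gives an expression that is continuous at 0.\<close>
  let ?F = "\<lambda>x. - (sqrt (1 + y\<^sup>2) / (H x + y\<^sup>2 * P x + sqrt 5) * (2 * R x))"
  have "H 0 + y\<^sup>2 * P 0 + sqrt 5 \<noteq> 0" using H_pos[of 0] P_pos[of 0]
    by (smt (verit) mult_nonneg_nonneg real_sqrt_ge_zero zero_le_power2)
  then have "isCont ?F 0" by (intro continuous_intros R_continuous h[OF refl])
  then have "(?F \<longlongrightarrow> ?F 0) (nhds 0)" using isCont_def tendsto_at_iff_tendsto_nhds by blast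
  then have "((\<lambda>t. ?F (exp (- t))) \<longlongrightarrow> ?F 0) at_top" using filterlim_compose e by blast
  then show ?thesis by (simp add: R_0 inner_commute[of _ "v1 y"] v1_inner hfun_eq)
qed

text \<open>A vector e with \<open>X\<alpha> . e\<close> tending to 0 at that end has, by the limit
  pair, an oscillating combination of \<open>b . e\<close> and \<open>c . e\<close> tending to 0, so
  both vanish. This applies to \<open>u y\<close> and \<open>v1 y\<close>.\<close>

lemma limit_pair_orthogonal: "b \<bullet> u y = 0" "c \<bullet> u y = 0" "b \<bullet> v1 y = 0" "c \<bullet> v1 y = 0"
proof -
  have *: "b \<bullet> e = 0 \<and> c \<bullet> e = 0" if e: "((\<lambda>t. X\<alpha> (exp (- t)) y \<bullet> e) \<longlongrightarrow> 0) at_top" for e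
  proof -
    have "((\<lambda>t. X\<alpha> (exp (- t)) y - (cos (sqrt 5 * t / 2) *\<^sub>R b - sin (sqrt 5 * t / 2) *\<^sub>R c)) \<longlongrightarrow> 0) at_top"
      using limit_pair by (simp add: is_limit_pair_def)
    from tendsto_diff[OF e tendsto_inner[OF this tendsto_const[of e]]]
    have "((\<lambda>t. cos (sqrt 5 / 2 * t) * (b \<bullet> e) - sin (sqrt 5 / 2 * t) * (c \<bullet> e)) \<longlongrightarrow> 0) at_top"
      by (simp add: inner_diff_left)
    then show ?thesis using trig_combination_limit_0[of "sqrt 5 / 2"] by simp
  qed
  show "b \<bullet> u y = 0" "c \<bullet> u y = 0" using *[of "u y"] by (simp_all add: u_inner inner_commute[of _ "u y"])
  show "b \<bullet> v1 y = 0" "c \<bullet> v1 y = 0" using *[OF v1_X\<alpha>_limit] by simp_all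
qed

lemma fixed_orthonormal: "orthonormal_list [u y, v1 y, b, c]"
  using limit_pair limit_pair_orthogonal[of y] u_inner(1)[of 1 y] v1_norm v1_u
  unfolding orthonormal_list4 is_limit_pair_def orthonormal_list2 by (auto simp: inner_commute)

lemma n_tendsto: "((\<lambda>x. n x y) \<longlongrightarrow> - v1 y) at_top"
proof -
  obtain M where M: "\<And>x. x \<ge> 1 \<Longrightarrow> norm (n x y + v x y) \<le> M * (1 + y\<^sup>2) / x" using n_plus_v_bound by metis
  have "((\<lambda>x. n x y + v1 y) \<longlongrightarrow> 0) at_top"
  proof (rule tendsto_0_of_O_inverse)
    fix x :: real assume "x \<ge> 1"
    then show "norm (n x y + v1 y) \<le> M * (1 + y\<^sup>2) / x" using M[of x] v1_eq[of x y] by simp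
  qed
  from tendsto_diff[OF this tendsto_const[of "v1 y"]] show ?thesis by simp
qed

text \<open>Reaching the point would make the inner product of \<open>v1\<close> and
  \<open>n\<close> equal to -1, but it exceeds -1 by a positive multiple of
  \<open>P\<close>.\<close>

lemma n_ne: "x > 0 \<Longrightarrow> n x y \<noteq> - v1 y"
proof
  assume x: "x > 0" and "n x y = - v1 y"
  then have "v1 y \<bullet> n x y = - 1" by (simp add: v1_norm)
  then have "2 * (1 + y\<^sup>2) * P x / hfun x y = 0" using v1_inner(1)[OF x, of y] by simp
  moreover have "2 * (1 + y\<^sup>2) * P x / hfun x y > 0"
    using P_pos[of x] x hfun_pos[OF x, of y] by (intro divide_pos_pos mult_pos_pos) (auto intro: add_pos_nonneg)
  ultimately show False by (metis less_irrefl)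
qed

section \<open>Length and winding of the curve \<open>n\<close>\<close>

lemma coefficients_continuous:
  "continuous_on {0<..} (\<lambda>x. hfun x y)" "continuous_on {0<..} (\<lambda>x. \<kappa> x y)"
proof -
  have "continuous_on {0<..} (\<lambda>x. H x + y\<^sup>2 * P x + sqrt 5)"
    unfolding H_def[abs_def]
    by (intro continuous_at_imp_continuous_on ballI continuous_intros X0_continuous P_continuous)
  then show h: "continuous_on {0<..} (\<lambda>x. hfun x y)"
    by (rule continuous_on_eq) (simp add: hfun_eq)
  have "hfun x y \<noteq> 0" if "x > 0" for x using hfun_pos[OF that, of y] by simp
  then show "continuous_on {0<..} (\<lambda>x. \<kappa> x y)"
    unfolding \<kappa>_def[abs_def]
    by (intro continuous_intros h continuous_at_imp_continuous_on[of _ X0] ballI X0_continuous) auto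
qed

text \<open>\<open>X0\<close> grows at least linearly and \<open>hfun\<close> at most linearly, so
  the speed \<kappa> is at least a constant over x. The length therefore grows at least like ln
  r.\<close>

lemma n_infinite_length: "infinite_length (\<lambda>x. n x y)"
  unfolding infinite_length_def
proof (intro conjI allI impI)
  fix x :: real assume "1 \<le> x"
  then show "(\<lambda>x. n x y) differentiable at x" using n_deriv[of x y] differentiableI_vector by force
next
  obtain K where K: "K > 0" "\<And>x. x \<ge> 1 \<Longrightarrow> cX x \<le> K" using cX_bounded by blast
  define L where "L = 2 * K + y\<^sup>2 * (2 * K) + sqrt 5"
  have L: "L > 0" using K by (simp add: L_def add_nonneg_pos)
  have lower: "1 / L * (1 / x) \<le> \<kappa> x y" if x1: "x \<ge> 1" for x
  proof -
    have x: "x > 0" using x1 by simp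
    have "P x \<le> cX x + qX x" unfolding P_cX[OF x] using x1 cq_sum_pos[OF x] by (simp add: divide_le_eq)
    then have p: "P x \<le> 2 * K" using qX_less[OF x] K(2)[OF x1] by linarith
    have "cX x - qX x \<le> 2 * K" using qX_less[OF x] K(2)[OF x1] by linarith
    then have "hfun x y \<le> x * (2 * K) + y\<^sup>2 * (2 * K) + sqrt 5"
      unfolding hfun_eq[OF x] H_cX[OF x] using x p by (intro add_mono mult_left_mono) auto
    also have "\<dots> \<le> x * (2 * K) + x * (y\<^sup>2 * (2 * K)) + x * sqrt 5"
      using x1 K(1) mult_right_mono[OF x1, of "y\<^sup>2 * (2 * K)"] by (intro add_mono) auto
    finally have h: "hfun x y \<le> L * x" by (simp add: L_def algebra_simps)
    have "1 \<le> sqrt 5" by simp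
    then have "1 \<le> 2 * cX x" using cX_ge[OF x] by linarith
    then have "x * 1 \<le> x * (2 * cX x)" using x by (intro mult_left_mono) auto
    then have "x \<le> 2 * (x * cX x) + sqrt 5" using \<open>1 \<le> sqrt 5\<close> by linarith
    then have "1 * x \<le> sqrt (1 + y\<^sup>2) * (2 * X0 x + sqrt 5)"
      unfolding X0_cX[OF x] using x by (intro mult_mono) auto
    then have "1 * x / (x * (L * x)) \<le> \<kappa> x y"
      unfolding \<kappa>_def using h x hfun_pos[OF x, of y] by (intro frac_le mult_left_mono) auto
    then show ?thesis using x by simp
  qed
  have speed: "norm (vector_derivative (\<lambda>x. n x y) (at x)) = \<kappa> x y" if "x \<ge> 1" for x
  proof -
    have x: "x > 0" using that by simp
    have "0 \<le> 1 / L * (1 / x)" using L x by simp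
    then have "\<kappa> x y \<ge> 0" using lower[OF that] by linarith
    then show ?thesis
      using vector_derivative_at[OF n_deriv[OF x, of y]] by (simp add: norm_eq_sqrt_inner frame_inner[OF x])
  qed
  have bound: "1 / L * ln r \<le> integral {1..r} (\<lambda>x. norm (vector_derivative (\<lambda>x. n x y) (at x)))" if r: "r \<ge> 1" for r
  proof -
    have "((\<lambda>x. 1 / L * (1 / x)) has_integral (1 / L * ln r - 1 / L * ln 1)) {1..r}"
      by (rule fundamental_theorem_of_calculus[OF r])
        (use L in \<open>auto intro!: derivative_eq_intros simp flip: has_real_derivative_iff_has_vector_derivative\<close>)
    then have int1: "((\<lambda>x. 1 / L * (1 / x)) has_integral 1 / L * ln r) {1..r}" by simp
    have "(\<lambda>x. \<kappa> x y) integrable_on {1..r}"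
      by (rule integrable_continuous_real) (auto intro: continuous_on_subset[OF coefficients_continuous(2)])
    then have "((\<lambda>x. \<kappa> x y) has_integral integral {1..r} (\<lambda>x. \<kappa> x y)) {1..r}" by (rule integrable_integral)
    then have "1 / L * ln r \<le> integral {1..r} (\<lambda>x. \<kappa> x y)"
      by (rule has_integral_le[OF int1]) (use lower in auto)
    also have "\<dots> = integral {1..r} (\<lambda>x. norm (vector_derivative (\<lambda>x. n x y) (at x)))"
      by (rule integral_cong) (simp add: speed)
    finally show ?thesis .
  qed
  show "LIM r at_top. integral {1..r} (\<lambda>x. norm (vector_derivative (\<lambda>x. n x y) (at x))) :> at_top"
  proof (rule filterlim_at_top_mono)
    show "LIM r at_top. 1 / L * ln r :> at_top"
      using L by (intro filterlim_tendsto_pos_mult_at_top[OF tendsto_const _ ln_at_top]) simp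
    show "\<forall>\<^sub>F r in at_top. 1 / L * ln r \<le> integral {1..r} (\<lambda>x. norm (vector_derivative (\<lambda>x. n x y) (at x)))"
      using eventually_ge_at_top[of 1] by eventually_elim (rule bound)
  qed
qed

text \<open>In the 3-space orthogonal to \<open>u y\<close>, both (v1, b, c) and (n,
  \<open>X\<alpha>\<close>, \<xi>) are orthonormal bases. \<open>D\<close> is the v1-component of
  the cross product of n and \<open>X\<alpha>\<close>, hence \<open>v1 . \<xi>\<close> up to sign,
  and this sign is constant because \<open>v1 . \<xi>\<close> is positive. As n' = -\<kappa>
  \<open>X\<alpha>\<close>, the angular velocity is -\<kappa> D divided by the squared polar
  radius.\<close>

lemma n_winds: "winds_uniformly_around (\<lambda>x. n x y) (- v1 y) b c"
proof -
  define D where "D x = (n x y \<bullet> b) * (X\<alpha> x y \<bullet> c) - (n x y \<bullet> c) * (X\<alpha> x y \<bullet> b)" for x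
  note fo = fixed_orthonormal[of y]
  have norm2: "(n x y \<bullet> b)\<^sup>2 + (n x y \<bullet> c)\<^sup>2 = (v1 y \<bullet> \<xi> x y)\<^sup>2 + (v1 y \<bullet> X\<alpha> x y)\<^sup>2"
    and D2: "(D x)\<^sup>2 = (v1 y \<bullet> \<xi> x y)\<^sup>2" if x: "x > 0" for x
  proof -
    note mo = moving_orthonormal[OF x, of y]
    have 1: "1 = (v1 y \<bullet> n x y)\<^sup>2 + (v1 y \<bullet> X\<alpha> x y)\<^sup>2 + (v1 y \<bullet> \<xi> x y)\<^sup>2"
      using orthonormal4_inner[OF mo, of "v1 y" "v1 y"] v1_u
      by (simp add: v1_norm inner_commute[of "v1 y" "u y"] power2_eq_square)
    have 2: "1 = (v1 y \<bullet> n x y)\<^sup>2 + (n x y \<bullet> b)\<^sup>2 + (n x y \<bullet> c)\<^sup>2"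
      using orthonormal4_inner[OF fo, of "n x y" "n x y"]
      by (simp add: n_inner[OF x] u_inner[OF x] inner_commute[of "n x y" "u y"] inner_commute[of "n x y" "v1 y"] power2_eq_square)
    have 3: "1 = (v1 y \<bullet> X\<alpha> x y)\<^sup>2 + (X\<alpha> x y \<bullet> b)\<^sup>2 + (X\<alpha> x y \<bullet> c)\<^sup>2"
      using orthonormal4_inner[OF fo, of "X\<alpha> x y" "X\<alpha> x y"]
      by (simp add: frame_inner[OF x] u_inner[OF x] inner_commute[of "X\<alpha> x y" "u y"] inner_commute[of "X\<alpha> x y" "v1 y"] power2_eq_square)
    have 4: "0 = (v1 y \<bullet> n x y) * (v1 y \<bullet> X\<alpha> x y) + (n x y \<bullet> b) * (X\<alpha> x y \<bullet> b) + (n x y \<bullet> c) * (X\<alpha> x y \<bullet> c)"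
      using orthonormal4_inner[OF fo, of "n x y" "X\<alpha> x y"]
      by (simp add: n_inner[OF x] u_inner[OF x] inner_commute[of "n x y" "u y"] inner_commute[of "n x y" "v1 y"]
        inner_commute[of "X\<alpha> x y" "u y"] inner_commute[of "X\<alpha> x y" "v1 y"])
    show "(n x y \<bullet> b)\<^sup>2 + (n x y \<bullet> c)\<^sup>2 = (v1 y \<bullet> \<xi> x y)\<^sup>2 + (v1 y \<bullet> X\<alpha> x y)\<^sup>2"
      using 1 2 by linarith
    \<comment> \<open>Lagrange's identity replaces the cross product by inner products, which the
      two orthonormal frames determine.\<close>
    have "(D x)\<^sup>2 = ((n x y \<bullet> b)\<^sup>2 + (n x y \<bullet> c)\<^sup>2) * ((X\<alpha> x y \<bullet> b)\<^sup>2 + (X\<alpha> x y \<bullet> c)\<^sup>2)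
        - ((n x y \<bullet> b) * (X\<alpha> x y \<bullet> b) + (n x y \<bullet> c) * (X\<alpha> x y \<bullet> c))\<^sup>2"
      by (simp add: D_def power2_eq_square algebra_simps)
    also have "\<dots> = (1 - (v1 y \<bullet> n x y)\<^sup>2) * (1 - (v1 y \<bullet> X\<alpha> x y)\<^sup>2) - (- ((v1 y \<bullet> n x y) * (v1 y \<bullet> X\<alpha> x y)))\<^sup>2"
      using 2 3 4 by (intro arg_cong2[where f = minus] arg_cong2[where f = times] arg_cong[where f = "\<lambda>z. z\<^sup>2"]) linarith+
    also have "\<dots> = 1 - (v1 y \<bullet> n x y)\<^sup>2 - (v1 y \<bullet> X\<alpha> x y)\<^sup>2"
      by (simp add: power2_eq_square algebra_simps)
    also have "\<dots> = (v1 y \<bullet> \<xi> x y)\<^sup>2" using 1 by linarith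
    finally show "(D x)\<^sup>2 = (v1 y \<bullet> \<xi> x y)\<^sup>2" .
  qed
  have \<xi>pos: "v1 y \<bullet> \<xi> x y > 0" if x: "x > 0" for x
    unfolding v1_inner(2)[OF x] using P_pos[of x] x hfun_pos[OF x, of y]
    by (intro mult_pos_pos divide_pos_pos) (simp_all add: add_pos_nonneg)
  have cont: "continuous_on {1..} (\<lambda>x. n x y)" "continuous_on {1..} (\<lambda>x. X\<alpha> x y)"
    by (intro continuous_at_imp_continuous_on ballI has_vector_derivative_continuous[OF n_deriv]
        has_vector_derivative_continuous[OF X\<alpha>_deriv]; simp)+
  have "continuous_on {1..} D" unfolding D_def[abs_def] by (intro continuous_intros cont)
  then obtain \<sigma> where \<sigma>: "\<sigma> \<in> {1, -1::real}" "\<And>x. x \<ge> 1 \<Longrightarrow> D x = \<sigma> * (v1 y \<bullet> \<xi> x y)"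
    using constant_sign[of D "\<lambda>x. v1 y \<bullet> \<xi> x y"] D2 \<xi>pos by (smt (verit))
  obtain m M where m: "m > 0" "\<And>x. x \<ge> 1 \<Longrightarrow> m \<le> angular_speed x" "\<And>x. x \<ge> 1 \<Longrightarrow> angular_speed x \<le> M"
    using angular_speed_bounds by blast
  have d: "((\<lambda>x. n x y \<bullet> e) has_real_derivative - \<kappa> x y * (X\<alpha> x y \<bullet> e)) (at x)" if "x \<ge> 1" for x e
    using n_deriv[of x y] that unfolding has_real_derivative_iff_has_vector_derivative
    using bounded_linear.has_vector_derivative[OF bounded_linear_inner_left, of "\<lambda>x. n x y" _ "at x" e] by fastforce
  have c\<kappa>: "continuous_on {1..} (\<lambda>x. - \<kappa> x y * (X\<alpha> x y \<bullet> e))" for e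
    by (intro continuous_intros cont continuous_on_subset[OF coefficients_continuous(2)]) auto
  have nz: "(n x y \<bullet> b)\<^sup>2 + (n x y \<bullet> c)\<^sup>2 \<noteq> 0" if "x \<ge> 1" for x
    using \<xi>pos[of x] that norm2[of x] by (simp add: sum_power2_eq_zero_iff)
  have speed: "(n x y \<bullet> b) * (- \<kappa> x y * (X\<alpha> x y \<bullet> c)) - (n x y \<bullet> c) * (- \<kappa> x y * (X\<alpha> x y \<bullet> b))
      = - \<sigma> * angular_speed x * ((n x y \<bullet> b)\<^sup>2 + (n x y \<bullet> c)\<^sup>2)" if x1: "x \<ge> 1" for x
  proof -
    have x: "x > 0" using x1 by simp
    define h where "h = hfun x y"
    define q where "q = sqrt (1 + y\<^sup>2)"
    define S where "S = 2 * X0 x + sqrt 5"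
    define p where "p = P x + 2 * sqrt 5"
    have h: "h > 0" using hfun_pos[OF x] by (simp add: h_def)
    have p: "p > 0" using P_pos[of x] x by (simp add: p_def add_pos_nonneg)
    have A: "p\<^sup>2 + (2 * R x)\<^sup>2 > 0" using p by (simp add: add_pos_nonneg)
    have "(n x y \<bullet> b) * (- \<kappa> x y * (X\<alpha> x y \<bullet> c)) - (n x y \<bullet> c) * (- \<kappa> x y * (X\<alpha> x y \<bullet> b)) = - \<kappa> x y * D x"
      by (simp add: D_def algebra_simps)
    also have "\<dots> = - \<sigma> * (q * S / (x * h) * (q / h * p))"
      by (simp add: \<sigma>(2)[OF x1] \<kappa>_def v1_inner(2)[OF x] h_def q_def S_def p_def)
    \<comment> \<open>The squared radius carries the factor (q/h)^2, which removes all dependence on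
      y from the quotient.\<close>
    also have "\<dots> = - \<sigma> * (S / x * p / (p\<^sup>2 + (2 * R x)\<^sup>2) * ((q / h)\<^sup>2 * (p\<^sup>2 + (2 * R x)\<^sup>2)))"
    proof -
      have "q * S / (x * h) * (q / h * p) = S / x * p / a * ((q / h)\<^sup>2 * a)" if "a \<noteq> 0" for a
        using that by (simp add: power2_eq_square mult_ac)
      then show ?thesis using A by (metis less_irrefl)
    qed
    also have "(q / h)\<^sup>2 * (p\<^sup>2 + (2 * R x)\<^sup>2) = (n x y \<bullet> b)\<^sup>2 + (n x y \<bullet> c)\<^sup>2"
      unfolding norm2[OF x] v1_inner(2,3)[OF x] h_def[symmetric] q_def[symmetric] p_def[symmetric]
      by (simp add: power2_eq_square algebra_simps)
    finally show ?thesis by (simp add: angular_speed_def S_def p_def)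
  qed
  obtain \<rho> \<theta> where pol: "\<And>x. x \<ge> 1 \<Longrightarrow> \<rho> x > 0" "\<And>x. x \<ge> 1 \<Longrightarrow> n x y \<bullet> b = \<rho> x * cos (\<theta> x)"
    "\<And>x. x \<ge> 1 \<Longrightarrow> n x y \<bullet> c = \<rho> x * sin (\<theta> x)"
    "\<And>x. x \<ge> 1 \<Longrightarrow> (\<theta> has_real_derivative - \<sigma> * angular_speed x) (at x within {1..})"
    by (rule polar_coordinates[where ?z1.0 = "\<lambda>x. n x y \<bullet> b" and ?z2.0 = "\<lambda>x. n x y \<bullet> c"
      and \<theta>' = "\<lambda>x. - \<sigma> * angular_speed x", OF d d c\<kappa> c\<kappa> nz speed]) blast+
  have mean: "((\<lambda>x. \<theta> x / x) \<longlongrightarrow> - \<sigma>) at_top"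
  proof (rule mean_of_angle)
    fix x :: real assume "x > 1"
    then have "at x within {1..} = at x within UNIV" by (intro at_within_nhd[of x "{1<..}"]) auto
    then show "(\<theta> has_real_derivative - \<sigma> * angular_speed x) (at x)" using pol(4)[of x] \<open>x > 1\<close> by simp
  qed
  have sg: "- \<sigma> * (- \<sigma> * angular_speed x) = angular_speed x" for x using \<sigma>(1) by auto
  show ?thesis
    unfolding winds_uniformly_around_def
  proof (rule exI[of _ \<rho>], rule exI[of _ \<theta>], rule exI[of _ "\<lambda>x. - \<sigma> * angular_speed x"],
      rule bexI[of _ "- \<sigma>"], rule exI[of _ m], intro conjI, rule m(1), rule exI[of _ M],
      rule exI[of _ "- \<sigma>"], intro conjI allI impI)
    fix x :: real assume x: "1 \<le> x"
    show "(n x y - - v1 y) \<bullet> b = \<rho> x * cos (\<theta> x)" "(n x y - - v1 y) \<bullet> c = \<rho> x * sin (\<theta> x)"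
      using pol(2,3)[OF x] limit_pair_orthogonal(3,4)[of y] by (simp_all add: inner_add_left inner_commute[of "v1 y"])
    show "m \<le> - \<sigma> * (- \<sigma> * angular_speed x)" "- \<sigma> * (- \<sigma> * angular_speed x) \<le> M"
      unfolding sg using m(2,3) x by auto
  qed (use pol mean \<sigma>(1) in auto)
qed

end

section \<open>The limit circles\<close>

lemma vector_derivative_bound:
  fixes g :: "real \<Rightarrow> 'a::real_normed_vector"
  assumes "convex S" "\<And>t. t \<in> S \<Longrightarrow> (g has_vector_derivative g' t) (at t)"
    "\<And>t. t \<in> S \<Longrightarrow> norm (g' t) \<le> B" "a \<in> S" "z \<in> S"
  shows "norm (g a - g z) \<le> B * \<bar>a - z\<bar>"
proof -
  have "norm (g a - g z) \<le> B * norm (a - z)"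
  proof (rule differentiable_bound[OF assms(1) _ _ assms(4,5)])
    fix t assume "t \<in> S"
    then show "(g has_derivative (\<lambda>h. h *\<^sub>R g' t)) (at t within S)" "onorm (\<lambda>h. h *\<^sub>R g' t) \<le> B"
      using assms(2,3) by (auto simp: has_vector_derivative_def onorm_scaleR_left onorm_id
          intro: has_derivative_at_withinI)
  qed
  then show ?thesis by simp
qed

lemma converges_locally_uniformlyI:
  assumes "\<And>Y. Y \<ge> 0 \<Longrightarrow> \<exists>g. (g \<longlongrightarrow> 0) at_top \<and> (\<forall>x\<ge>1. \<forall>y. \<bar>y\<bar> \<le> Y \<longrightarrow> norm (M x y - N x y) \<le> g x)"
  shows "converges_locally_uniformly M N"
  unfolding converges_locally_uniformly_def
proof (intro allI uniform_limitI)
  fix p q e :: real assume e: "e > 0"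
  obtain g where g: "(g \<longlongrightarrow> 0) at_top"
    "\<And>x y. x \<ge> 1 \<Longrightarrow> \<bar>y\<bar> \<le> \<bar>p\<bar> + \<bar>q\<bar> \<Longrightarrow> norm (M x y - N x y) \<le> g x"
    using assms[of "\<bar>p\<bar> + \<bar>q\<bar>"] by auto
  show "\<forall>\<^sub>F x in at_top. \<forall>y\<in>{p..q}. dist (M x y - N x y) 0 < e"
    using order_tendstoD(2)[OF g(1) e] eventually_ge_at_top[of 1]
  proof eventually_elim
    case (elim x)
    show ?case
    proof
      fix y assume "y \<in> {p..q}"
      then have "norm (M x y - N x y) \<le> g x" using elim by (intro g(2)) auto
      then show "dist (M x y - N x y) 0 < e" using elim by simp
    qed
  qed
qed

context limit_frame begin

lemma \<kappa>_bound: obtains M where "\<And>x. x \<ge> 1 \<Longrightarrow> \<bar>\<kappa> x 0\<bar> \<le> M / x"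
proof -
  obtain K \<delta> where K: "K \<ge> 1" "\<delta> > 0" "\<And>x. x \<ge> 1 \<Longrightarrow> cX x \<le> K"
    "\<And>x. x \<ge> 1 \<Longrightarrow> \<delta> \<le> cX x - qX x" using cq_bounds by metis
  have "\<bar>\<kappa> x 0\<bar> \<le> ((2 * K + sqrt 5) / \<delta>) / x" if x1: "x \<ge> 1" for x
  proof -
    have x: "x > 0" using x1 by simp
    have "\<delta> * x \<le> H x" unfolding H_cX[OF x] using K(4)[OF x1] x by simp
    then have h: "\<delta> * x \<le> hfun x 0" using hfun_ge[OF x, of 0] by linarith
    have "X0 x \<le> K * x" unfolding X0_cX[OF x] using K(3)[OF x1] x by simp
    moreover have "sqrt 5 * 1 \<le> sqrt 5 * x" using x1 by (intro mult_left_mono) auto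
    moreover have "X0 x > 0" "sqrt 5 > 0" using X0_pos x by simp_all
    ultimately have "\<bar>2 * X0 x + sqrt 5\<bar> \<le> (2 * K + sqrt 5) * x" unfolding distrib_right by linarith
    then have "\<bar>\<kappa> x 0\<bar> \<le> (2 * K + sqrt 5) * x / (x * (\<delta> * x))"
      unfolding \<kappa>_def using h x K(2) by (intro abs_quotient_le) auto
    then show ?thesis using x K(2) by simp
  qed
  then show thesis using that by blast
qed

text \<open>Only the component of \<open>F'\<close> along \<open>n\<close> fails to be integrable, and \<open>n\<close> is \<open>-v\<^sub>1\<close> up to \<open>O(1/x)\<close>.\<close>

lemma rotating_vector_converges:
  fixes F E :: "real \<Rightarrow> real^4" and p q :: "real \<Rightarrow> real"
  assumes d: "\<And>x. x \<ge> 1 \<Longrightarrow> (F has_vector_derivative p x *\<^sub>R E x + q x *\<^sub>R n x 0) (at x)"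
    and p: "\<And>x. x \<ge> 1 \<Longrightarrow> \<bar>p x\<bar> \<le> M1 / x\<^sup>2" and q: "\<And>x. x \<ge> 1 \<Longrightarrow> \<bar>q x\<bar> \<le> M2 / x"
    and E: "\<And>x. x \<ge> 1 \<Longrightarrow> norm (E x) = 1" and F: "\<And>x. x \<ge> 1 \<Longrightarrow> norm (F x) = 1"
    and Fn: "\<And>x. x \<ge> 1 \<Longrightarrow> F x \<bullet> n x 0 = 0"
  obtains L where "(F \<longlongrightarrow> L) at_top" "L \<bullet> v1 0 = 0"
proof -
  let ?V = "v1 0"
  define proj where "proj e = e - (e \<bullet> ?V) *\<^sub>R ?V" for e :: "real^4"
  have V: "norm ?V = 1" using v1 by (simp add: is_v1_def)
  obtain M where M0: "\<And>x. x \<ge> 1 \<Longrightarrow> norm (n x 0 + v x 0) \<le> M * (1 + 0\<^sup>2) / x" using n_plus_v_bound by metis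
  have M: "norm (n x 0 + ?V) \<le> M / x" if "x \<ge> 1" for x
    using M0[OF that] v1_eq[of x 0] that by simp
  have projlin: "bounded_linear proj" unfolding proj_def[abs_def] by (intro bounded_linear_intros)
  have projnorm: "norm (proj e) \<le> 2 * norm e" for e
  proof -
    have "\<bar>e \<bullet> ?V\<bar> \<le> norm e" using Cauchy_Schwarz_ineq2[of e ?V] by (simp add: V)
    then show ?thesis unfolding proj_def using norm_triangle_ineq4[of e "(e \<bullet> ?V) *\<^sub>R ?V"] by (simp add: V)
  qed
  \<comment> \<open>The projection kills \<open>v1 0\<close>, so \<open>n\<close> may be replaced by
    \<open>n + v1\<close>, which gains a factor 1/x.\<close>
  have projn: "proj (n x 0) = proj (n x 0 + ?V)" for x
    using v1_norm[of 0] by (simp add: proj_def inner_add_left algebra_simps)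
  have dproj: "((\<lambda>x. proj (F x)) has_vector_derivative proj (p x *\<^sub>R E x + q x *\<^sub>R n x 0)) (at x)" if "x \<ge> 1" for x
    using bounded_linear.has_vector_derivative[OF projlin d[OF that]] .
  have "norm (proj (p x *\<^sub>R E x + q x *\<^sub>R n x 0)) \<le> (2 * M1 + 2 * M2 * M) / x\<^sup>2" if x1: "x \<ge> 1" for x
  proof -
    have "proj (p x *\<^sub>R E x + q x *\<^sub>R n x 0) = p x *\<^sub>R proj (E x) + q x *\<^sub>R proj (n x 0 + ?V)"
      using projlin unfolding projn[symmetric] by (simp add: linear_simps bounded_linear.linear linear_add linear_scale)
    also have "norm \<dots> \<le> \<bar>p x\<bar> * norm (proj (E x)) + \<bar>q x\<bar> * norm (proj (n x 0 + ?V))"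
      by (rule order_trans[OF norm_triangle_ineq]) simp
    also have "\<dots> \<le> M1 / x\<^sup>2 * 2 + M2 / x * (2 * (M / x))"
    proof (intro add_mono mult_mono)
      show "norm (proj (E x)) \<le> 2" using projnorm[of "E x"] E[OF x1] by simp
      show "norm (proj (n x 0 + ?V)) \<le> 2 * (M / x)" using projnorm[of "n x 0 + ?V"] M[OF x1] by simp
      show "0 \<le> M1 / x\<^sup>2" "0 \<le> M2 / x" using p[OF x1] q[OF x1] by linarith+
    qed (use p[OF x1] q[OF x1] in auto)
    also have "\<dots> = (2 * M1 + 2 * M2 * M) / x\<^sup>2" using x1 by (simp add: field_simps power2_eq_square)
    finally show ?thesis .
  qed
  then obtain L where L: "((\<lambda>x. proj (F x)) \<longlongrightarrow> L) at_top"
    using convergent_of_quadratic_decay[OF dproj] by blast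
  have FV: "((\<lambda>x. F x \<bullet> ?V) \<longlongrightarrow> 0) at_top"
  proof (rule tendsto_0_of_O_inverse)
    fix x :: real assume x1: "x \<ge> 1"
    \<comment> \<open>Since F is orthogonal to \<open>n\<close>, its v1-component is also
      O(1/x).\<close>
    have "F x \<bullet> ?V = F x \<bullet> (n x 0 + ?V)" using Fn[OF x1] by (simp add: inner_add_right)
    also have "\<bar>\<dots>\<bar> \<le> norm (F x) * norm (n x 0 + ?V)" by (rule Cauchy_Schwarz_ineq2)
    finally show "norm (F x \<bullet> ?V) \<le> M / x" using F[OF x1] M[OF x1] by simp
  qed
  have "((\<lambda>x. proj (F x) + (F x \<bullet> ?V) *\<^sub>R ?V) \<longlongrightarrow> L + 0 *\<^sub>R ?V) at_top"
    by (intro tendsto_intros L FV)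
  then have FL: "(F \<longlongrightarrow> L) at_top" by (simp add: proj_def)
  moreover have "L \<bullet> ?V = 0"
    using tendsto_unique[OF _ tendsto_inner[OF FL tendsto_const[of ?V]] FV] by simp
  ultimately show thesis by (rule that)
qed

text \<open>Within their own plane \<xi> and \<open>X\<alpha>\<close> rotate at rate
  \<open>b1\<close>. Turning them back by \<open>psi\<close> leaves the rate
  \<open>psi' + b1\<close>, which is O(1/x^2), and a component along \<open>n\<close> of size
  \<kappa> = O(1/x).\<close>

lemma rotating_frame_limits:
  obtains B0 C0 where
    "((\<lambda>x. cos (psi x) *\<^sub>R \<xi> x 0 + sin (psi x) *\<^sub>R X\<alpha> x 0) \<longlongrightarrow> B0) at_top"
    "((\<lambda>x. cos (psi x) *\<^sub>R X\<alpha> x 0 - sin (psi x) *\<^sub>R \<xi> x 0) \<longlongrightarrow> C0) at_top"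
    "orthonormal_list [u 0, v1 0, B0, C0]"
proof -
  define B where "B x = cos (psi x) *\<^sub>R \<xi> x 0 + sin (psi x) *\<^sub>R X\<alpha> x 0" for x
  define C where "C x = cos (psi x) *\<^sub>R X\<alpha> x 0 - sin (psi x) *\<^sub>R \<xi> x 0" for x
  obtain M1 where M1: "\<And>x. x \<ge> 1 \<Longrightarrow> \<bar>psi' x + b1 x 0\<bar> \<le> M1 / x\<^sup>2" using psi'_b1_bound by blast
  obtain M2 where M2: "\<And>x. x \<ge> 1 \<Longrightarrow> \<bar>\<kappa> x 0\<bar> \<le> M2 / x" using \<kappa>_bound by blast
  have cs: "cos t * cos t + sin t * sin t = 1" for t :: real
    using sin_cos_squared_add3[of t] by simp
  have BC: "B x \<bullet> B x = 1" "C x \<bullet> C x = 1" "B x \<bullet> C x = 0" "B x \<bullet> n x 0 = 0" "C x \<bullet> n x 0 = 0"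
    "B x \<bullet> u 0 = 0" "C x \<bullet> u 0 = 0" if x: "x > 0" for x
    using cs[of "psi x"]
    by (simp_all add: B_def C_def inner_add_left inner_add_right inner_diff_left inner_diff_right
        frame_inner[OF x] n_inner[OF x] u_inner[OF x] inner_commute[of _ "u 0"] algebra_simps)
  have nrm: "norm (B x) = 1" "norm (C x) = 1" if "x \<ge> 1" for x
    using BC(1,2)[of x] that by (simp_all add: norm_eq_sqrt_inner)
  have dcos: "((\<lambda>x. cos (psi x)) has_real_derivative - sin (psi x) * psi' x) (at x)"
    and dsin: "((\<lambda>x. sin (psi x)) has_real_derivative cos (psi x) * psi' x) (at x)" if "x > 0" for x
    by (rule DERIV_chain2[OF DERIV_cos psi_deriv[OF that]] DERIV_chain2[OF DERIV_sin psi_deriv[OF that]])+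
  have dB: "(B has_vector_derivative (psi' x + b1 x 0) *\<^sub>R C x + (\<kappa> x 0 * sin (psi x)) *\<^sub>R n x 0) (at x)" if x1: "x \<ge> 1" for x
  proof -
    have x: "x > 0" using x1 by simp
    have "(B has_vector_derivative (cos (psi x) *\<^sub>R (b1 x 0 *\<^sub>R X\<alpha> x 0) + (- sin (psi x) * psi' x) *\<^sub>R \<xi> x 0)
      + (sin (psi x) *\<^sub>R (\<kappa> x 0 *\<^sub>R n x 0 - b1 x 0 *\<^sub>R \<xi> x 0) + (cos (psi x) * psi' x) *\<^sub>R X\<alpha> x 0)) (at x)"
      unfolding B_def[abs_def]
      by (intro has_vector_derivative_add has_vector_derivative_scaleR dcos dsin frame_deriv_x(2) X\<alpha>_deriv x)
    then show ?thesis by (simp add: C_def algebra_simps)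
  qed
  have dC: "(C has_vector_derivative (- (psi' x + b1 x 0)) *\<^sub>R B x + (\<kappa> x 0 * cos (psi x)) *\<^sub>R n x 0) (at x)" if x1: "x \<ge> 1" for x
  proof -
    have x: "x > 0" using x1 by simp
    have "(C has_vector_derivative (cos (psi x) *\<^sub>R (\<kappa> x 0 *\<^sub>R n x 0 - b1 x 0 *\<^sub>R \<xi> x 0) + (- sin (psi x) * psi' x) *\<^sub>R X\<alpha> x 0)
      - (sin (psi x) *\<^sub>R (b1 x 0 *\<^sub>R X\<alpha> x 0) + (cos (psi x) * psi' x) *\<^sub>R \<xi> x 0)) (at x)"
      unfolding C_def[abs_def]
      by (intro has_vector_derivative_diff has_vector_derivative_scaleR dcos dsin frame_deriv_x(2) X\<alpha>_deriv x)
    then show ?thesis by (simp add: B_def algebra_simps)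
  qed
  have q: "\<bar>\<kappa> x 0 * sin (psi x)\<bar> \<le> M2 / x" "\<bar>\<kappa> x 0 * cos (psi x)\<bar> \<le> M2 / x" if "x \<ge> 1" for x
    using M2[OF that] mult_left_mono[OF abs_sin_le_one[of "psi x"], of "\<bar>\<kappa> x 0\<bar>"]
      mult_left_mono[OF abs_cos_le_one[of "psi x"], of "\<bar>\<kappa> x 0\<bar>"] by (simp_all add: abs_mult)
  have M1': "\<bar>- (psi' x + b1 x 0)\<bar> \<le> M1 / x\<^sup>2" if "x \<ge> 1" for x using M1[OF that] by linarith
  have Bn: "B x \<bullet> n x 0 = 0" "C x \<bullet> n x 0 = 0" if "x \<ge> 1" for x using BC(4,5)[of x] that by simp_all
  obtain B0 where B0: "(B \<longlongrightarrow> B0) at_top" "B0 \<bullet> v1 0 = 0"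
    by (rule rotating_vector_converges[OF dB M1 q(1) nrm(2) nrm(1) Bn(1)])
  obtain C0 where C0: "(C \<longlongrightarrow> C0) at_top" "C0 \<bullet> v1 0 = 0"
    by (rule rotating_vector_converges[OF dC M1' q(2) nrm(1) nrm(2) Bn(2)])
  have lim: "l = r" if "(g \<longlongrightarrow> l) at_top" "\<And>x. x > 0 \<Longrightarrow> g x = r" for g :: "real \<Rightarrow> real" and l r
  proof -
    have "\<forall>\<^sub>F x in at_top. g x = r" using eventually_gt_at_top[of 0] by eventually_elim (rule that(2))
    from Lim_transform_eventually[OF that(1) this] show ?thesis
      by (rule tendsto_unique[OF trivial_limit_at_top_linorder _ tendsto_const])
  qed
  have "B0 \<bullet> B0 = 1" by (rule lim[OF tendsto_inner[OF B0(1) B0(1)] BC(1)])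
  moreover have "C0 \<bullet> C0 = 1" by (rule lim[OF tendsto_inner[OF C0(1) C0(1)] BC(2)])
  moreover have "B0 \<bullet> C0 = 0" by (rule lim[OF tendsto_inner[OF B0(1) C0(1)] BC(3)])
  moreover have "B0 \<bullet> u 0 = 0" by (rule lim[OF tendsto_inner[OF B0(1) tendsto_const] BC(6)])
  moreover have "C0 \<bullet> u 0 = 0" by (rule lim[OF tendsto_inner[OF C0(1) tendsto_const] BC(7)])
  ultimately have "orthonormal_list [u 0, v1 0, B0, C0]"
    using B0(2) C0(2) u_inner(1)[of 1 0] v1_norm[of 0] v1_u[of 0]
    unfolding orthonormal_list4 by (simp add: inner_commute)
  then show thesis using that[OF B0(1)[unfolded B_def[abs_def]] C0(1)[unfolded C_def[abs_def]]] by blast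
qed

text \<open>The correction \<open>R/H\<close> tends to 0, so \<open>psi\<close> can be replaced by w
  in the limit; rotating forward by w then recovers \<xi> and \<open>X\<alpha>\<close>.\<close>

lemma frame_limits_at_0:
  obtains B0 C0 where
    "((\<lambda>x. \<xi> x 0 - b_bar B0 C0 x) \<longlongrightarrow> 0) at_top" "((\<lambda>x. X\<alpha> x 0 - c_bar B0 C0 x) \<longlongrightarrow> 0) at_top"
    "orthonormal_list [u 0, v1 0, B0, C0]"
proof -
  obtain B0 C0 where
    B: "((\<lambda>x. cos (psi x) *\<^sub>R \<xi> x 0 + sin (psi x) *\<^sub>R X\<alpha> x 0) \<longlongrightarrow> B0) at_top" (is "(?B \<longlongrightarrow> _) _") and
    C: "((\<lambda>x. cos (psi x) *\<^sub>R X\<alpha> x 0 - sin (psi x) *\<^sub>R \<xi> x 0) \<longlongrightarrow> C0) at_top" (is "(?C \<longlongrightarrow> _) _") and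
    on: "orthonormal_list [u 0, v1 0, B0, C0]" by (rule rotating_frame_limits)
  define \<epsilon> where "\<epsilon> x = R x / H x" for x
  have \<epsilon>: "(\<epsilon> \<longlongrightarrow> 0) at_top"
  proof -
    obtain K \<delta> where K: "K \<ge> 1" "\<delta> > 0" "\<And>x. x \<ge> 1 \<Longrightarrow> cX x \<le> K"
      "\<And>x. x \<ge> 1 \<Longrightarrow> \<delta> \<le> cX x - qX x" using cq_bounds by metis
    show ?thesis
    proof (rule tendsto_0_of_O_inverse)
      fix x :: real assume x1: "x \<ge> 1"
      then have x: "x > 0" by simp
      have "\<bar>\<epsilon> x\<bar> \<le> K / (\<delta> * x)"
        unfolding \<epsilon>_def H_cX[OF x]
        by (rule abs_quotient_le) (use R_le[OF x] K(3,4)[OF x1] x K(2) in \<open>auto simp: mult.commute\<close>)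
      then show "norm (\<epsilon> x) \<le> K / \<delta> / x" by simp
    qed
  qed
  have wx: "wfun x = psi x - \<epsilon> x" for x by (simp add: psi_def \<epsilon>_def)
  have cs: "cos t * cos t + sin t * sin t = 1" for t :: real
    using sin_cos_squared_add3[of t] by simp
  let ?B' = "\<lambda>x. cos (\<epsilon> x) *\<^sub>R ?B x - sin (\<epsilon> x) *\<^sub>R ?C x"
  let ?C' = "\<lambda>x. sin (\<epsilon> x) *\<^sub>R ?B x + cos (\<epsilon> x) *\<^sub>R ?C x"
  have "(?B' \<longlongrightarrow> cos 0 *\<^sub>R B0 - sin 0 *\<^sub>R C0) at_top" by (intro tendsto_intros \<epsilon> B C)
  then have B': "((\<lambda>x. ?B' x - B0) \<longlongrightarrow> 0) at_top" using LIM_zero by fastforce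
  have "(?C' \<longlongrightarrow> sin 0 *\<^sub>R B0 + cos 0 *\<^sub>R C0) at_top" by (intro tendsto_intros \<epsilon> B C)
  then have C': "((\<lambda>x. ?C' x - C0) \<longlongrightarrow> 0) at_top" using LIM_zero by fastforce
  have Beq: "?B' x = cos (wfun x) *\<^sub>R \<xi> x 0 + sin (wfun x) *\<^sub>R X\<alpha> x 0" for x
    by (simp add: wx cos_diff sin_diff algebra_simps)
  have Ceq: "?C' x = cos (wfun x) *\<^sub>R X\<alpha> x 0 - sin (wfun x) *\<^sub>R \<xi> x 0" for x
    by (simp add: wx cos_diff sin_diff algebra_simps)
  have rot: "cos t *\<^sub>R (cos t *\<^sub>R a + sin t *\<^sub>R a') - sin t *\<^sub>R (cos t *\<^sub>R a' - sin t *\<^sub>R a) = a"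
    "sin t *\<^sub>R (cos t *\<^sub>R a + sin t *\<^sub>R a') + cos t *\<^sub>R (cos t *\<^sub>R a' - sin t *\<^sub>R a) = a'"
    for t and a a' :: "real^4"
  proof -
    have "cos t *\<^sub>R (cos t *\<^sub>R a + sin t *\<^sub>R a') - sin t *\<^sub>R (cos t *\<^sub>R a' - sin t *\<^sub>R a)
      = (cos t * cos t + sin t * sin t) *\<^sub>R a" by (simp only: scaleR_add_left) (simp add: algebra_simps)
    then show "cos t *\<^sub>R (cos t *\<^sub>R a + sin t *\<^sub>R a') - sin t *\<^sub>R (cos t *\<^sub>R a' - sin t *\<^sub>R a) = a"
      by (simp only: cs scaleR_one)
    have "sin t *\<^sub>R (cos t *\<^sub>R a + sin t *\<^sub>R a') + cos t *\<^sub>R (cos t *\<^sub>R a' - sin t *\<^sub>R a)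
      = (cos t * cos t + sin t * sin t) *\<^sub>R a'" by (simp only: scaleR_add_left) (simp add: algebra_simps)
    then show "sin t *\<^sub>R (cos t *\<^sub>R a + sin t *\<^sub>R a') + cos t *\<^sub>R (cos t *\<^sub>R a' - sin t *\<^sub>R a) = a'"
      by (simp only: cs scaleR_one)
  qed
  have \<xi>eq: "\<xi> x 0 - b_bar B0 C0 x = cos (wfun x) *\<^sub>R (?B' x - B0) - sin (wfun x) *\<^sub>R (?C' x - C0)" for x
  proof -
    have "k *\<^sub>R (p - B0) - m *\<^sub>R (q - C0) = (k *\<^sub>R p - m *\<^sub>R q) - (k *\<^sub>R B0 - m *\<^sub>R C0)" for k m p q
      by (simp add: algebra_simps)
    then show ?thesis unfolding Beq Ceq b_bar_def by (simp only: rot(1))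
  qed
  have X\<alpha>eq: "X\<alpha> x 0 - c_bar B0 C0 x = sin (wfun x) *\<^sub>R (?B' x - B0) + cos (wfun x) *\<^sub>R (?C' x - C0)" for x
  proof -
    have "k *\<^sub>R (p - B0) + m *\<^sub>R (q - C0) = (k *\<^sub>R p + m *\<^sub>R q) - (k *\<^sub>R B0 + m *\<^sub>R C0)" for k m p q
      by (simp add: algebra_simps)
    then show ?thesis unfolding Beq Ceq c_bar_def by (simp only: rot(2))
  qed
  have bound: "norm (cos t *\<^sub>R p + sin t *\<^sub>R q) \<le> norm p + norm q" "norm (cos t *\<^sub>R p - sin t *\<^sub>R q) \<le> norm p + norm q"
    for t and p q :: "real^4"
  proof -
    have "norm (cos t *\<^sub>R p) \<le> norm p" "norm (sin t *\<^sub>R q) \<le> norm q"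
      by (simp_all add: mult_left_le_one_le)
    then show "norm (cos t *\<^sub>R p + sin t *\<^sub>R q) \<le> norm p + norm q" "norm (cos t *\<^sub>R p - sin t *\<^sub>R q) \<le> norm p + norm q"
      by (meson add_mono order_trans norm_triangle_ineq norm_triangle_ineq4)+
  qed
  have null: "((\<lambda>x. norm (?B' x - B0) + norm (?C' x - C0)) \<longlongrightarrow> 0) at_top"
    using tendsto_add[OF tendsto_norm_zero[OF B'] tendsto_norm_zero[OF C']] by simp
  show thesis
  proof (rule that[OF _ _ on])
    show "((\<lambda>x. \<xi> x 0 - b_bar B0 C0 x) \<longlongrightarrow> 0) at_top"
      by (rule Lim_null_comparison[OF _ null]) (simp only: \<xi>eq bound eventually_True)
    show "((\<lambda>x. X\<alpha> x 0 - c_bar B0 C0 x) \<longlongrightarrow> 0) at_top"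
      by (rule Lim_null_comparison[OF _ null])
        (simp only: X\<alpha>eq add.commute[of "sin _ *\<^sub>R _"] add.commute[of "norm (cos _ *\<^sub>R _ - _ - _)"] bound eventually_True)
  qed
qed

text \<open>The y-derivatives are \<open>b2\<close> and \<open>c2\<close> times the unit vector
  \<open>X\<beta>\<close>, with numerators bounded by multiples of |y| and denominator at least
  \<delta> x. One factor Y comes from these, the other from the distance between y and 0.\<close>

lemma frame_y_variation:
  obtains M where "M \<ge> 0"
    "\<And>x y Y. x \<ge> 1 \<Longrightarrow> \<bar>y\<bar> \<le> Y \<Longrightarrow> norm (\<xi> x y - \<xi> x 0) \<le> M * Y\<^sup>2 / x"
    "\<And>x y Y. x \<ge> 1 \<Longrightarrow> \<bar>y\<bar> \<le> Y \<Longrightarrow> norm (X\<alpha> x y - X\<alpha> x 0) \<le> M * Y\<^sup>2 / x"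
proof -
  obtain K \<delta> where K: "K \<ge> 1" "\<delta> > 0" "\<And>x. x \<ge> 1 \<Longrightarrow> cX x \<le> K"
    "\<And>x. x \<ge> 1 \<Longrightarrow> \<delta> \<le> cX x - qX x" using cq_bounds by metis
  define M where "M = (2 * K + 2 * sqrt 5) / \<delta>"
  have main: "norm (\<xi> x y - \<xi> x 0) \<le> M * Y\<^sup>2 / x \<and> norm (X\<alpha> x y - X\<alpha> x 0) \<le> M * Y\<^sup>2 / x"
    if x1: "x \<ge> 1" and y: "\<bar>y\<bar> \<le> Y" for x y Y
  proof -
    have x: "x > 0" using x1 by simp
    have Y: "Y \<ge> 0" using y by linarith
    have "P x \<le> cX x + qX x" unfolding P_cX[OF x] using x1 cq_sum_pos[OF x] by (simp add: divide_le_eq)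
    then have p: "0 < P x" "P x \<le> 2 * K" using P_pos[of x] x qX_less[OF x] K(3)[OF x1] by linarith+
    have r: "\<bar>R x\<bar> \<le> K" using R_le[OF x] K(3)[OF x1] by linarith
    have h: "\<delta> * x \<le> hfun x t" for t
    proof -
      have "\<delta> * x \<le> H x" unfolding H_cX[OF x] using K(4)[OF x1] x by simp
      then show ?thesis using hfun_ge[OF x, of t] by linarith
    qed
    have quot: "\<bar>2 * t / hfun x t * e\<bar> \<le> M * Y / x" if t: "\<bar>t\<bar> \<le> Y" and e: "\<bar>e\<bar> \<le> K + sqrt 5" for t e
    proof -
      have "\<bar>2 * t * e\<bar> \<le> (2 * Y) * (K + sqrt 5)"
        unfolding abs_mult[of _ e] using t e Y by (intro mult_mono) auto
      then have "\<bar>2 * t * e / hfun x t\<bar> \<le> (2 * Y) * (K + sqrt 5) / (\<delta> * x)"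
        using h[of t] K(2) x by (intro abs_quotient_le) auto
      then show ?thesis by (simp add: M_def algebra_simps)
    qed
    have b2: "norm (b2 x t *\<^sub>R X\<beta> x t) \<le> M * Y / x" and c2: "norm (c2 x t *\<^sub>R X\<beta> x t) \<le> M * Y / x"
      if t: "t \<in> {-Y..Y}" for t
    proof -
      have n1: "norm (X\<beta> x t) = 1" by (simp add: norm_eq_sqrt_inner frame_inner[OF x])
      have t': "\<bar>t\<bar> \<le> Y" using t by auto
      have "b2 x t = - (2 * t / hfun x t * (P x / 2 + sqrt 5))" using x by (simp add: b2_def X0'_eq)
      moreover have "\<bar>P x / 2 + sqrt 5\<bar> \<le> K + sqrt 5" using p by simp
      ultimately show "norm (b2 x t *\<^sub>R X\<beta> x t) \<le> M * Y / x" using quot[OF t'] by (simp add: n1 del: times_divide_eq_left)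
      have "c2 x t = 2 * t / hfun x t * R x" using x by (simp add: c2_def X0'_eq X0''_eq)
      moreover have "\<bar>R x\<bar> \<le> K + sqrt 5" using r by (simp add: add_increasing2)
      ultimately show "norm (c2 x t *\<^sub>R X\<beta> x t) \<le> M * Y / x" using quot[OF t', of "R x"] by (simp add: n1 del: times_divide_eq_left)
    qed
    have ins: "y \<in> {-Y..Y}" "0 \<in> {-Y..Y}" using y Y by auto
    have fin: "M * Y / x * \<bar>y - 0\<bar> \<le> M * Y\<^sup>2 / x"
      using mult_left_mono[OF y, of "M * Y / x"] Y K x by (simp add: M_def power2_eq_square)
    show ?thesis
      using order_trans[OF vector_derivative_bound[OF convex_real_interval(5) frame_deriv_y(2)[OF x] b2 ins] fin]
        order_trans[OF vector_derivative_bound[OF convex_real_interval(5) frame_deriv_y(3)[OF x] c2 ins] fin] by blast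
  qed
  have "M \<ge> 0" using K by (simp add: M_def)
  then show thesis using main that by blast
qed

lemma locally_uniform_from_0:
  fixes G :: "real \<Rightarrow> real \<Rightarrow> real^4" and g :: "real \<Rightarrow> real^4"
  assumes lim: "((\<lambda>x. G x 0 - g x) \<longlongrightarrow> 0) at_top"
    and var: "\<And>x y Y. x \<ge> 1 \<Longrightarrow> \<bar>y\<bar> \<le> Y \<Longrightarrow> norm (G x y - G x 0) \<le> M * Y\<^sup>2 / x"
  shows "\<exists>e. (e \<longlongrightarrow> 0) at_top \<and> (\<forall>x\<ge>1. \<forall>y. \<bar>y\<bar> \<le> Y \<longrightarrow> norm (G x y - g x) \<le> e x)"
proof (intro exI conjI allI impI)
  have "((\<lambda>x. M * Y\<^sup>2 / x) \<longlongrightarrow> 0) at_top"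
    by (intro tendsto_divide_0[OF tendsto_const] filterlim_at_top_imp_at_infinity filterlim_ident)
  from tendsto_add[OF this tendsto_norm_zero[OF lim]]
  show "((\<lambda>x. M * Y\<^sup>2 / x + norm (G x 0 - g x)) \<longlongrightarrow> 0) at_top" by simp
  fix x y :: real assume xy: "x \<ge> 1" "\<bar>y\<bar> \<le> Y"
  have "G x y - g x = (G x y - G x 0) + (G x 0 - g x)" by simp
  then show "norm (G x y - g x) \<le> M * Y\<^sup>2 / x + norm (G x 0 - g x)"
    using var[OF xy] norm_triangle_ineq[of "G x y - G x 0" "G x 0 - g x"] by simp
qed

end

subsection \<open>The surface\<close>

locale surface = limit_frame +
  fixes f :: "real \<Rightarrow> real \<Rightarrow> real^4"
  assumes surface: "curvature_surface X\<alpha> X\<beta> f"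
begin

abbreviation A :: "real \<Rightarrow> real^4" where "A \<equiv> A_center \<phi> X\<beta> \<xi> f"

lemma f_deriv:
  assumes x: "x > 0"
  shows "((\<lambda>t. f t y) has_vector_derivative ((x\<^sup>2 - y\<^sup>2) / (x * hfun x y)) *\<^sub>R X\<alpha> x y) (at x)"
proof -
  let ?D = "\<lambda>(dx, dy). (((x ^ 2 - y ^ 2) / (x * hfun x y)) * dx) *\<^sub>R X\<alpha> x y + ((2 * y / hfun x y) * dy) *\<^sub>R X\<beta> x y"
  have "((\<lambda>(s, t). f s t) has_derivative ?D) (at (x, y))"
    using surface x unfolding curvature_surface_def by blast
  then have "((\<lambda>(s, t). f s t) has_derivative ?D) (at ((\<lambda>t. (t, y)) x))" by simp
  moreover have "((\<lambda>t. (t, y)) has_derivative (\<lambda>h. (h, 0))) (at x)"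
    by (auto intro!: derivative_eq_intros)
  ultimately have "((\<lambda>t. (\<lambda>(s, t). f s t) (t, y)) has_derivative (\<lambda>h. ?D (h, 0))) (at x)"
    by (rule has_derivative_compose[rotated])
  then show ?thesis by (simp add: has_vector_derivative_def mult.commute)
qed

text \<open>The combination is constant in x because \<open>c1 - 2 (1 + y^2) b1 - y a1\<close> is 2
  sqrt 5 (1 + y^2) times the \<open>X\<alpha>\<close> coefficient of the derivative of f: the
  \<open>X0\<close> terms cancel and only those with x^2 - y^2 survive.\<close>

lemma A_eq:
  assumes x: "x > 0"
  shows "f x y - A y = (1 / (2 * sqrt 5 * sqrt (1 + y\<^sup>2))) *\<^sub>R (n x y - (2 * sqrt (1 + y\<^sup>2)) *\<^sub>R \<xi> x y)"
proof -
  define q where "q = sqrt (1 + y\<^sup>2)"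
  have q: "q > 0" "1 + y\<^sup>2 = q * q" by (simp_all add: q_def add_pos_nonneg)
  let ?g = "\<lambda>x y. f x y - (1 / (2 * sqrt 5 * (1 + y ^ 2))) *\<^sub>R
       (X\<beta> x y - (2 * (1 + y ^ 2)) *\<^sub>R \<xi> x y + y *\<^sub>R \<phi> x y)"
  have "A y = ?g x y"
    unfolding A_center_def
  proof (rule x_independent_value_eq[OF _ x])
    fix z :: real assume z: "z > 0"
    define e where "e = (z\<^sup>2 - y\<^sup>2) / (z * hfun z y)"
    have "((\<lambda>t. ?g t y) has_vector_derivative e *\<^sub>R X\<alpha> z y - (1 / (2 * sqrt 5 * (1 + y ^ 2))) *\<^sub>R
        (c1 z y *\<^sub>R X\<alpha> z y - (2 * (1 + y\<^sup>2)) *\<^sub>R (b1 z y *\<^sub>R X\<alpha> z y) + y *\<^sub>R (- a1 z y *\<^sub>R X\<alpha> z y))) (at z)"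
      unfolding e_def
      by (intro has_vector_derivative_diff has_vector_derivative_add f_deriv[OF z] frame_deriv_x[OF z]
        bounded_linear.has_vector_derivative[OF bounded_linear_scaleR_right])
    moreover have "c1 z y - 2 * (1 + y\<^sup>2) * b1 z y - y * a1 z y = (2 * sqrt 5 * (1 + y\<^sup>2)) * e"
      using z hfun_pos[OF z, of y] unfolding c1_def b1_def a1_def e_def
      by (simp add: field_simps power2_eq_square)
    then have "(1 / (2 * sqrt 5 * (1 + y\<^sup>2))) * (c1 z y - 2 * (1 + y\<^sup>2) * b1 z y - y * a1 z y) = e"
      using q by simp
    then have "e *\<^sub>R X\<alpha> z y = (1 / (2 * sqrt 5 * (1 + y ^ 2))) *\<^sub>R
        (c1 z y *\<^sub>R X\<alpha> z y - (2 * (1 + y\<^sup>2)) *\<^sub>R (b1 z y *\<^sub>R X\<alpha> z y) + y *\<^sub>R (- a1 z y *\<^sub>R X\<alpha> z y))"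
    proof -
      have "k *\<^sub>R (p *\<^sub>R e - m *\<^sub>R (q *\<^sub>R e) + y *\<^sub>R (- r *\<^sub>R e)) = (k * (p - m * q - y * r)) *\<^sub>R e"
        for k p m q r and e :: "real^4" by (simp add: algebra_simps)
      from this[of "1 / (2 * sqrt 5 * (1 + y\<^sup>2))" "c1 z y" "X\<alpha> z y" "2 * (1 + y\<^sup>2)" "b1 z y" "a1 z y"]
      show ?thesis
        using \<open>(1 / (2 * sqrt 5 * (1 + y\<^sup>2))) * (c1 z y - 2 * (1 + y\<^sup>2) * b1 z y - y * a1 z y) = e\<close>
        by (simp only:)
    qed
    ultimately show "((\<lambda>t. ?g t y) has_vector_derivative 0) (at z)" by simp
  qed
  then have "f x y - A y = (1 / (2 * sqrt 5 * (q * q))) *\<^sub>R (X\<beta> x y - (2 * (q * q)) *\<^sub>R \<xi> x y + y *\<^sub>R \<phi> x y)"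
    by (simp add: q(2))
  moreover have "X\<beta> x y + y *\<^sub>R \<phi> x y = q *\<^sub>R n x y" using q(1) by (simp add: n_vec_def q_def)
  then have "X\<beta> x y - (2 * (q * q)) *\<^sub>R \<xi> x y + y *\<^sub>R \<phi> x y = q *\<^sub>R (n x y - (2 * q) *\<^sub>R \<xi> x y)"
    by (simp add: algebra_simps)
  ultimately show ?thesis using q(1) unfolding q_def[symmetric] by simp
qed

definition circ :: "real^4 \<Rightarrow> real^4 \<Rightarrow> real \<Rightarrow> real \<Rightarrow> real^4" where
  "circ b' c' x y = - (1 / (2 * sqrt 5 * sqrt (1 + y ^ 2))) *\<^sub>R
     (v1 y + (2 * sqrt (1 + y ^ 2)) *\<^sub>R b_bar b' c' x) + A y"

text \<open>The limit vectors found at y = 0 serve all y, since the variation of \<xi> and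
  \<open>X\<alpha>\<close> in y is O(1/x) on bounded intervals. For f, \<open>A_eq\<close> reduces
  the convergence to that of \<open>n\<close> and \<xi>.\<close>

lemma limit_circles:
  obtains b' c' where "orthonormal_list [b', c']" "span {b', c'} = span {b, c}"
    "converges_locally_uniformly \<xi> (\<lambda>x y. b_bar b' c' x)"
    "converges_locally_uniformly X\<alpha> (\<lambda>x y. c_bar b' c' x)"
    "\<And>x y. circ b' c' x y \<in> S2 \<phi> X\<beta> \<xi> f y"
    "converges_locally_uniformly f (circ b' c')"
proof -
  obtain B0 C0 where lim\<xi>: "((\<lambda>x. \<xi> x 0 - b_bar B0 C0 x) \<longlongrightarrow> 0) at_top"
    and limX\<alpha>: "((\<lambda>x. X\<alpha> x 0 - c_bar B0 C0 x) \<longlongrightarrow> 0) at_top"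
    and on: "orthonormal_list [u 0, v1 0, B0, C0]" by (rule frame_limits_at_0)
  have onBC: "B0 \<bullet> B0 = 1" "C0 \<bullet> C0 = 1" "B0 \<bullet> C0 = 0"
    and perp: "B0 \<bullet> u 0 = 0" "C0 \<bullet> u 0 = 0" "B0 \<bullet> v1 0 = 0" "C0 \<bullet> v1 0 = 0"
    using on unfolding orthonormal_list4 by (simp_all add: inner_commute)
  have combo: "e = (e \<bullet> b) *\<^sub>R b + (e \<bullet> c) *\<^sub>R c" if "e \<bullet> u 0 = 0" "e \<bullet> v1 0 = 0" for e
    using orthonormal4_expand[OF fixed_orthonormal, of e 0] that by simp
  have combo': "e = (e \<bullet> B0) *\<^sub>R B0 + (e \<bullet> C0) *\<^sub>R C0" if "e \<bullet> u 0 = 0" "e \<bullet> v1 0 = 0" for e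
    using orthonormal4_expand[OF on, of e] that by simp
  have in_span: "s *\<^sub>R a + t *\<^sub>R d \<in> span {a, d}" for s t and a d :: "real^4"
    by (intro span_add span_scale span_base) auto
  have spans: "span {B0, C0} = span {b, c}"
    \<comment> \<open>Both pairs complete \<open>u 0\<close>, \<open>v1 0\<close> to an orthonormal
      basis, so they span the same plane.\<close>
    unfolding span_eq
    using in_span combo[OF perp(1,3)] combo[OF perp(2,4)]
      combo'[OF limit_pair_orthogonal(1,3)] combo'[OF limit_pair_orthogonal(2,4)] by (metis empty_subsetI insert_subset)
  \<comment> \<open>Orthogonality is known for \<open>B0\<close>, \<open>C0\<close> only at y = 0;
    expanding them in \<open>b\<close>, \<open>c\<close> carries it to every y.\<close>
  have perp_all: "b_bar B0 C0 x \<bullet> u y = 0" "b_bar B0 C0 x \<bullet> v1 y = 0" for x y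
    unfolding b_bar_def
    by (subst combo[OF perp(1,3)], subst combo[OF perp(2,4)],
        simp add: inner_add_left inner_diff_left limit_pair_orthogonal)+
  have bb: "b_bar B0 C0 x \<bullet> b_bar B0 C0 x = 1" for x
    using sin_cos_squared_add3[of "wfun x"]
    by (simp add: b_bar_def inner_diff_left inner_diff_right onBC inner_commute[of C0 B0] algebra_simps)
  obtain M where M: "M \<ge> 0"
    "\<And>x y Y. x \<ge> 1 \<Longrightarrow> \<bar>y\<bar> \<le> Y \<Longrightarrow> norm (\<xi> x y - \<xi> x 0) \<le> M * Y\<^sup>2 / x"
    "\<And>x y Y. x \<ge> 1 \<Longrightarrow> \<bar>y\<bar> \<le> Y \<Longrightarrow> norm (X\<alpha> x y - X\<alpha> x 0) \<le> M * Y\<^sup>2 / x"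
    by (rule frame_y_variation) blast
  have conv\<xi>: "converges_locally_uniformly \<xi> (\<lambda>x y. b_bar B0 C0 x)"
    by (rule converges_locally_uniformlyI, rule locally_uniform_from_0[where G = \<xi> and g = "b_bar B0 C0", OF lim\<xi> M(2)])
  have convX\<alpha>: "converges_locally_uniformly X\<alpha> (\<lambda>x y. c_bar B0 C0 x)"
    by (rule converges_locally_uniformlyI, rule locally_uniform_from_0[where G = X\<alpha> and g = "c_bar B0 C0", OF limX\<alpha> M(3)])
  let ?circ = "circ B0 C0"
  have circS2: "?circ x y \<in> S2 \<phi> X\<beta> \<xi> f y" for x y
  proof -
    define q where "q = sqrt (1 + y\<^sup>2)"
    have q: "q > 0" "1 + y\<^sup>2 = q * q" by (simp_all add: q_def add_pos_nonneg)
    have d: "?circ x y - A y = - (1 / (2 * sqrt 5 * q)) *\<^sub>R (v1 y + (2 * q) *\<^sub>R b_bar B0 C0 x)"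
      by (simp add: circ_def q_def)
    have "(?circ x y - A y) \<bullet> u y = 0"
      unfolding d using v1_u[of y] perp_all(1)[of x y] by (simp add: inner_add_right inner_commute[of _ "u y"])
    moreover have "dist (?circ x y) (A y) = 1 / (2 * sqrt 5) * sqrt ((5 + 4 * y\<^sup>2) / (1 + y\<^sup>2))"
    proof -
      have "(v1 y + (2 * q) *\<^sub>R b_bar B0 C0 x) \<bullet> (v1 y + (2 * q) *\<^sub>R b_bar B0 C0 x) = 1 + 4 * (q * q)"
        using perp_all(2)[of x y]
        by (simp add: inner_add_left inner_add_right v1_norm bb inner_commute[of "v1 y"] algebra_simps)
      also have "\<dots> = 5 + 4 * y\<^sup>2" unfolding q(2)[symmetric] by simp
      finally have "norm (v1 y + (2 * q) *\<^sub>R b_bar B0 C0 x) = sqrt (5 + 4 * y\<^sup>2)" by (simp add: norm_eq_sqrt_inner)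
      then have "dist (?circ x y) (A y) = 1 / (2 * sqrt 5 * q) * sqrt (5 + 4 * y\<^sup>2)"
        unfolding dist_norm d using q(1) by simp
      then show ?thesis by (simp add: real_sqrt_divide q_def)
    qed
    ultimately show ?thesis by (simp add: S2_def)
  qed
  have convf: "converges_locally_uniformly f ?circ"
  proof (rule converges_locally_uniformlyI)
    fix Y :: real assume Y: "Y \<ge> 0"
    obtain N where N: "N \<ge> 0" "\<And>x y. x \<ge> 1 \<Longrightarrow> norm (n x y + v x y) \<le> N * (1 + y\<^sup>2) / x"
      using n_plus_v_bound by blast
    obtain e where e: "(e \<longlongrightarrow> 0) at_top" "\<And>x y. x \<ge> 1 \<Longrightarrow> \<bar>y\<bar> \<le> Y \<Longrightarrow> norm (\<xi> x y - b_bar B0 C0 x) \<le> e x"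
      using locally_uniform_from_0[where G = \<xi> and g = "b_bar B0 C0", OF lim\<xi> M(2), of Y] by blast
    have "((\<lambda>x. N * (1 + Y\<^sup>2) / x) \<longlongrightarrow> 0) at_top"
      by (intro tendsto_divide_0[OF tendsto_const] filterlim_at_top_imp_at_infinity filterlim_ident)
    from tendsto_add[OF this e(1)] have lim: "((\<lambda>x. N * (1 + Y\<^sup>2) / x + e x) \<longlongrightarrow> 0) at_top" by simp
    have "norm (f x y - ?circ x y) \<le> N * (1 + Y\<^sup>2) / x + e x" if x1: "x \<ge> 1" and y: "\<bar>y\<bar> \<le> Y" for x y
    proof -
      have x: "x > 0" using x1 by simp
      define q where "q = sqrt (1 + y\<^sup>2)"
      have q: "q \<ge> 1" by (simp add: q_def)
      define k where "k = 1 / (2 * sqrt 5 * q)"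
      have s5: "1 \<le> sqrt 5" by simp
      have "1 \<le> 2 * sqrt 5" using s5 by linarith
      then have "1 * 1 \<le> (2 * sqrt 5) * q" using q by (intro mult_mono) auto
      then have k: "0 \<le> k" "k \<le> 1" using q by (simp_all add: k_def)
      \<comment> \<open>This fixes the coefficient of \<xi> independently of y.\<close>
      have kq: "k * (2 * q) = 1 / sqrt 5" using q by (simp add: k_def)
      have "f x y - ?circ x y = (f x y - A y) + k *\<^sub>R (v1 y + (2 * q) *\<^sub>R b_bar B0 C0 x)"
        by (simp add: circ_def k_def q_def)
      also have "\<dots> = k *\<^sub>R (n x y + v1 y) - (k * (2 * q)) *\<^sub>R (\<xi> x y - b_bar B0 C0 x)"
        unfolding A_eq[OF x] q_def[symmetric] k_def[symmetric] by (simp add: algebra_simps)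
      finally have "norm (f x y - ?circ x y) \<le> k * norm (n x y + v1 y) + 1 / sqrt 5 * norm (\<xi> x y - b_bar B0 C0 x)"
        unfolding kq using norm_triangle_ineq4[of "k *\<^sub>R (n x y + v1 y)" "(1 / sqrt 5) *\<^sub>R (\<xi> x y - b_bar B0 C0 x)"] k
        by simp
      also have "\<dots> \<le> 1 * (N * (1 + Y\<^sup>2) / x) + 1 * e x"
      proof (intro add_mono mult_mono k)
        have "y\<^sup>2 \<le> Y\<^sup>2" using y Y abs_le_square_iff[of y Y] by simp
        then have "N * (1 + y\<^sup>2) / x \<le> N * (1 + Y\<^sup>2) / x"
          using N(1) x by (intro divide_right_mono mult_left_mono) auto
        then show "norm (n x y + v1 y) \<le> N * (1 + Y\<^sup>2) / x" using N(2)[OF x1, of y] v1_eq[OF x, of y] by simp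
        show "norm (\<xi> x y - b_bar B0 C0 x) \<le> e x" by (rule e(2)[OF x1 y])
        show "1 / sqrt 5 \<le> 1" using s5 by simp
      qed simp_all
      finally show ?thesis by simp
    qed
    then show "\<exists>g. (g \<longlongrightarrow> 0) at_top \<and> (\<forall>x\<ge>1. \<forall>y. \<bar>y\<bar> \<le> Y \<longrightarrow> norm (f x y - ?circ x y) \<le> g x)"
      using lim by blast
  qed
  have "orthonormal_list [B0, C0]" using onBC by (simp add: orthonormal_list2)
  then show thesis using that spans conv\<xi> convX\<alpha> circS2 convf by blast
qed

end

theorem theorem4p7:
  fixes \<phi> X\<alpha> X\<beta> \<xi> f :: "real \<Rightarrow> real \<Rightarrow> real^4"
    and v1 :: "real \<Rightarrow> real^4"
    and b_inf c_inf :: "real^4"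
  assumes frame: "frame_field \<phi> X\<alpha> X\<beta> \<xi>"
    and surface: "curvature_surface X\<alpha> X\<beta> f"
    and v1: "is_v1 \<phi> X\<beta> v1"
    and limit_pair: "is_limit_pair X\<alpha> b_inf c_inf"
  shows
    "(\<forall>y. infinite_length (\<lambda>x. n_vec \<phi> X\<beta> x y) \<and>
          ((\<lambda>x. n_vec \<phi> X\<beta> x y) \<longlongrightarrow> - v1 y) at_top \<and>
          winds_uniformly_around (\<lambda>x. n_vec \<phi> X\<beta> x y) (- v1 y) b_inf c_inf \<and>
          (\<forall>x>0. n_vec \<phi> X\<beta> x y \<noteq> - v1 y)) \<and>
     (\<exists>b c. orthonormal_list [b, c] \<and> span {b, c} = span {b_inf, c_inf} \<and>
        converges_locally_uniformly \<xi> (\<lambda>x y. b_bar b c x) \<and>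
        converges_locally_uniformly X\<alpha> (\<lambda>x y. c_bar b c x) \<and>
        (let circ = (\<lambda>x y. - (1 / (2 * sqrt 5 * sqrt (1 + y ^ 2))) *\<^sub>R
                        (v1 y + (2 * sqrt (1 + y ^ 2)) *\<^sub>R b_bar b c x)
                      + A_center \<phi> X\<beta> \<xi> f y)
         in (\<forall>x>0. \<forall>y. circ x y \<in> S2 \<phi> X\<beta> \<xi> f y) \<and>
            converges_locally_uniformly f circ))"
proof -
  interpret surface \<phi> X\<alpha> X\<beta> \<xi> v1 b_inf c_inf f
    by unfold_locales (fact frame v1 limit_pair surface)+
  obtain b c where bc: "orthonormal_list [b, c]" "span {b, c} = span {b_inf, c_inf}"
    "converges_locally_uniformly \<xi> (\<lambda>x y. b_bar b c x)"
    "converges_locally_uniformly X\<alpha> (\<lambda>x y. c_bar b c x)"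
    "\<And>x y. circ b c x y \<in> S2 \<phi> X\<beta> \<xi> f y"
    "converges_locally_uniformly f (circ b c)" by (rule limit_circles) blast
  show ?thesis
    using n_infinite_length n_tendsto n_winds n_ne bc(1-4) bc(5,6)[unfolded circ_def[abs_def]]
    unfolding Let_def by blast
qed

end
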